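(* Let $b,c\in\mathbb{C}$ and $a\in\mathbb{C}\setminus\{0\}$. Then all the weak solutions $\psi\in L^1_{\mathrm{loc}}(\mathbb{R}^2;\mathbb{R})$ of $$-\Delta\psi=|az^2+bz+c|^2e^\psi$$ in $\mathbb{R}^2$ with $\int_{\mathbb{R}^2}|az^2+bz+c|^2e^\psi<\infty$ are of the form $$\psi=\log(8)-2\log(|P|^2+|Q|^2),$$ where $P=\lambda P_0+\mu Q_0$, $Q=\frac1\lambda Q_0$ for some $\mu\in\mathbb{C}$, $\lambda\in\mathbb{C}\setminus\{0\}$, and the polynomials $P_0,Q_0$ are of one of the following forms: (i) (with $a\in\mathbb{C}\setminus\{0\}$, $b,c\in\mathbb{C}$ arbitrary) $P_0=\frac a3z^3+\frac b2z^2+cz$ and $Q_0=1$; (ii) (only if $c\ne\frac{b^2}{4a}$) $P_0=z^2-\frac ca$ and $Q_0=az+\frac b2$.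
   Context: $\mathbb{R}^2$ is identified with $\mathbb{C}$ via $z=x+\mathrm{i}y$; weak solution means solution in the sense of distributions. *)

theory Defs
  imports "HOL-Analysis.Analysis" "HOL-Computational_Algebra.Polynomial"
begin

primrec C_k :: "nat \<Rightarrow> ('a::euclidean_space \<Rightarrow> real) \<Rightarrow> bool" where
  "C_k 0 f \<longleftrightarrow> continuous_on UNIV f"
| "C_k (Suc k) f \<longleftrightarrow>
     (\<forall>x. f differentiable (at x)) \<and> (\<forall>v. C_k k (\<lambda>x. frechet_derivative f (at x) v))"

definition test_function :: "('a::euclidean_space \<Rightarrow> real) \<Rightarrow> bool" where
  "test_function \<phi> \<longleftrightarrow> (\<forall>k. C_k k \<phi>) \<and> compact (closure {x. \<phi> x \<noteq> 0})"

definition laplacian :: "('a::euclidean_space \<Rightarrow> real) \<Rightarrow> 'a \<Rightarrow> real" where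
  "laplacian \<phi> x =
     (\<Sum>v\<in>Basis. frechet_derivative (\<lambda>y. frechet_derivative \<phi> (at y) v) (at x) v)"

definition L1_loc :: "('a::euclidean_space \<Rightarrow> real) \<Rightarrow> bool" where
  "L1_loc u \<longleftrightarrow> (\<forall>K. compact K \<longrightarrow> u absolutely_integrable_on K)"

(* -Laplacian u = g on the whole space in the sense of distributions. The conjunct
   L1_loc g makes g a distribution; without it, the Bochner integral of g * phi could be
   the default value 0. *)
definition weak_solution_neg_laplacian ::
    "('a::euclidean_space \<Rightarrow> real) \<Rightarrow> ('a \<Rightarrow> real) \<Rightarrow> bool" where
  "weak_solution_neg_laplacian u g \<longleftrightarrow> L1_loc u \<and> L1_loc g \<and>
     (\<forall>\<phi>. test_function \<phi> \<longrightarrow>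
        - (\<integral>x. u x * laplacian \<phi> x \<partial>lebesgue) = (\<integral>x. g x * \<phi> x \<partial>lebesgue))"

end

theory Submission
  imports Defs "HOL-Complex_Analysis.Complex_Analysis"
begin

text \<open>
  Write \<open>R = a z\<^sup>2 + b z + c\<close> and \<open>g = |R|\<^sup>2 e\<^sup>\<psi>\<close>. A Liouville argument for mollifications shows that
  \<open>\<psi>\<close> is a constant plus the logarithmic potential of the finite measure \<open>g\<close>. Exponential
  integrability of this potential (Brezis and Merle, via Jensen's inequality) and the finiteness of
  the mass bound it, give the decay of \<open>g\<close> at infinity, and bootstrapping makes it smooth.

  With \<open>\<phi> = \<psi>\<^sub>z\<close>, the function \<open>T = R (\<phi>\<^sub>z - \<phi>\<^sup>2 / 2) - R' \<phi>\<close> is entire by the equation, and constant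
  by the decay. Hence \<open>y = e\<^bsup>-\<psi>/2\<^esup>\<close> solves the linear equation \<open>R y'' - R' y' + (T / 2) y = 0\<close> in the
  variable \<open>z\<close>. At a zero of \<open>R\<close> this forces \<open>T = 0\<close> or \<open>T = 4 a\<close>, and in both cases there is a basis of
  polynomial solutions \<open>P\<^sub>0, Q\<^sub>0\<close>. As \<open>y\<close> is real, it is a hermitian form in this basis; the equation
  determines its determinant, and completing the square gives the assertion.
\<close>

section \<open>Smooth functions and bump functions\<close>

text \<open>A distributional solution comes without pointwise bounds. The only upper bound on psi is
  psi <= e^psi <= g where |R| >= 1, so convolutions with nonnegative test functions are controlled
  from above only, by a logarithm. This is enough, since a harmonic function with such a one-sided
  bound is constant. The exponents below come from one count. If g decays like |z|^(-1-d) with 0 < d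
  < 1, then psi_z decays like |z|^(-d) and T grows at most like |z|^(2-2d), so any d > 1/2 forces T
  to be constant. Finite mass makes psi fall at least like -6 ln |z|, up to arbitrarily small
  losses, and |R|^2 grows like |z|^4, so every d < 1 is available; d = 4/5 is used. The zeros of R
  are the obstacle for the algebra: adding ln |R|^2 to psi gives the classical Liouville equation,
  but with singularities there. The identities for T and y are therefore kept in a form multiplied
  by R. They then hold at the zeros too, and it is at a zero that they determine T.\<close>

abbreviation fd :: "('a::euclidean_space \<Rightarrow> real) \<Rightarrow> 'a \<Rightarrow> 'a \<Rightarrow> real" where
  "fd f v x \<equiv> frechet_derivative f (at x) v"

lemma fd_eq:
  assumes "(f has_derivative f') (at x)"
  shows "fd f v x = f' v"
  using frechet_derivative_at[OF assms] by simp

lemma fd_has_derivative: "f differentiable (at x) \<Longrightarrow> (f has_derivative (\<lambda>v. fd f v x)) (at x)"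
  by (simp add: frechet_derivative_works)

lemma C_k_SucI:
  assumes "\<And>x. (f has_derivative f' x) (at x)" "\<And>v. C_k k (\<lambda>x. f' x v)"
  shows "C_k (Suc k) f"
proof -
  have "(\<lambda>x. fd f v x) = (\<lambda>x. f' x v)" for v
    using fd_eq[OF assms(1)] by auto
  then show ?thesis using assms by (auto simp: differentiable_def)
qed

lemma C_k_SucD:
  assumes "C_k (Suc k) f"
  shows "(f has_derivative (\<lambda>v. fd f v x)) (at x)" "C_k k (fd f v)"
  using assms by (auto intro: fd_has_derivative)

lemma C_k_Suc_imp: "C_k (Suc k) f \<Longrightarrow> C_k k f"
proof (induction k arbitrary: f)
  case 0
  then show ?case
    by (auto intro!: continuous_at_imp_continuous_on differentiable_imp_continuous_within)
next
  case (Suc k)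
  have "\<forall>v. C_k k (fd f v)" using Suc.IH Suc.prems by (metis C_k.simps(2))
  then show ?case using Suc.prems by (metis C_k.simps(2))
qed

lemma C_k_le: "C_k k f \<Longrightarrow> j \<le> k \<Longrightarrow> C_k j f"
proof (induction k)
  case (Suc k)
  then show ?case using C_k_Suc_imp by (cases "j = Suc k") auto
qed simp

lemma C_k_imp_continuous: "C_k k f \<Longrightarrow> continuous_on UNIV f"
  using C_k_le[of k f 0] by simp

lemma C_k_const [intro]: "C_k k (\<lambda>x. c)"
proof (induction k arbitrary: c)
  case (Suc k)
  show ?case by (rule C_k_SucI[of _ "\<lambda>x v. 0"]) (use Suc in \<open>auto intro!: derivative_eq_intros\<close>)
qed auto

lemma C_k_linear:
  assumes "bounded_linear f" shows "C_k k f"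
proof (cases k)
  case 0 then show ?thesis using assms by (simp add: linear_continuous_on)
next
  case (Suc j)
  show ?thesis unfolding Suc
    by (rule C_k_SucI[of _ "\<lambda>x. f"]) (use assms in \<open>auto intro: bounded_linear_imp_has_derivative\<close>)
qed

lemma C_k_add [intro]: "C_k k f \<Longrightarrow> C_k k g \<Longrightarrow> C_k k (\<lambda>x. f x + g x)"
proof (induction k arbitrary: f g)
  case 0 then show ?case by (auto intro: continuous_intros)
next
  case (Suc k)
  show ?case
    by (rule C_k_SucI[of _ "\<lambda>x v. fd f v x + fd g v x"])
       (use Suc in \<open>auto intro!: derivative_intros Suc.IH fd_has_derivative\<close>)
qed

lemma C_k_mult [intro]: "C_k k f \<Longrightarrow> C_k k g \<Longrightarrow> C_k k (\<lambda>x. f x * g x)"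
proof (induction k arbitrary: f g)
  case 0 then show ?case by (auto intro: continuous_intros)
next
  case (Suc k)
  have *: "C_k k f" "C_k k g" using Suc.prems C_k_Suc_imp by blast+
  show ?case
  proof (rule C_k_SucI[of _ "\<lambda>x v. f x * fd g v x + fd f v x * g x"])
    show "((\<lambda>x. f x * g x) has_derivative (\<lambda>v. f x * fd g v x + fd f v x * g x)) (at x)" for x
      using Suc.prems by (auto intro!: has_derivative_mult fd_has_derivative)
    show "C_k k (\<lambda>x. f x * fd g v x + fd f v x * g x)" for v
      using Suc * by (intro C_k_add Suc.IH) auto
  qed
qed

lemma C_k_cmult [intro]: "C_k k f \<Longrightarrow> C_k k (\<lambda>x. c * f x)"
  by (intro C_k_mult C_k_const)

lemma C_k_minus [intro]: "C_k k f \<Longrightarrow> C_k k (\<lambda>x. - f x)"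
  using C_k_cmult[of k f "-1"] by simp

lemma C_k_diff [intro]: "C_k k f \<Longrightarrow> C_k k g \<Longrightarrow> C_k k (\<lambda>x. f x - g x)"
  using C_k_add[of k f "\<lambda>x. - g x"] by auto

lemma C_k_power [intro]: "C_k k f \<Longrightarrow> C_k k (\<lambda>x. f x ^ n)"
  by (induction n) auto

text \<open>The whole chain \<open>F\<close> of derivatives is carried along: the derivative of
  \<open>F j\<close> composed with \<open>f\<close> brings in \<open>F (Suc j)\<close>, so the
  induction closes once \<open>j\<close> is general.\<close>

lemma C_k_compose:
  assumes F: "\<And>j t. (F j has_real_derivative F (Suc j) t) (at t)"
  shows "C_k k f \<Longrightarrow> C_k k (\<lambda>x. F j (f x))"
proof (induction k arbitrary: j f)
  case 0
  have "continuous_on UNIV (F j)"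
    using F by (meson DERIV_isCont continuous_at_imp_continuous_on)
  then show ?case using 0 by (auto intro: continuous_on_compose2)
next
  case (Suc k)
  have *: "C_k k f" using Suc.prems C_k_Suc_imp by blast
  show ?case
  proof (rule C_k_SucI[of _ "\<lambda>x v. F (Suc j) (f x) * fd f v x"])
    show "((\<lambda>x. F j (f x)) has_derivative (\<lambda>v. F (Suc j) (f x) * fd f v x)) (at x)" for x
      using has_derivative_compose[OF C_k_SucD(1)[OF Suc.prems] F[of j "f x", unfolded has_field_derivative_def]] by simp
    show "C_k k (\<lambda>x. F (Suc j) (f x) * fd f v x)" for v
      using Suc * by (intro C_k_mult Suc.IH) auto
  qed
qed

lemma C_k_exp [intro]: "C_k k f \<Longrightarrow> C_k k (\<lambda>x. exp (f x))"
  using C_k_compose[of "\<lambda>_. exp" k f 0] by (auto intro: DERIV_exp)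

text \<open>The derivative is written as a product of \<open>1 / f\<close> with itself and a
  derivative of \<open>f\<close>, so the induction hypothesis and closure under products
  suffice.\<close>

lemma C_k_inverse:
  assumes "\<And>x. f x \<noteq> 0"
  shows "C_k k f \<Longrightarrow> C_k k (\<lambda>x. 1 / f x)"
proof (induction k)
  case 0 then show ?case using assms by (auto intro!: continuous_intros)
next
  case (Suc k)
  have *: "C_k k f" using Suc.prems C_k_Suc_imp by blast
  show ?case
  proof (rule C_k_SucI[of _ "\<lambda>x v. - (fd f v x * ((1 / f x) * (1 / f x)))"])
    show "((\<lambda>x. 1 / f x) has_derivative (\<lambda>v. - (fd f v x * ((1 / f x) * (1 / f x))))) (at x)" for x
      using assms Suc.prems
      by (auto intro!: derivative_eq_intros fd_has_derivative simp: field_simps)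
    show "C_k k (\<lambda>x. - (fd f v x * ((1 / f x) * (1 / f x))))" for v
      using Suc * by (intro C_k_mult C_k_minus) auto
  qed
qed

lemma C_k_reflect:
  shows "C_k k f \<Longrightarrow> C_k k (\<lambda>x. f (z - x))"
proof (induction k arbitrary: f)
  case 0 then show ?case by (auto intro!: continuous_on_compose2[of UNIV f] continuous_intros)
next
  case (Suc k)
  show ?case
  proof (rule C_k_SucI[of _ "\<lambda>x v. - fd f v (z - x)"])
    fix x
    have "((\<lambda>x. z - x) has_derivative (\<lambda>v. - v)) (at x)" by (auto intro!: derivative_eq_intros)
    from has_derivative_compose[OF this C_k_SucD(1)[OF Suc.prems]]
    have "((\<lambda>x. f (z - x)) has_derivative (\<lambda>v. fd f (- v) (z - x))) (at x)" .
    moreover have "fd f (- v) (z - x) = - fd f v (z - x)" for v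
      using has_derivative_linear[OF C_k_SucD(1)[OF Suc.prems, of "z - x"]] by (simp add: linear_neg)
    ultimately show "((\<lambda>x. f (z - x)) has_derivative (\<lambda>v. - fd f v (z - x))) (at x)" by simp
  next
    show "C_k k (\<lambda>x. - fd f v (z - x))" for v
      using Suc.prems by (intro C_k_minus Suc.IH) auto
  qed
qed

lemma fd_reflect:
  assumes "C_k (Suc k) f"
  shows "fd (\<lambda>x. f (z - x)) v x = - fd f v (z - x)"
proof -
  have "((\<lambda>x. z - x) has_derivative (\<lambda>v. - v)) (at x)" by (auto intro!: derivative_eq_intros)
  from has_derivative_compose[OF this C_k_SucD(1)[OF assms]]
  have "fd (\<lambda>x. f (z - x)) v x = fd f (- v) (z - x)" by (rule fd_eq)
  moreover have "fd f (- v) (z - x) = - fd f v (z - x)"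
    using has_derivative_linear[OF C_k_SucD(1)[OF assms, of "z - x"]] by (simp add: linear_neg)
  ultimately show ?thesis by simp
qed

lemma fd_linear:
  assumes "C_k (Suc k) f"
  shows "linear (\<lambda>v. fd f v x)"
  using has_derivative_linear[OF C_k_SucD(1)[OF assms]] .

text \<open>Clairaut's theorem. The second difference of \<open>f\<close> over a small parallelogram
  with sides \<open>s v\<close> and \<open>s w\<close>, divided by \<open>s^2\<close>, is by two
  applications of the mean value theorem a value of the mixed derivative at a nearby point. The
  second difference is symmetric in \<open>v\<close> and \<open>w\<close>, so the two mixed
  derivatives are limits of the same sequence.\<close>

lemma fd_symmetric:
  assumes f: "C_k 2 f"
  shows "fd (fd f v) w x = fd (fd f w) v x"
proof -
  have f1: "C_k (Suc 0) f" by (rule C_k_le[OF f]) simp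
  have fv: "C_k (Suc 0) (fd f v)" for v using C_k_SucD(2)[of 1 f] f by (simp add: numeral_2_eq_2)
  have line: "((\<lambda>t. h (p + t *\<^sub>R u)) has_real_derivative fd h u (p + t *\<^sub>R u)) (at t)"
    if h: "C_k (Suc 0) h" for h :: "'a \<Rightarrow> real" and p u t
  proof -
    have "((\<lambda>t. p + t *\<^sub>R u) has_derivative (\<lambda>s. s *\<^sub>R u)) (at t)" by (auto intro!: derivative_eq_intros)
    from has_derivative_compose[OF this C_k_SucD(1)[OF h]]
    show ?thesis by (simp add: has_field_derivative_def linear_scale[OF fd_linear[OF h]] mult.commute[of _ "fd h u _"])
  qed
  have step: "\<exists>\<sigma> \<tau>. 0 < \<sigma> \<and> \<sigma> < s \<and> 0 < \<tau> \<and> \<tau> < s \<and>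
     f (x + s *\<^sub>R v + s *\<^sub>R w) - f (x + s *\<^sub>R v) - f (x + s *\<^sub>R w) + f x
       = s * (s * fd (fd f v) w (x + \<sigma> *\<^sub>R v + \<tau> *\<^sub>R w))" if s: "s > 0" for v w s
  proof -
    define F where "F t = f (x + s *\<^sub>R w + t *\<^sub>R v) - f (x + t *\<^sub>R v)" for t
    have "(F has_real_derivative (fd f v (x + s *\<^sub>R w + t *\<^sub>R v) - fd f v (x + t *\<^sub>R v))) (at t)" for t
      unfolding F_def by (intro DERIV_diff line[OF f1])
    from MVT2[of 0 s F, OF s this] obtain \<sigma> where \<sigma>: "0 < \<sigma>" "\<sigma> < s"
      "F s - F 0 = s * (fd f v (x + s *\<^sub>R w + \<sigma> *\<^sub>R v) - fd f v (x + \<sigma> *\<^sub>R v))" by auto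
    have "((\<lambda>t. fd f v ((x + \<sigma> *\<^sub>R v) + t *\<^sub>R w)) has_real_derivative
          fd (fd f v) w ((x + \<sigma> *\<^sub>R v) + t *\<^sub>R w)) (at t)" for t by (rule line[OF fv])
    from MVT2[of 0 s, OF s this] obtain \<tau> where \<tau>: "0 < \<tau>" "\<tau> < s"
      "fd f v ((x + \<sigma> *\<^sub>R v) + s *\<^sub>R w) - fd f v (x + \<sigma> *\<^sub>R v)
        = s * fd (fd f v) w ((x + \<sigma> *\<^sub>R v) + \<tau> *\<^sub>R w)" by auto
    show ?thesis using \<sigma> \<tau> unfolding F_def
      by (intro exI[of _ \<sigma>] exI[of _ \<tau>]) (simp add: algebra_simps)
  qed
  have lim: "\<exists>X. X \<longlonglongrightarrow> fd (fd f v) w x \<and> (\<forall>n. X n =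
     (f (x + (1/Suc n) *\<^sub>R v + (1/Suc n) *\<^sub>R w) - f (x + (1/Suc n) *\<^sub>R v) - f (x + (1/Suc n) *\<^sub>R w) + f x)
        * (Suc n)^2)" for v w
  proof -
    have "\<forall>n. \<exists>\<sigma> \<tau>. 0 < \<sigma> \<and> \<sigma> < 1/Suc n \<and> 0 < \<tau> \<and> \<tau> < 1/Suc n \<and>
     f (x + (1/Suc n) *\<^sub>R v + (1/Suc n) *\<^sub>R w) - f (x + (1/Suc n) *\<^sub>R v) - f (x + (1/Suc n) *\<^sub>R w) + f x
       = (1/Suc n) * ((1/Suc n) * fd (fd f v) w (x + \<sigma> *\<^sub>R v + \<tau> *\<^sub>R w))"
      by (intro allI step) auto
    then obtain S T where ST: "\<And>n. 0 < S n \<and> S n < 1/Suc n \<and> 0 < T n \<and> T n < 1/Suc n \<and>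
     f (x + (1/Suc n) *\<^sub>R v + (1/Suc n) *\<^sub>R w) - f (x + (1/Suc n) *\<^sub>R v) - f (x + (1/Suc n) *\<^sub>R w) + f x
       = (1/Suc n) * ((1/Suc n) * fd (fd f v) w (x + S n *\<^sub>R v + T n *\<^sub>R w))"
      by metis
    have z: "(\<lambda>n. 1 / real (Suc n)) \<longlonglongrightarrow> 0"
      using LIMSEQ_inverse_real_of_nat by (simp add: inverse_eq_divide)
    have "S \<longlonglongrightarrow> 0" by (rule tendsto_sandwich[OF _ _ tendsto_const z]) (use ST in \<open>auto intro!: always_eventually less_imp_le\<close>)
    moreover have "T \<longlonglongrightarrow> 0" by (rule tendsto_sandwich[OF _ _ tendsto_const z]) (use ST in \<open>auto intro!: always_eventually less_imp_le\<close>)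
    ultimately have "(\<lambda>n. x + S n *\<^sub>R v + T n *\<^sub>R w) \<longlonglongrightarrow> x + 0 *\<^sub>R v + 0 *\<^sub>R w"
      by (intro tendsto_intros)
    moreover have "isCont (fd (fd f v) w) x"
      using C_k_SucD(2)[OF fv[of v], of w] by (simp add: continuous_on_eq_continuous_at)
    ultimately have "(\<lambda>n. fd (fd f v) w (x + S n *\<^sub>R v + T n *\<^sub>R w)) \<longlonglongrightarrow> fd (fd f v) w x"
      using isCont_tendsto_compose by fastforce
    then show ?thesis
    proof (intro exI conjI allI)
      fix n
      have nz: "(1 / real (Suc n)) * ((1 / real (Suc n)) * c) * (real (Suc n))\<^sup>2 = c" for c
        by (simp add: power2_eq_square del: of_nat_Suc)
      show "fd (fd f v) w (x + S n *\<^sub>R v + T n *\<^sub>R w) =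
        (f (x + (1/Suc n) *\<^sub>R v + (1/Suc n) *\<^sub>R w) - f (x + (1/Suc n) *\<^sub>R v) - f (x + (1/Suc n) *\<^sub>R w) + f x)
        * (Suc n)^2"
        unfolding ST[THEN conjunct2, THEN conjunct2, THEN conjunct2, THEN conjunct2]
        using nz by simp
    qed
  qed
  obtain X where X: "X \<longlonglongrightarrow> fd (fd f v) w x" and Xe: "\<And>n. X n =
     (f (x + (1/Suc n) *\<^sub>R v + (1/Suc n) *\<^sub>R w) - f (x + (1/Suc n) *\<^sub>R v) - f (x + (1/Suc n) *\<^sub>R w) + f x)
        * (Suc n)^2" using lim[of v w] by blast
  obtain Y where Y: "Y \<longlonglongrightarrow> fd (fd f w) v x" and Ye: "\<And>n. Y n =
     (f (x + (1/Suc n) *\<^sub>R w + (1/Suc n) *\<^sub>R v) - f (x + (1/Suc n) *\<^sub>R w) - f (x + (1/Suc n) *\<^sub>R v) + f x)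
        * (Suc n)^2" using lim[of w v] by blast
  have "X = Y"
  proof
    fix n
    have "x + (1 / real (Suc n)) *\<^sub>R w + (1 / real (Suc n)) *\<^sub>R v = x + (1 / real (Suc n)) *\<^sub>R v + (1 / real (Suc n)) *\<^sub>R w"
      by simp
    then show "X n = Y n" unfolding Xe Ye by (simp only:) simp
  qed
  then show ?thesis using X Y LIMSEQ_unique by blast
qed

text \<open>Bump functions are built from \<open>exp (-1/t)\<close>, whose derivatives have the form \<open>p (1/t) exp (-1/t)\<close>.\<close>

definition flat_exp :: "real poly \<Rightarrow> real \<Rightarrow> real" where
  "flat_exp p t = (if t > 0 then poly p (1 / t) * exp (- 1 / t) else 0)"

text \<open>With s = 1/t one has d/dt (p(s) e^(-s)) = s^2 (p(s) - p'(s)) e^(-s).\<close>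

definition flat_exp_deriv :: "real poly \<Rightarrow> real poly" where
  "flat_exp_deriv p = [:0, 0, 1:] * (p - pderiv p)"

lemma poly_exp_tendsto_0: "((\<lambda>s. poly p s * exp (- s)) \<longlongrightarrow> 0) (at_top :: real filter)"
proof (induction p)
  case (pCons a p)
  have "((\<lambda>s. s ^ n / exp s) \<longlongrightarrow> 0) (at_top :: real filter)" for n by (rule tendsto_power_div_exp_0)
  have "poly (pCons a p) s * exp (- s) = (\<Sum>i\<le>degree (pCons a p). coeff (pCons a p) i * (s ^ i / exp s))" for s
    by (simp only: poly_altdef sum_distrib_right) (simp add: exp_minus field_simps)
  moreover have "((\<lambda>s. \<Sum>i\<le>degree (pCons a p). coeff (pCons a p) i * (s ^ i / exp s)) \<longlongrightarrow> (\<Sum>i\<le>degree (pCons a p). coeff (pCons a p) i * 0)) (at_top :: real filter)"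
    by (intro tendsto_intros tendsto_power_div_exp_0)
  ultimately show ?case by simp
qed simp

lemma flat_exp_tendsto_0: "(flat_exp p \<longlongrightarrow> 0) (at 0)"
proof -
  have "((\<lambda>t. poly p (inverse t) * exp (- inverse t)) \<longlongrightarrow> 0) (at_right 0)"
    using filterlim_compose[OF poly_exp_tendsto_0 filterlim_inverse_at_top_right] by simp
  then have "(flat_exp p \<longlongrightarrow> 0) (at_right 0)"
    by (rule Lim_transform_eventually)
       (auto simp: flat_exp_def eventually_at_right_field inverse_eq_divide intro!: exI[of _ 1])
  moreover have "(flat_exp p \<longlongrightarrow> 0) (at_left 0)"
    by (rule Lim_transform_eventually[OF tendsto_const])
       (auto simp: flat_exp_def eventually_at_left_field intro!: exI[of _ "-1"])
  ultimately show ?thesis by (simp add: filterlim_at_split)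
qed

lemma flat_exp_has_derivative:
  "(flat_exp p has_real_derivative flat_exp (flat_exp_deriv p) t) (at t)"
proof -
  consider "t > 0" | "t < 0" | "t = 0" by linarith
  then show ?thesis
  proof cases
    case 1
    have "((\<lambda>t. poly p (1 / t) * exp (- 1 / t)) has_real_derivative
        flat_exp (flat_exp_deriv p) t) (at t)"
      using 1 by (auto intro!: derivative_eq_intros poly_DERIV[THEN DERIV_chain2]
          simp: flat_exp_def flat_exp_deriv_def field_simps power2_eq_square)
    then show ?thesis
      by (rule has_field_derivative_transform_within_open[of _ _ _ "{0<..}"]) (use 1 in \<open>auto simp: flat_exp_def\<close>)
  next
    case 2
    have "((\<lambda>t. 0) has_real_derivative flat_exp (flat_exp_deriv p) t) (at t)"
      using 2 by (auto simp: flat_exp_def)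
    then show ?thesis
      by (rule has_field_derivative_transform_within_open[of _ _ _ "{..<0}"]) (use 2 in \<open>auto simp: flat_exp_def\<close>)
  next
    case 3
    \<comment> \<open>At 0 the difference quotient of \<open>flat_exp p\<close> is itself a flat
      function, with the polynomial \<open>[:0, 1:] * p\<close>, because dividing by t multiplies by
      s = 1/t.\<close>
    have "((\<lambda>t. flat_exp p t / t) \<longlongrightarrow> 0) (at 0)"
    proof (rule Lim_transform_eventually[OF flat_exp_tendsto_0[of "[:0, 1:] * p"]])
      show "\<forall>\<^sub>F t in at 0. flat_exp ([:0, 1:] * p) t = flat_exp p t / t"
        by (auto simp: flat_exp_def eventually_at intro!: exI[of _ 1])
    qed
    then show ?thesis using 3 by (simp add: DERIV_def flat_exp_def)
  qed
qed

lemma C_k_flat_exp: "C_k k f \<Longrightarrow> C_k k (\<lambda>x. flat_exp p (f x))"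
proof -
  assume "C_k k f"
  from C_k_compose[of "\<lambda>j. flat_exp ((flat_exp_deriv ^^ j) p)" k f 0, OF _ this]
  show ?thesis using flat_exp_has_derivative by simp
qed

lemma flat_exp_1_pos: "flat_exp 1 t > 0 \<longleftrightarrow> t > 0" and flat_exp_1_nonneg: "flat_exp 1 t \<ge> 0"
  and flat_exp_1_le: "flat_exp 1 t \<le> 1" and flat_exp_1_0: "t \<le> 0 \<Longrightarrow> flat_exp 1 t = 0"
  by (auto simp: flat_exp_def)

lemma flat_exp_1_lim:
  assumes "t > 0" shows "(\<lambda>n. flat_exp 1 (real n * t)) \<longlonglongrightarrow> 1"
proof -
  have "(\<lambda>n. exp (- ((1 / t) * inverse (real n)))) \<longlonglongrightarrow> exp (- ((1/t) * 0))"
    by (intro tendsto_intros lim_inverse_n)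
  then have "(\<lambda>n. exp (- ((1 / t) * inverse (real n)))) \<longlonglongrightarrow> 1" by simp
  then show ?thesis
    by (rule Lim_transform_eventually)
       (use assms in \<open>auto simp: flat_exp_def eventually_sequentially field_simps intro!: exI[of _ 1]\<close>)
qed

text \<open>The number \<open>n\<close> is a sharpening parameter: at distance t > 0 from a face the
  factor e^(-1/(n t)) tends to 1, so the bumps converge pointwise to the indicator of the open box
  while staying below it.\<close>

definition box_bump :: "nat \<Rightarrow> 'a::euclidean_space \<Rightarrow> 'a \<Rightarrow> 'a \<Rightarrow> real" where
  "box_bump n a b x = (\<Prod>i\<in>Basis. flat_exp 1 (real n * (x \<bullet> i - a \<bullet> i)) * flat_exp 1 (real n * (b \<bullet> i - x \<bullet> i)))"

lemma C_k_prod: "(\<And>i. i \<in> I \<Longrightarrow> C_k k (f i)) \<Longrightarrow> C_k k (\<lambda>x. \<Prod>i\<in>I. f i x)"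
  by (induction I rule: infinite_finite_induct) auto

lemma box_bump_nonneg: "box_bump n a b x \<ge> 0"
  by (auto simp: box_bump_def intro!: prod_nonneg mult_nonneg_nonneg flat_exp_1_nonneg)

lemma box_bump_le_1: "box_bump n a b x \<le> 1"
  unfolding box_bump_def
  by (intro prod_le_1) (auto intro!: mult_nonneg_nonneg mult_le_one flat_exp_1_nonneg flat_exp_1_le)

lemma box_bump_outside: "x \<notin> box a b \<Longrightarrow> box_bump n a b x = 0"
proof -
  assume "x \<notin> box a b"
  then obtain i where "i \<in> Basis" "x \<bullet> i \<le> a \<bullet> i \<or> b \<bullet> i \<le> x \<bullet> i" by (auto simp: mem_box not_less)
  then have "flat_exp 1 (real n * (x \<bullet> i - a \<bullet> i)) = 0 \<or> flat_exp 1 (real n * (b \<bullet> i - x \<bullet> i)) = 0"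
    by (auto intro!: flat_exp_1_0 mult_nonneg_nonpos)
  with \<open>i \<in> Basis\<close> show ?thesis by (auto simp: box_bump_def)
qed

lemma box_bump_lim: "(\<lambda>n. box_bump n a b x) \<longlonglongrightarrow> indicator (box a b) x"
proof (cases "x \<in> box a b")
  case True
  have "(\<lambda>n. box_bump n a b x) \<longlonglongrightarrow> (\<Prod>i\<in>(Basis::'a set). 1 * 1)"
    unfolding box_bump_def using True
    by (intro tendsto_prod tendsto_mult flat_exp_1_lim) (auto simp: mem_box)
  then show ?thesis using True by simp
qed (simp add: box_bump_outside)

lemma test_function_box_bump: "test_function (box_bump n a b)"
proof -
  have "C_k k (box_bump n a b)" for k
    unfolding box_bump_def
    by (intro C_k_prod C_k_mult C_k_flat_exp C_k_const C_k_diff C_k_linear bounded_linear_inner_left)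
  moreover have "{x. box_bump n a b x \<noteq> 0} \<subseteq> cbox a b"
    using box_bump_outside box_subset_cbox by blast
  then have "compact (closure {x. box_bump n a b x \<noteq> 0})"
    by (meson bounded_cbox bounded_subset compact_closure)
  ultimately show ?thesis by (simp add: test_function_def)
qed

declare C_k.simps(2) [simp del]

section \<open>Locally integrable functions\<close>

text \<open>The Borel version of \<open>L1_loc\<close>, with \<open>lborel\<close> in place of
  \<open>lebesgue\<close>, so that product measures, Fubini and affine substitutions apply directly.
  Balls around the origin are enough, since every compact set lies in one.\<close>

definition loc_int :: "('a::euclidean_space \<Rightarrow> real) \<Rightarrow> bool" where
  "loc_int h \<longleftrightarrow> h \<in> borel_measurable borel \<and>
     (\<forall>r. integrable lborel (\<lambda>x. indicat_real (cball 0 r) x * h x))"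

lemma integrable_bound_mult:
  fixes f h :: "'a::euclidean_space \<Rightarrow> real"
  assumes h: "integrable lborel h" and f: "f \<in> borel_measurable borel" "\<And>x. \<bar>f x\<bar> \<le> B"
  shows "integrable lborel (\<lambda>x. h x * f x)"
proof (rule Bochner_Integration.integrable_bound)
  show "integrable lborel (\<lambda>x. B * h x)" using h by simp
  show "(\<lambda>x. h x * f x) \<in> borel_measurable lborel"
    using h f(1) borel_measurable_integrable by (intro borel_measurable_times) auto
  show "AE x in lborel. norm (h x * f x) \<le> norm (B * h x)"
  proof (intro AE_I2)
    fix x
    have "\<bar>f x\<bar> \<le> \<bar>B\<bar>" using f(2)[of x] by linarith
    then show "norm (h x * f x) \<le> norm (B * h x)"
      by (simp add: abs_mult mult.commute[of "\<bar>B\<bar>"] mult_left_mono)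
  qed
qed

lemma loc_int_mult:
  assumes h: "loc_int h" and f: "f \<in> borel_measurable borel"
    and b: "\<And>x. \<bar>f x\<bar> \<le> B * indicator (cball 0 r) x"
  shows "integrable lborel (\<lambda>x. h x * f x)"
proof -
  have "integrable lborel (\<lambda>x. (indicat_real (cball 0 r) x * h x) * f x)"
  proof (rule integrable_bound_mult[of _ _ "\<bar>B\<bar>"])
    show "integrable lborel (\<lambda>x. indicat_real (cball 0 r) x * h x)" using h by (simp add: loc_int_def)
    show "\<bar>f x\<bar> \<le> \<bar>B\<bar>" for x using b[of x] by (cases "x \<in> cball 0 r") auto
  qed (rule f)
  moreover have "(\<lambda>x. (indicat_real (cball 0 r) x * h x) * f x) = (\<lambda>x. h x * f x)"
  proof
    fix x show "(indicat_real (cball 0 r) x * h x) * f x = h x * f x"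
      using b[of x] by (auto simp: indicator_def split: if_splits)
  qed
  ultimately show ?thesis by simp
qed

lemma continuous_bounded_support:
  fixes f :: "'a::euclidean_space \<Rightarrow> real"
  assumes "continuous_on UNIV f" "bounded {x. f x \<noteq> 0}"
  obtains B r where "B > 0" "r > 0" "\<And>x. \<bar>f x\<bar> \<le> B * indicator (cball 0 r) x"
proof -
  obtain r where r: "r > 0" "\<And>x. f x \<noteq> 0 \<Longrightarrow> norm x \<le> r"
    using assms(2) by (auto simp: bounded_pos)
  have "bounded (f ` cball 0 r)"
    by (intro compact_imp_bounded compact_continuous_image continuous_on_subset[OF assms(1)]) auto
  then obtain B where B: "B > 0" "\<And>x. norm x \<le> r \<Longrightarrow> \<bar>f x\<bar> \<le> B" by (auto simp: bounded_pos)
  show ?thesis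
  proof (rule that[OF B(1) r(1)])
    fix x show "\<bar>f x\<bar> \<le> B * indicator (cball 0 r) x"
      using B(2)[of x] r(2)[of x] by (auto simp: indicator_def)
  qed
qed

lemma continuous_measurable: "continuous_on UNIV f \<Longrightarrow> f \<in> borel_measurable borel"
  by (rule borel_measurable_continuous_onI)

lemma test_functionD:
  assumes "test_function \<phi>"
  shows "C_k k \<phi>" "bounded {x. \<phi> x \<noteq> 0}"
  using assms closure_subset[of "{x. \<phi> x \<noteq> 0}"]
  by (auto simp: test_function_def intro: bounded_subset[OF compact_imp_bounded])

lemma test_functionI:
  assumes "\<And>k. C_k k \<phi>" "bounded {x. \<phi> x \<noteq> 0}"
  shows "test_function \<phi>"
  using assms by (auto simp: test_function_def)

lemma loc_int_mult_continuous:
  assumes "loc_int h" "continuous_on UNIV f" "bounded {x. f x \<noteq> 0}"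
  shows "integrable lborel (\<lambda>x. h x * f x)"
proof -
  obtain B r where "\<And>x. \<bar>f x\<bar> \<le> B * indicator (cball 0 r) x"
    using continuous_bounded_support[OF assms(2,3)] by blast
  then show ?thesis using assms by (intro loc_int_mult continuous_measurable) auto
qed

lemma loc_int_continuous:
  assumes "continuous_on UNIV f" shows "loc_int f"
  unfolding loc_int_def
proof (intro conjI allI continuous_measurable assms)
  fix r show "integrable lborel (\<lambda>x. indicat_real (cball 0 r) x * f x)"
    using borel_integrable_compact[of "cball 0 r" f] continuous_on_subset[OF assms]
    by (simp add: set_integrable_def indicator_scaleR_eq_if if_distrib cong: if_cong)
qed

lemma loc_int_add: "loc_int f \<Longrightarrow> loc_int g \<Longrightarrow> loc_int (\<lambda>x. f x + g x)"
  by (auto simp: loc_int_def algebra_simps)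

lemma loc_int_diff: "loc_int f \<Longrightarrow> loc_int g \<Longrightarrow> loc_int (\<lambda>x. f x - g x)"
  by (auto simp: loc_int_def algebra_simps)

text \<open>The fundamental lemma of the calculus of variations. Smooth bumps fill up open boxes, so
  \<open>h\<close> integrates to 0 over every box. The measures with densities h^+ and h^- then
  agree on boxes, an intersection-stable generator of the Borel sets, hence everywhere, and
  uniqueness of densities gives h^+ = h^- almost everywhere.\<close>

lemma integral_test_eq_0_imp_AE_0:
  fixes h :: "'a::euclidean_space \<Rightarrow> real"
  assumes h: "loc_int h"
    and z: "\<And>\<phi>. test_function \<phi> \<Longrightarrow> (\<And>x. \<phi> x \<ge> 0) \<Longrightarrow> (\<integral>x. h x * \<phi> x \<partial>lborel) = 0"
  shows "AE x in lborel. h x = 0"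
proof -
  have hm [measurable]: "h \<in> borel_measurable borel" using h by (simp add: loc_int_def)
  have hb: "integrable lborel (\<lambda>x. indicat_real (box a b) x * h x)" for a b
  proof -
    obtain r where r: "box a b \<subseteq> cball 0 r"
      using bounded_subset_ballD[OF bounded_box, of a b 0] ball_subset_cball by blast
    have "integrable lborel (\<lambda>x. h x * indicat_real (box a b) x)"
      by (rule loc_int_mult[OF h, of _ 1 r]) (use r in \<open>auto simp: indicator_def\<close>)
    then show ?thesis by (simp add: mult.commute)
  qed
  have box0: "(\<integral>x. indicat_real (box a b) x * h x \<partial>lborel) = 0" for a b
  proof -
    have "(\<lambda>n. \<integral>x. h x * box_bump n a b x \<partial>lborel) \<longlonglongrightarrow> (\<integral>x. indicat_real (box a b) x * h x \<partial>lborel)"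
    proof (rule integral_dominated_convergence[where w="\<lambda>x. \<bar>indicat_real (box a b) x * h x\<bar>"])
      show "integrable lborel (\<lambda>x. \<bar>indicat_real (box a b) x * h x\<bar>)" using hb by simp
      show "(\<lambda>x. h x * box_bump n a b x) \<in> borel_measurable lborel" for n
        using continuous_measurable[OF C_k_imp_continuous[OF test_functionD(1)[OF test_function_box_bump]]]
        by measurable
      show "AE x in lborel. (\<lambda>n. h x * box_bump n a b x) \<longlonglongrightarrow> indicat_real (box a b) x * h x"
        by (intro AE_I2) (subst mult.commute, intro tendsto_mult tendsto_const box_bump_lim)
      show "AE x in lborel. norm (h x * box_bump n a b x) \<le> \<bar>indicat_real (box a b) x * h x\<bar>" for n
      proof (intro AE_I2)
        fix x show "norm (h x * box_bump n a b x) \<le> \<bar>indicat_real (box a b) x * h x\<bar>"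
          using box_bump_outside[of x a b n] box_bump_nonneg[of n a b x] box_bump_le_1[of n a b x]
          by (cases "x \<in> box a b") (auto simp: abs_mult mult_left_le)
      qed
    qed simp
    moreover have "(\<integral>x. h x * box_bump n a b x \<partial>lborel) = 0" for n
      by (intro z test_function_box_bump box_bump_nonneg)
    ultimately show ?thesis using LIMSEQ_unique[OF _ tendsto_const] by fastforce
  qed
  \<comment> \<open>\<open>ennreal\<close> sends negative reals to 0, so these two densities are the
    positive and the negative part of \<open>h\<close>.\<close>
  define P where "P = density lborel (\<lambda>x. ennreal (h x))"
  define Q where "Q = density lborel (\<lambda>x. ennreal (- h x))"
  have pn: "integrable lborel (\<lambda>x. indicat_real (box a b) x * max 0 (h x))"
    "integrable lborel (\<lambda>x. indicat_real (box a b) x * max 0 (- h x))" for a b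
  proof -
    have "integrable lborel (\<lambda>x. max 0 (indicat_real (box a b) x * h x))"
      "integrable lborel (\<lambda>x. max 0 (- (indicat_real (box a b) x * h x)))"
      using hb by (auto intro!: integrable_max)
    moreover have "(\<lambda>x. max 0 (indicat_real (box a b) x * h x)) = (\<lambda>x. indicat_real (box a b) x * max 0 (h x))"
      "(\<lambda>x. max 0 (- (indicat_real (box a b) x * h x))) = (\<lambda>x. indicat_real (box a b) x * max 0 (- h x))"
      by (auto simp: indicator_def)
    ultimately show "integrable lborel (\<lambda>x. indicat_real (box a b) x * max 0 (h x))"
      "integrable lborel (\<lambda>x. indicat_real (box a b) x * max 0 (- h x))" by simp_all
  qed
  have e1: "(\<lambda>x. ennreal (k x) * indicator A x) = (\<lambda>x. ennreal (indicat_real A x * max 0 (k x)))" for A and k :: "'a \<Rightarrow> real"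
    by (auto simp: indicator_def max_def ennreal_neg)
  have eP: "emeasure P (box a b) = ennreal (\<integral>x. indicat_real (box a b) x * max 0 (h x) \<partial>lborel)" for a b
    unfolding P_def using e1[where k="\<lambda>x. h x" and A="box a b"]
    by (subst emeasure_density) (auto simp: nn_integral_eq_integral[OF pn(1)])
  have eQ: "emeasure Q (box a b) = ennreal (\<integral>x. indicat_real (box a b) x * max 0 (- h x) \<partial>lborel)" for a b
    unfolding Q_def using e1[where k="\<lambda>x. - h x" and A="box a b"]
    by (subst emeasure_density) (auto simp: nn_integral_eq_integral[OF pn(2)])
  have eq: "emeasure P (box a b) = emeasure Q (box a b)" for a b
  proof -
    have "(\<integral>x. indicat_real (box a b) x * max 0 (h x) \<partial>lborel) - (\<integral>x. indicat_real (box a b) x * max 0 (- h x) \<partial>lborel)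
      = (\<integral>x. indicat_real (box a b) x * max 0 (h x) - indicat_real (box a b) x * max 0 (- h x) \<partial>lborel)"
      using pn by simp
    also have "\<dots> = (\<integral>x. indicat_real (box a b) x * h x \<partial>lborel)"
      by (intro Bochner_Integration.integral_cong) (auto simp: max_def algebra_simps)
    finally show ?thesis using eP eQ box0 by simp
  qed
  have "P = Q"
  proof (rule measure_eqI_generator_eq)
    let ?E = "range (\<lambda>(a, b). box a b::'a set)"
    show "Int_stable ?E" by (auto simp: Int_stable_def box_Int_box)
    show "?E \<subseteq> Pow UNIV" "sets P = sigma_sets UNIV ?E" "sets Q = sigma_sets UNIV ?E"
      by (simp_all add: borel_eq_box P_def Q_def)
    let ?A = "\<lambda>n::nat. box (- (real n *\<^sub>R One)) (real n *\<^sub>R One) :: 'a set"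
    show "range ?A \<subseteq> ?E" "(\<Union>i. ?A i) = UNIV"
      unfolding UN_box_eq_UNIV by auto
    show "emeasure P (?A i) \<noteq> \<infinity>" for i using eP by simp
    show "emeasure P X = emeasure Q X" if "X \<in> ?E" for X using that eq by auto
  qed
  then have "AE x in lborel. ennreal (h x) = ennreal (- h x)"
    unfolding P_def Q_def by (intro sigma_finite_measure.density_unique[OF sigma_finite_lborel]) auto
  then show ?thesis
  proof eventually_elim
    fix x assume "ennreal (h x) = ennreal (- h x)"
    then show "h x = 0" by (cases "h x \<ge> 0") (auto simp: ennreal_neg ennreal_eq_0_iff)
  qed
qed

section \<open>Affine substitutions and integrable point singularities\<close>

lemma nn_integral_affine:
  fixes t :: "'a::euclidean_space" and f :: "'a \<Rightarrow> ennreal"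
  assumes c: "c \<noteq> 0" and f[measurable]: "f \<in> borel_measurable borel"
  shows "(\<integral>\<^sup>+x. f x \<partial>lborel) = ennreal (\<bar>c\<bar> ^ DIM('a)) * (\<integral>\<^sup>+x. f (t + c *\<^sub>R x) \<partial>lborel)"
  by (subst lborel_affine[OF c, of t]) (simp add: nn_integral_density nn_integral_distr nn_integral_cmult)

lemma integral_affine:
  fixes t :: "'a::euclidean_space" and f :: "'a \<Rightarrow> real"
  assumes c: "c \<noteq> 0" and f[measurable]: "f \<in> borel_measurable borel"
  shows "(\<integral>x. f x \<partial>lborel) = \<bar>c\<bar> ^ DIM('a) * (\<integral>x. f (t + c *\<^sub>R x) \<partial>lborel)"
    and "integrable lborel f \<longleftrightarrow> integrable lborel (\<lambda>x. f (t + c *\<^sub>R x))"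
proof -
  have "(\<integral>x. f x \<partial>lborel) = (\<integral>x. f x \<partial>density (distr lborel borel (\<lambda>x. t + c *\<^sub>R x)) (\<lambda>_. \<bar>c\<bar>^DIM('a)))"
    by (subst lborel_affine[OF c, of t]) simp
  also have "\<dots> = \<bar>c\<bar> ^ DIM('a) * (\<integral>x. f (t + c *\<^sub>R x) \<partial>lborel)"
    by (subst integral_density) (auto simp: integral_distr)
  finally show "(\<integral>x. f x \<partial>lborel) = \<bar>c\<bar> ^ DIM('a) * (\<integral>x. f (t + c *\<^sub>R x) \<partial>lborel)" .
  have "integrable lborel f \<longleftrightarrow> integrable (density (distr lborel borel (\<lambda>x. t + c *\<^sub>R x)) (\<lambda>_. \<bar>c\<bar>^DIM('a))) f"
    by (subst lborel_affine[OF c, of t]) simp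
  also have "\<dots> \<longleftrightarrow> integrable lborel (\<lambda>x. f (t + c *\<^sub>R x))"
    using c by (subst integrable_density) (auto simp: integrable_distr_eq)
  finally show "integrable lborel f \<longleftrightarrow> integrable lborel (\<lambda>x. f (t + c *\<^sub>R x))" .
qed

lemma integral_reflect:
  fixes t :: "'a::euclidean_space" and f :: "'a \<Rightarrow> real"
  assumes f[measurable]: "f \<in> borel_measurable borel"
  shows "(\<integral>x. f (t - x) \<partial>lborel) = (\<integral>x. f x \<partial>lborel)"
    and "integrable lborel (\<lambda>x. f (t - x)) \<longleftrightarrow> integrable lborel f"
  using integral_affine[OF _ f, of "-1" t] by auto

lemma nn_integral_reflect:
  fixes t :: "'a::euclidean_space" and f :: "'a \<Rightarrow> ennreal"
  assumes f[measurable]: "f \<in> borel_measurable borel"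
  shows "(\<integral>\<^sup>+x. f (t - x) \<partial>lborel) = (\<integral>\<^sup>+x. f x \<partial>lborel)"
  using nn_integral_affine[OF _ f, of "-1" t] by auto

lemma integral_shift:
  fixes t :: "'a::euclidean_space" and f :: "'a \<Rightarrow> real"
  assumes f[measurable]: "f \<in> borel_measurable borel"
  shows "(\<integral>x. f (x + t) \<partial>lborel) = (\<integral>x. f x \<partial>lborel)"
    and "integrable lborel (\<lambda>x. f (x + t)) \<longleftrightarrow> integrable lborel f"
  using integral_affine[OF _ f, of 1 t] by (auto simp: add.commute)

text \<open>The value at the origin is set to \<open>top\<close> because \<open>0 powr - p\<close>
  evaluates to 0. In the plane the product of two such functions has to dominate the radial power on
  the coordinate axes as well, where one factor is singular.\<close>

lemma nn_integral_abs_powr_finite: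
  assumes "0 \<le> p" "p < 1"
  shows "(\<integral>\<^sup>+t. indicator {-1..1} t * (if t = 0 then top else ennreal (\<bar>t\<bar> powr - p)) \<partial>lborel) < (\<infinity>::ennreal)"
proof -
  have "((\<lambda>x. x powr - p) has_integral (1 powr (- p + 1) / (- p + 1))) {0..1::real}"
    by (rule has_integral_powr_from_0) (use assms in auto)
  then have "((\<lambda>x. if x \<in> {0..1} then x powr - p else 0) has_integral (1 / (1 - p))) UNIV"
    by (simp only: has_integral_restrict_UNIV) (simp add: add.commute)
  then have "((\<lambda>x. indicat_real {0..1} x * x powr - p) has_integral (1 / (1 - p))) UNIV"
    by (rule has_integral_eq[rotated]) (auto simp: indicator_def)
  then have I: "(\<integral>\<^sup>+t. ennreal (indicat_real {0..1} t * t powr - p) \<partial>lborel) = ennreal (1 / (1 - p))"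
    by (intro nn_integral_has_integral_lborel) auto
  have "(\<integral>\<^sup>+t. ennreal (indicat_real {0..1} (-t) * (-t) powr - p) \<partial>lborel) = ennreal (1 / (1 - p))"
    using nn_integral_reflect[of "\<lambda>t. ennreal (indicat_real {0..1} t * t powr - p)" 0] I by simp
  with I have "(\<integral>\<^sup>+t. ennreal (indicat_real {0..1} t * t powr - p) + ennreal (indicat_real {0..1} (-t) * (-t) powr - p) \<partial>lborel) = ennreal (1 / (1 - p)) + ennreal (1 / (1 - p))"
    by (subst nn_integral_add) auto
  moreover have "(\<integral>\<^sup>+t. indicator {-1..1} t * (if t = 0 then top else ennreal (\<bar>t\<bar> powr - p)) \<partial>lborel)
    \<le> (\<integral>\<^sup>+t. ennreal (indicat_real {0..1} t * t powr - p) + ennreal (indicat_real {0..1} (-t) * (-t) powr - p) \<partial>lborel)"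
    by (intro nn_integral_mono_AE eventually_mono[OF AE_lborel_singleton[of 0]])
       (auto simp: indicator_def)
  moreover have "ennreal (1 / (1 - p)) + ennreal (1 / (1 - p)) < \<infinity>" by simp
  ultimately show ?thesis by order
qed

text \<open>The two-dimensional singularity is dominated by a product of one-dimensional ones:
  \<open>|z| powr -2p \<le> |Re z| powr -p * |Im z| powr -p\<close>.\<close>

lemma nn_integral_norm_powr_finite:
  assumes p: "0 \<le> p" "p < 1"
  shows "(\<integral>\<^sup>+z. ennreal (indicat_real (cball 0 1) z * norm (z::complex) powr (- 2 * p)) \<partial>lborel) < \<infinity>"
proof -
  define f where "f t = indicator {-1..1} t * (if t = 0 then top else ennreal (\<bar>t\<bar> powr - p))" for t :: real
  have [measurable]: "f \<in> borel_measurable borel" unfolding f_def by measurable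
  have "ennreal (indicat_real (cball 0 1) z * norm z powr (- 2 * p)) \<le> (\<Prod>b\<in>Basis. f (z \<bullet> b))" for z :: complex
  proof (cases "z \<in> cball 0 1 \<and> z \<noteq> 0")
    case True
    then have z: "cmod z \<le> 1" "\<bar>Re z\<bar> \<le> cmod z" "\<bar>Im z\<bar> \<le> cmod z" "cmod z > 0"
      by (auto simp: abs_Re_le_cmod abs_Im_le_cmod)
    have P: "(\<Prod>b\<in>Basis. f (z \<bullet> b)) = f (Re z) * f (Im z)" by (simp add: Basis_complex_def)
    show ?thesis
    proof (cases "Re z = 0 \<or> Im z = 0")
      case True
      have "f (Re z) \<noteq> 0" "f (Im z) \<noteq> 0" using z by (auto simp: f_def indicator_eq_0_iff)
      moreover have "f (Re z) = top \<or> f (Im z) = top" using True by (auto simp: f_def)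
      ultimately show ?thesis unfolding P by (auto simp: ennreal_mult_eq_top_iff)
    next
      case False
      have "cmod z powr (- 2 * p) = cmod z powr (-p) * cmod z powr (-p)"
        by (simp add: powr_add[symmetric])
      also have "\<dots> \<le> \<bar>Re z\<bar> powr (-p) * \<bar>Im z\<bar> powr (-p)"
        using z False p by (intro mult_mono powr_mono2') auto
      finally show ?thesis unfolding P using False z
        by (auto simp: f_def indicator_def ennreal_mult[symmetric] intro!: ennreal_leI)
    qed
  qed auto
  then have "(\<integral>\<^sup>+z. ennreal (indicat_real (cball 0 1) z * norm (z::complex) powr (- 2 * p)) \<partial>lborel)
    \<le> (\<integral>\<^sup>+z. (\<Prod>b\<in>Basis. f ((z::complex) \<bullet> b)) \<partial>lborel)" by (intro nn_integral_mono)
  also have "\<dots> = (\<Prod>b\<in>(Basis::complex set). (\<integral>\<^sup>+t. f t \<partial>lborel))"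
    by (rule nn_integral_lborel_prod) auto
  also have "\<dots> < \<infinity>"
    using nn_integral_abs_powr_finite[OF p] unfolding f_def[symmetric]
    by (simp add: Basis_complex_def ennreal_mult_less_top)
  finally show ?thesis .
qed

lemma integrable_norm_powr:
  assumes p: "0 \<le> p" "p < 1"
  shows "integrable lborel (\<lambda>z::complex. indicat_real (cball 0 1) z * norm z powr (- 2 * p))"
proof (rule integrableI_nonneg)
  show "(\<lambda>z::complex. indicat_real (cball 0 1) z * norm z powr (- 2 * p)) \<in> borel_measurable lborel"
    by (intro borel_measurable_times borel_measurable_indicator powr_real_measurable borel_measurable_norm borel_measurable_const) auto
qed (use nn_integral_norm_powr_finite[OF p] in auto)

text \<open>This is the planar power with exponent p = 1/2 on the unit disc; other positive radii
  follow by scaling.\<close>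

lemma integrable_inverse_norm:
  "integrable lborel (\<lambda>z::complex. indicat_real (cball 0 r) z / norm z)"
proof (cases "r > 0")
  case True
  have "(\<lambda>z::complex. indicat_real (cball 0 1) z * norm z powr (- 2 * (1/2))) = (\<lambda>z. indicat_real (cball 0 1) z / norm z)"
    by (auto simp: powr_minus field_simps fun_eq_iff)
  then have 1: "integrable lborel (\<lambda>z::complex. indicat_real (cball 0 1) z / norm z)"
    using integrable_norm_powr[of "1/2"] by simp
  have "integrable lborel (\<lambda>z. (\<lambda>z::complex. indicat_real (cball 0 r) z / norm z) (0 + r *\<^sub>R z))"
  proof -
    have "(\<lambda>z::complex. indicat_real (cball 0 r) (0 + r *\<^sub>R z) / norm (0 + r *\<^sub>R z)) = (\<lambda>z. (1 / r) * (indicat_real (cball 0 1) z / norm z))" (is "?L = ?R")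
      using True by (auto simp: fun_eq_iff indicator_def)
    moreover have "integrable lborel ?R" using 1 by (rule integrable_mult_right)
    ultimately show ?thesis by simp
  qed
  then show ?thesis using True
    by (subst integral_affine(2)[of r _ 0]) (measurable, auto)
next
  case False
  have "(\<lambda>z::complex. indicat_real (cball 0 r) z / norm z) = (\<lambda>z. 0)"
  proof
    fix z :: complex
    have "z = 0" if "cmod z \<le> r" using that False by (metis norm_le_zero_iff not_less order_trans)
    then show "indicat_real (cball 0 r) z / cmod z = 0" by (auto simp: indicator_def)
  qed
  then show ?thesis by simp
qed

section \<open>Differentiation under the integral\<close>

lemma differentiable_increment_bound:
  fixes f :: "'a::euclidean_space \<Rightarrow> real"
  assumes f: "\<And>z. z \<in> ball z0 1 \<Longrightarrow> (f has_derivative D z) (at z)"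
    and b: "\<And>z v. z \<in> ball z0 1 \<Longrightarrow> \<bar>D z v\<bar> \<le> G * norm v" and z: "z \<in> ball z0 1"
  shows "\<bar>f z - f z0\<bar> \<le> G * norm (z - z0)"
proof -
  have "norm (f z - f z0) \<le> G * norm (z - z0)"
  proof (rule differentiable_bound[of "ball z0 1" f D])
    show "onorm (D x) \<le> G" if "x \<in> ball z0 1" for x
      using b[OF that] by (intro onorm_le) (auto simp: mult.commute)
  qed (use f z in \<open>auto intro: has_derivative_at_withinI\<close>)
  then show ?thesis by simp
qed

text \<open>The mean value inequality turns the bound \<open>G\<close> on derivatives over the unit
  ball into a bound on increments. Increment minus linear part, divided by the step length, is then
  dominated by \<open>2 * G\<close>, and dominated convergence applies along every null sequence of
  steps. Radius 1 suits convolutions, where translates over a bounded set share a majorant.\<close>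

lemma has_derivative_integral:
  fixes F :: "'a::euclidean_space \<Rightarrow> 'b::euclidean_space \<Rightarrow> real"
  assumes F: "\<And>z w. z \<in> ball z0 1 \<Longrightarrow> ((\<lambda>z. F z w) has_derivative D z w) (at z)"
    and Fm: "\<And>z. z \<in> ball z0 1 \<Longrightarrow> F z \<in> borel_measurable borel"
    and int0: "integrable lborel (F z0)"
    and Dm: "\<And>v. (\<lambda>w. D z0 w v) \<in> borel_measurable borel"
    and G: "integrable lborel G"
    and b: "\<And>z w v. z \<in> ball z0 1 \<Longrightarrow> \<bar>D z w v\<bar> \<le> G w * norm v"
  shows "((\<lambda>z. \<integral>w. F z w \<partial>lborel) has_derivative (\<lambda>v. \<integral>w. D z0 w v \<partial>lborel)) (at z0)"
  unfolding has_derivative_at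
proof (intro conjI)
  have z0: "z0 \<in> ball z0 1" by simp
  have inc: "\<bar>F z w - F z0 w\<bar> \<le> G w * norm (z - z0)" if "z \<in> ball z0 1" for z w
    by (rule differentiable_increment_bound[OF F b that])
  have int: "integrable lborel (F z)" if z: "z \<in> ball z0 1" for z
  proof -
    have "integrable lborel (\<lambda>w. F z w - F z0 w)"
    proof (rule Bochner_Integration.integrable_bound)
      show "integrable lborel (\<lambda>w. G w * norm (z - z0))" using G by simp
      show "AE x in lborel. norm (F z x - F z0 x) \<le> norm (G x * norm (z - z0))"
      proof (intro AE_I2)
        fix w show "norm (F z w - F z0 w) \<le> norm (G w * norm (z - z0))"
          using inc[OF z, of w] by simp
      qed
    qed (use Fm[OF z] Fm[OF z0] in simp)
    from Bochner_Integration.integrable_add[OF this int0] show ?thesis by simp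
  qed
  have Dint: "integrable lborel (\<lambda>w. D z0 w v)" for v
  proof (rule Bochner_Integration.integrable_bound)
    show "integrable lborel (\<lambda>w. G w * norm v)" using G by simp
    show "AE w in lborel. norm (D z0 w v) \<le> norm (G w * norm v)"
    proof (intro AE_I2)
      fix w show "norm (D z0 w v) \<le> norm (G w * norm v)"
        using b[OF z0, of w v] by simp
    qed
  qed (use Dm in simp)
  have lin: "linear (D z0 w)" for w using has_derivative_linear[OF F[OF z0]] .
  show "bounded_linear (\<lambda>v. \<integral>w. D z0 w v \<partial>lborel)"
  proof (rule bounded_linear_intro[where K="\<integral>w. G w \<partial>lborel"])
    show "(\<integral>w. D z0 w (x + y) \<partial>lborel) = (\<integral>w. D z0 w x \<partial>lborel) + (\<integral>w. D z0 w y \<partial>lborel)" for x y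
      using Dint by (simp add: linear_add[OF lin])
    show "(\<integral>w. D z0 w (r *\<^sub>R x) \<partial>lborel) = r *\<^sub>R (\<integral>w. D z0 w x \<partial>lborel)" for r x
      by (simp add: linear_scale[OF lin])
    show "norm (\<integral>w. D z0 w x \<partial>lborel) \<le> norm x * (\<integral>w. G w \<partial>lborel)" for x
    proof -
      have "norm (\<integral>w. D z0 w x \<partial>lborel) \<le> (\<integral>w. norm (D z0 w x) \<partial>lborel)"
        by (rule integral_norm_bound)
      also have "\<dots> \<le> (\<integral>w. G w * norm x \<partial>lborel)"
        using Dint G b[OF z0] by (intro integral_mono) auto
      finally have "norm (\<integral>w. D z0 w x \<partial>lborel) \<le> (\<integral>w. G w * norm x \<partial>lborel)" .
      then show ?thesis by (simp add: mult.commute)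
    qed
  qed
  show "(\<lambda>h. norm ((\<integral>w. F (z0 + h) w \<partial>lborel) - (\<integral>w. F z0 w \<partial>lborel) - (\<integral>w. D z0 w h \<partial>lborel)) / norm h) \<midarrow>0\<rightarrow> 0"
    unfolding tendsto_at_iff_sequentially
  proof (intro allI impI)
    fix X :: "nat \<Rightarrow> 'a" assume X0: "\<forall>i. X i \<in> UNIV - {0}" and X: "X \<longlonglongrightarrow> 0"
    \<comment> \<open>The quotient is replaced by 0 while the step is still too long for the bounds
      to hold; this concerns only finitely many \<open>n\<close>.\<close>
    define s where "s n w = (if norm (X n) < 1 then (F (z0 + X n) w - F z0 w - D z0 w (X n)) / norm (X n) else 0)" for n w
    have ev: "\<forall>\<^sub>F n in sequentially. norm (X n) < 1"
      using tendsto_norm_zero[OF X] by (rule order_tendstoD) simp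
    have "(\<lambda>n. \<integral>w. s n w \<partial>lborel) \<longlonglongrightarrow> (\<integral>w. 0 \<partial>(lborel::'b measure))"
    proof (rule integral_dominated_convergence[where w="\<lambda>w. 2 * G w"])
      show "integrable lborel (\<lambda>w. 2 * G w)" using G by simp
      show "s n \<in> borel_measurable lborel" for n
      proof (cases "norm (X n) < 1")
        case True
        then have "F (z0 + X n) \<in> borel_measurable borel" by (intro Fm) (simp add: dist_norm)
        then show ?thesis unfolding s_def using True Dm[of "X n"] Fm[OF z0] by simp
      qed (simp add: s_def[abs_def])
      show "AE w in lborel. (\<lambda>n. s n w) \<longlonglongrightarrow> 0"
      proof (intro AE_I2)
        fix w
        have "(\<lambda>h. norm (F (z0 + h) w - F z0 w - D z0 w h) / norm h) \<midarrow>0\<rightarrow> 0"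
          using F[OF z0, of w] by (simp add: has_derivative_at)
        then have "(\<lambda>n. norm (F (z0 + X n) w - F z0 w - D z0 w (X n)) / norm (X n)) \<longlonglongrightarrow> 0"
          using X X0 unfolding tendsto_at_iff_sequentially by (auto simp: o_def)
        then have "(\<lambda>n. norm (s n w)) \<longlonglongrightarrow> 0"
          by (rule Lim_transform_eventually) (use ev in eventually_elim, auto simp: s_def)
        then show "(\<lambda>n. s n w) \<longlonglongrightarrow> 0" by (rule tendsto_norm_zero_cancel)
      qed
      show "AE w in lborel. norm (s n w) \<le> 2 * G w" for n
      proof (intro AE_I2)
        fix w
        have "0 \<le> G w" using b[OF z0, of w "SOME i. i \<in> Basis"] order_trans[OF abs_ge_zero]
          by (metis SOME_Basis norm_Basis mult.right_neutral)
        moreover have "\<bar>F (z0 + X n) w - F z0 w - D z0 w (X n)\<bar> \<le> 2 * G w * norm (X n)" if "norm (X n) < 1"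
          using inc[of "z0 + X n" w] b[OF z0, of w "X n"] that by (simp add: dist_norm)
        ultimately show "norm (s n w) \<le> 2 * G w"
          using X0 by (auto simp: s_def field_simps)
      qed
    qed simp
    then have "(\<lambda>n. norm (\<integral>w. s n w \<partial>lborel)) \<longlonglongrightarrow> 0"
      using tendsto_norm_zero by force
    then show "((\<lambda>h. norm ((\<integral>w. F (z0 + h) w \<partial>lborel) - (\<integral>w. F z0 w \<partial>lborel) - (\<integral>w. D z0 w h \<partial>lborel)) / norm h) \<circ> X) \<longlonglongrightarrow> 0"
    proof (rule Lim_transform_eventually)
      show "\<forall>\<^sub>F n in sequentially. norm (\<integral>w. s n w \<partial>lborel) = ((\<lambda>h. norm ((\<integral>w. F (z0 + h) w \<partial>lborel) - (\<integral>w. F z0 w \<partial>lborel) - (\<integral>w. D z0 w h \<partial>lborel)) / norm h) \<circ> X) n"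
        using ev
      proof eventually_elim
        fix n assume n: "norm (X n) < 1"
        then have "integrable lborel (F (z0 + X n))" by (intro int) (simp add: dist_norm)
        then show "norm (\<integral>w. s n w \<partial>lborel) = ((\<lambda>h. norm ((\<integral>w. F (z0 + h) w \<partial>lborel) - (\<integral>w. F z0 w \<partial>lborel) - (\<integral>w. D z0 w h \<partial>lborel)) / norm h) \<circ> X) n"
          using n int0 Dint by (simp add: s_def)
      qed
    qed
  qed
qed

lemma continuous_integral:
  fixes F :: "'a::euclidean_space \<Rightarrow> 'b::euclidean_space \<Rightarrow> real"
  assumes F: "\<And>w. isCont (\<lambda>z. F z w) z0"
    and Fm: "\<And>z. F z \<in> borel_measurable borel"
    and G: "integrable lborel G"
    and b: "\<And>z w. z \<in> ball z0 1 \<Longrightarrow> \<bar>F z w\<bar> \<le> G w"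
  shows "isCont (\<lambda>z. \<integral>w. F z w \<partial>lborel) z0"
  unfolding isCont_def tendsto_at_iff_sequentially
proof (intro allI impI)
  fix X :: "nat \<Rightarrow> 'a" assume X: "X \<longlonglongrightarrow> z0"
  have ev: "\<forall>\<^sub>F n in sequentially. X n \<in> ball z0 1"
    using topological_tendstoD[OF X, of "ball z0 1"] by simp
  define s where "s n w = (if X n \<in> ball z0 1 then F (X n) w else 0)" for n w
  have "(\<lambda>n. \<integral>w. s n w \<partial>lborel) \<longlonglongrightarrow> (\<integral>w. F z0 w \<partial>lborel)"
  proof (rule integral_dominated_convergence[where w=G])
    show "s n \<in> borel_measurable lborel" for n using Fm by (cases "X n \<in> ball z0 1") (auto simp: s_def[abs_def])
    show "AE w in lborel. (\<lambda>n. s n w) \<longlonglongrightarrow> F z0 w"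
    proof (intro AE_I2)
      fix w show "(\<lambda>n. s n w) \<longlonglongrightarrow> F z0 w"
        by (rule Lim_transform_eventually[OF isCont_tendsto_compose[OF F X, of w]])
           (use ev in eventually_elim, auto simp: s_def)
    qed
    show "AE w in lborel. norm (s n w) \<le> G w" for n
      using b order_trans[OF abs_ge_zero b[of z0]] by (intro AE_I2) (auto simp: s_def)
  qed (use Fm G in auto)
  then show "((\<lambda>z. \<integral>w. F z w \<partial>lborel) \<circ> X) \<longlonglongrightarrow> (\<integral>w. F z0 w \<partial>lborel)"
    by (rule Lim_transform_eventually) (use ev in eventually_elim, auto simp: s_def[abs_def])
qed

section \<open>Derivatives of convolutions\<close>

lemma fd_bound:
  assumes "C_k (Suc k) f"
  shows "\<bar>fd f v x\<bar> \<le> (\<Sum>b\<in>Basis. \<bar>fd f b x\<bar>) * norm v"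
proof -
  have "fd f v x = fd f (\<Sum>b\<in>Basis. (v \<bullet> b) *\<^sub>R b) x" by (simp add: euclidean_representation)
  also have "\<dots> = (\<Sum>b\<in>Basis. (v \<bullet> b) * fd f b x)"
    by (simp add: linear_sum[OF fd_linear[OF assms]] linear_scale[OF fd_linear[OF assms]])
  finally have "\<bar>fd f v x\<bar> \<le> (\<Sum>b\<in>Basis. \<bar>v \<bullet> b\<bar> * \<bar>fd f b x\<bar>)"
    by (simp add: sum_abs[THEN order_trans] abs_mult[symmetric])
  also have "\<dots> \<le> (\<Sum>b\<in>Basis. norm v * \<bar>fd f b x\<bar>)"
    by (intro sum_mono mult_right_mono Basis_le_norm) auto
  finally show ?thesis by (simp add: sum_distrib_left[symmetric] mult.commute)
qed

lemma bounded_support_fd: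
  assumes "bounded {x. f x \<noteq> 0}"
  shows "bounded {x. fd f v x \<noteq> 0}"
proof (rule bounded_subset[OF bounded_closure[OF assms]], rule subsetI, rule ccontr)
  fix x assume x: "x \<in> {x. fd f v x \<noteq> 0}" and n: "x \<notin> closure {x. f x \<noteq> 0}"
  have "(f has_derivative (\<lambda>_. 0)) (at x)"
  proof (rule has_derivative_transform_within_open[of "\<lambda>_. 0" _ _ _ "- closure {x. f x \<noteq> 0}"])
    show "0 = f y" if "y \<in> - closure {x. f x \<noteq> 0}" for y
      using that closure_subset[of "{x. f x \<noteq> 0}"] by auto
  qed (use n in auto)
  from fd_eq[OF this, of v] x show False by simp
qed

lemma test_function_fd: "test_function \<phi> \<Longrightarrow> test_function (fd \<phi> v)"
  using test_functionD C_k_SucD(2) bounded_support_fd by (intro test_functionI) blast+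

text \<open>Either factor may carry the bounded support. If it is \<open>h\<close>, then
  \<open>f\<close> is evaluated only on a fixed large ball, where it is bounded. If it is
  \<open>f\<close>, then \<open>w\<close> is confined to a fixed ball while \<open>z\<close> moves
  in the unit ball around \<open>z0\<close>. In both cases the majorant is the same for all these
  \<open>z\<close>.\<close>

lemma convolution_bound:
  fixes h f :: "'a::euclidean_space \<Rightarrow> real"
  assumes bs: "bounded {x. h x \<noteq> 0} \<or> bounded {x. f x \<noteq> 0}" and f: "continuous_on UNIV f"
  obtains B r where "B \<ge> 0" "\<And>z w. z \<in> ball z0 1 \<Longrightarrow> \<bar>h w * f (z - w)\<bar> \<le> B * \<bar>indicator (cball 0 r) w * h w\<bar>"
  using bs
proof
  assume "bounded {x. h x \<noteq> 0}"
  then obtain r where r: "\<And>x. h x \<noteq> 0 \<Longrightarrow> norm x \<le> r" by (auto simp: bounded_iff)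
  have "bounded (f ` cball 0 (norm z0 + 1 + r))"
    by (intro compact_imp_bounded compact_continuous_image continuous_on_subset[OF f]) auto
  then obtain B where B: "B > 0" "\<And>x. norm x \<le> norm z0 + 1 + r \<Longrightarrow> \<bar>f x\<bar> \<le> B" by (auto simp: bounded_pos)
  show thesis
  proof (rule that[of B r])
    fix z w assume z: "z \<in> ball z0 1"
    show "\<bar>h w * f (z - w)\<bar> \<le> B * \<bar>indicator (cball 0 r) w * h w\<bar>"
    proof (cases "h w = 0")
      case False
      then have w: "norm w \<le> r" by (rule r)
      have "norm (z - w) \<le> norm z0 + 1 + r"
        using z w norm_triangle_ineq4[of z w] norm_triangle_ineq2[of z z0] by (simp add: dist_norm norm_minus_commute)
      then have "\<bar>f (z - w)\<bar> \<le> B" by (rule B)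
      then show ?thesis using w by (simp add: abs_mult mult.commute[of B] mult_left_mono)
    qed simp
  qed (use B in auto)
next
  assume b: "bounded {x. f x \<noteq> 0}"
  obtain B r where B: "B > 0" "r > 0" "\<And>x. \<bar>f x\<bar> \<le> B * indicator (cball 0 r) x"
    using continuous_bounded_support[OF f b] by blast
  show thesis
  proof (rule that[of B "norm z0 + 1 + r"])
    fix z w assume z: "z \<in> ball z0 1"
    show "\<bar>h w * f (z - w)\<bar> \<le> B * \<bar>indicator (cball 0 (norm z0 + 1 + r)) w * h w\<bar>"
    proof (cases "norm (z - w) \<le> r")
      case True
      then have "norm w \<le> norm z0 + 1 + r"
        using z norm_triangle_ineq2[of w z] norm_triangle_ineq2[of z z0] by (simp add: dist_norm norm_minus_commute)
      then show ?thesis using B(3)[of "z - w"] True by (simp add: abs_mult mult.commute[of B] mult_left_mono)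
    next
      case False
      then show ?thesis using B(1) B(3)[of "z - w"] by simp
    qed
  qed (use B in auto)
qed

lemma convolution_has_derivative:
  fixes h f :: "'a::euclidean_space \<Rightarrow> real"
  assumes h: "loc_int h" and bs: "bounded {x. h x \<noteq> 0} \<or> bounded {x. f x \<noteq> 0}"
    and f: "C_k (Suc k) f"
  shows "((\<lambda>z. \<integral>w. h w * f (z - w) \<partial>lborel) has_derivative (\<lambda>v. \<integral>w. h w * fd f v (z0 - w) \<partial>lborel)) (at z0)"
proof -
  have hm [measurable]: "h \<in> borel_measurable borel" using h by (simp add: loc_int_def)
  have fc: "continuous_on UNIV f" using C_k_imp_continuous[OF f] .
  have fdc: "continuous_on UNIV (fd f v)" for v using C_k_imp_continuous[OF C_k_SucD(2)[OF f]] .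
  have [measurable]: "f \<in> borel_measurable borel" "fd f v \<in> borel_measurable borel" for v
    using fc fdc continuous_measurable by auto
  define gs where "gs x = (\<Sum>b\<in>Basis. \<bar>fd f b x\<bar>)" for x
  have gsc: "continuous_on UNIV gs" unfolding gs_def using fdc by (intro continuous_intros)
  have gsb: "bounded {x. h x \<noteq> 0} \<or> bounded {x. gs x \<noteq> 0}"
    using bs
  proof
    assume "bounded {x. f x \<noteq> 0}"
    then have "bounded (\<Union>b\<in>Basis. {x. fd f b x \<noteq> 0})" by (auto intro: bounded_support_fd)
    then have "bounded {x. gs x \<noteq> 0}"
      by (rule bounded_subset) (auto simp: gs_def sum_nonneg_eq_0_iff)
    then show ?thesis ..
  qed auto
  obtain B r where B: "B \<ge> 0" "\<And>z w. z \<in> ball z0 1 \<Longrightarrow> \<bar>h w * f (z - w)\<bar> \<le> B * \<bar>indicator (cball 0 r) w * h w\<bar>"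
    using convolution_bound[OF bs fc] by blast
  obtain B' r' where B': "B' \<ge> 0" "\<And>z w. z \<in> ball z0 1 \<Longrightarrow> \<bar>h w * gs (z - w)\<bar> \<le> B' * \<bar>indicator (cball 0 r') w * h w\<bar>"
    using convolution_bound[OF gsb gsc] by blast
  show ?thesis
  proof (rule has_derivative_integral[where F="\<lambda>z w. h w * f (z - w)" and D="\<lambda>z w v. h w * fd f v (z - w)"
      and G="\<lambda>w. B' * \<bar>indicator (cball 0 r') w * h w\<bar>"])
    fix z w :: 'a
    have "((\<lambda>z. z - w) has_derivative (\<lambda>v. v)) (at z)" by (auto intro!: derivative_eq_intros)
    from has_derivative_compose[OF this C_k_SucD(1)[OF f, of "z - w"]]
    show "((\<lambda>z. h w * f (z - w)) has_derivative (\<lambda>v. h w * fd f v (z - w))) (at z)"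
      by (intro has_derivative_mult_right)
  next
    show "integrable lborel (\<lambda>w. h w * f (z0 - w))"
    proof (rule Bochner_Integration.integrable_bound)
      show "integrable lborel (\<lambda>w. B * \<bar>indicator (cball 0 r) w * h w\<bar>)" using h by (simp add: loc_int_def)
      show "AE w in lborel. norm (h w * f (z0 - w)) \<le> norm (B * \<bar>indicator (cball 0 r) w * h w\<bar>)"
      proof (intro AE_I2)
        fix w show "norm (h w * f (z0 - w)) \<le> norm (B * \<bar>indicator (cball 0 r) w * h w\<bar>)"
          using B(2)[of z0 w] B(1) by simp
      qed
    qed simp
    show "integrable lborel (\<lambda>w. B' * \<bar>indicator (cball 0 r') w * h w\<bar>)" using h by (simp add: loc_int_def)
    fix z w v assume z: "z \<in> ball z0 1"
    have "\<bar>h w * fd f v (z - w)\<bar> \<le> \<bar>h w\<bar> * (gs (z - w) * norm v)"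
      unfolding gs_def abs_mult by (intro mult_left_mono fd_bound[OF f]) auto
    also have "\<dots> = \<bar>h w * gs (z - w)\<bar> * norm v" by (simp add: abs_mult gs_def sum_nonneg)
    also have "\<dots> \<le> B' * \<bar>indicator (cball 0 r') w * h w\<bar> * norm v" using B'(2)[OF z] by (intro mult_right_mono) auto
    finally show "\<bar>h w * fd f v (z - w)\<bar> \<le> B' * \<bar>indicator (cball 0 r') w * h w\<bar> * norm v" .
  qed measurable
qed

lemma C_k_convolution:
  fixes h f :: "'a::euclidean_space \<Rightarrow> real"
  assumes h: "loc_int h"
  shows "bounded {x. h x \<noteq> 0} \<or> bounded {x. f x \<noteq> 0} \<Longrightarrow> C_k k f \<Longrightarrow> C_k k (\<lambda>z. \<integral>w. h w * f (z - w) \<partial>lborel)"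
proof (induction k arbitrary: f)
  case 0
  then have fc: "continuous_on UNIV f" by simp
  have hm [measurable]: "h \<in> borel_measurable borel" using h by (simp add: loc_int_def)
  have [measurable]: "f \<in> borel_measurable borel" using fc continuous_measurable by auto
  have "isCont (\<lambda>z. \<integral>w. h w * f (z - w) \<partial>lborel) z0" for z0
  proof -
    obtain B r where B: "B \<ge> 0" "\<And>z w. z \<in> ball z0 1 \<Longrightarrow> \<bar>h w * f (z - w)\<bar> \<le> B * \<bar>indicator (cball 0 r) w * h w\<bar>"
      using convolution_bound[OF 0(1) fc] by blast
    show ?thesis
    proof (rule continuous_integral[where G="\<lambda>w. B * \<bar>indicator (cball 0 r) w * h w\<bar>"])
      show "isCont (\<lambda>z. h w * f (z - w)) z0" for w
        using fc by (intro continuous_intros continuous_at_compose[unfolded o_def, of _ "\<lambda>z. z - w" f]) (auto simp: continuous_on_eq_continuous_at)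
      show "integrable lborel (\<lambda>w. B * \<bar>indicator (cball 0 r) w * h w\<bar>)" using h by (simp add: loc_int_def)
    qed (use B in \<open>auto\<close>)
  qed
  then show ?case by (simp add: continuous_at_imp_continuous_on)
next
  case (Suc k)
  show ?case
  proof (rule C_k_SucI[OF convolution_has_derivative[OF h Suc.prems(1,2)]])
    fix v
    have "bounded {x. h x \<noteq> 0} \<or> bounded {x. fd f v x \<noteq> 0}"
      using Suc.prems(1) bounded_support_fd by blast
    then show "C_k k (\<lambda>z. \<integral>w. h w * fd f v (z - w) \<partial>lborel)"
      using C_k_SucD(2)[OF Suc.prems(2)] by (rule Suc.IH)
  qed
qed

text \<open>The integral of f(z - w) over w is independent of z, so its derivative in z vanishes;
  differentiation under the integral then does the work of an integration by parts.\<close>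

lemma integral_fd_eq_0:
  fixes f :: "'a::euclidean_space \<Rightarrow> real"
  assumes f: "C_k (Suc 0) f" "bounded {x. f x \<noteq> 0}"
  shows "(\<integral>x. fd f v x \<partial>lborel) = 0"
proof -
  have [measurable]: "f \<in> borel_measurable borel" "fd f v \<in> borel_measurable borel"
    using continuous_measurable C_k_imp_continuous[OF f(1)] C_k_imp_continuous[OF C_k_SucD(2)[OF f(1)]] by auto
  have "((\<lambda>z. \<integral>w. 1 * f (z - w) \<partial>lborel) has_derivative (\<lambda>v. \<integral>w. 1 * fd f v (0 - w) \<partial>lborel)) (at 0)"
  proof (rule convolution_has_derivative[OF loc_int_continuous _ f(1)])
    show "bounded {x. (1::real) \<noteq> 0} \<or> bounded {x. f x \<noteq> 0}" using f(2) by simp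
  qed simp
  moreover have "(\<integral>w. 1 * f (z - w) \<partial>lborel) = (\<integral>w. f w \<partial>lborel)" for z by (simp add: integral_reflect)
  ultimately have "((\<lambda>z. \<integral>w. f w \<partial>lborel) has_derivative (\<lambda>v. \<integral>w. 1 * fd f v (0 - w) \<partial>lborel)) (at (0::'a))"
    by simp
  from has_derivative_unique[OF this has_derivative_const]
  have "(\<integral>w. 1 * fd f v (0 - w) \<partial>lborel) = 0" by meson
  then show ?thesis using integral_reflect(1)[of "fd f v" 0] by simp
qed

section \<open>Laplacians and Green's second identity\<close>

lemma C_k_2D:
  assumes "C_k 2 f"
  shows "C_k (Suc (Suc 0)) f" "C_k (Suc 0) f" "C_k (Suc 0) (fd f v)" "C_k 0 (fd (fd f v) w)"
proof -
  show 1: "C_k (Suc (Suc 0)) f" using assms by (simp only: numeral_2_eq_2)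
  show "C_k (Suc 0) f" using C_k_Suc_imp[OF 1] .
  show 2: "C_k (Suc 0) (fd f v)" for v using C_k_SucD(2)[OF 1] .
  show "C_k 0 (fd (fd f v) w)" using C_k_SucD(2)[OF 2] .
qed

lemma fd_mult:
  assumes "C_k (Suc 0) f" "C_k (Suc 0) g"
  shows "fd (\<lambda>x. f x * g x) v x = f x * fd g v x + fd f v x * g x"
  by (rule fd_eq[where f'="\<lambda>v. f x * fd g v x + fd f v x * g x"])
     (intro has_derivative_mult C_k_SucD(1)[OF assms(1)] C_k_SucD(1)[OF assms(2)])

lemma fd_diff:
  assumes "C_k (Suc 0) f" "C_k (Suc 0) g"
  shows "fd (\<lambda>x. f x - g x) v x = fd f v x - fd g v x"
  by (rule fd_eq[where f'="\<lambda>v. fd f v x - fd g v x"])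
     (intro has_derivative_diff C_k_SucD(1)[OF assms(1)] C_k_SucD(1)[OF assms(2)])

lemma laplacian_continuous: "C_k 2 f \<Longrightarrow> continuous_on UNIV (laplacian f)"
  unfolding laplacian_def[abs_def] using C_k_2D(4) by (intro continuous_intros) auto

lemma bounded_support_laplacian:
  "bounded {x. f x \<noteq> 0} \<Longrightarrow> bounded {x. laplacian f x \<noteq> 0}"
proof -
  assume "bounded {x. f x \<noteq> 0}"
  then have "bounded (\<Union>v\<in>Basis. {x. fd (fd f v) v x \<noteq> 0})" by (auto intro!: bounded_support_fd)
  then show ?thesis
  proof (rule bounded_subset, intro subsetI)
    fix x assume "x \<in> {x. laplacian f x \<noteq> 0}"
    then show "x \<in> (\<Union>v\<in>Basis. {x. fd (fd f v) v x \<noteq> 0})"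
      using sum.not_neutral_contains_not_neutral[of "\<lambda>v. fd (fd f v) v x" Basis] by (auto simp: laplacian_def)
  qed
qed

text \<open>In each basis direction b the difference u phi_bb - u_bb phi is the b-derivative of u
  phi_b - u_b phi. The latter has bounded support, so the difference integrates to 0.\<close>

lemma green_identity:
  fixes u \<phi> :: "'a::euclidean_space \<Rightarrow> real"
  assumes u: "C_k 2 u" and \<phi>: "C_k 2 \<phi>" "bounded {x. \<phi> x \<noteq> 0}"
  shows "(\<integral>x. u x * laplacian \<phi> x \<partial>lborel) = (\<integral>x. laplacian u x * \<phi> x \<partial>lborel)"
proof -
  define F where "F b x = u x * fd \<phi> b x - fd u b x * \<phi> x" for b x
  have C1: "C_k (Suc 0) (F b)" for b unfolding F_def
    by (intro C_k_diff C_k_mult C_k_2D(2)[OF u] C_k_2D(2)[OF \<phi>(1)] C_k_2D(3)[OF u] C_k_2D(3)[OF \<phi>(1)])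
  have bF: "bounded {x. F b x \<noteq> 0}" for b
    by (rule bounded_subset[OF bounded_Un[THEN iffD2, OF conjI, OF \<phi>(2) bounded_support_fd[OF \<phi>(2), of b]]])
       (auto simp: F_def)
  have fdF: "fd (F b) b x = u x * fd (fd \<phi> b) b x - fd (fd u b) b x * \<phi> x" for b x
    unfolding F_def using C_k_2D[OF u] C_k_2D[OF \<phi>(1)]
    by (subst fd_diff) (auto simp: fd_mult intro!: C_k_mult)
  have int: "integrable lborel (fd (F b) b)" for b
    using loc_int_mult_continuous[OF loc_int_continuous[of "\<lambda>_. 1"] C_k_imp_continuous[OF C_k_SucD(2)[OF C1]] bounded_support_fd[OF bF]]
    by simp
  have "(\<integral>x. u x * laplacian \<phi> x - laplacian u x * \<phi> x \<partial>lborel) = (\<integral>x. (\<Sum>b\<in>Basis. fd (F b) b x) \<partial>lborel)"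
    unfolding fdF laplacian_def by (simp add: sum_subtractf sum_distrib_left sum_distrib_right)
  also have "\<dots> = (\<Sum>b\<in>Basis. \<integral>x. fd (F b) b x \<partial>lborel)"
    using int by (intro Bochner_Integration.integral_sum) auto
  also have "\<dots> = 0" by (intro sum.neutral ballI integral_fd_eq_0 C1 bF)
  finally have "(\<integral>x. u x * laplacian \<phi> x - laplacian u x * \<phi> x \<partial>lborel) = 0" .
  moreover have "integrable lborel (\<lambda>x. u x * laplacian \<phi> x)"
    using u \<phi> by (intro loc_int_mult_continuous loc_int_continuous C_k_imp_continuous laplacian_continuous bounded_support_laplacian)
  moreover have "integrable lborel (\<lambda>x. laplacian u x * \<phi> x)"
    using u \<phi> by (intro loc_int_mult_continuous loc_int_continuous laplacian_continuous) (auto intro: C_k_imp_continuous)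
  ultimately show ?thesis by simp
qed

section \<open>The fundamental solution in the plane\<close>

lemma nn_integral_inverse_1_plus_square_finite:
  "(\<integral>\<^sup>+t. ennreal (1 / (1 + t\<^sup>2)) \<partial>(lborel::real measure)) < \<infinity>"
proof -
  have 1: "(\<integral>\<^sup>+t. ennreal (1 / (1 + t\<^sup>2)) * indicator {0..} t \<partial>(lborel::real measure)) = ennreal (pi / 2 - arctan 0)"
  proof (rule nn_integral_FTC_atLeast)
    show "DERIV arctan x :> 1 / (1 + x\<^sup>2)" for x :: real
      using DERIV_arctan[of x] by (simp add: inverse_eq_divide)
    show "(arctan \<longlongrightarrow> pi / 2) at_top" by (rule tendsto_arctan_at_top)
  qed (auto simp: field_simps)
  have "(\<integral>\<^sup>+t. ennreal (1 / (1 + (-t)\<^sup>2)) * indicator {0..} (-t) \<partial>(lborel::real measure)) = ennreal (pi / 2)"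
    using 1 nn_integral_reflect[of "\<lambda>t::real. ennreal (1 / (1 + t\<^sup>2)) * indicator {0..} t" 0] by simp
  with 1 have "(\<integral>\<^sup>+t. ennreal (1 / (1 + t\<^sup>2)) * indicator {0..} t + ennreal (1 / (1 + (-t)\<^sup>2)) * indicator {0..} (-t) \<partial>(lborel::real measure)) = ennreal (pi / 2) + ennreal (pi / 2)"
    by (subst nn_integral_add) auto
  moreover have "(\<integral>\<^sup>+t. ennreal (1 / (1 + t\<^sup>2)) \<partial>(lborel::real measure)) \<le> (\<integral>\<^sup>+t. ennreal (1 / (1 + t\<^sup>2)) * indicator {0..} t + ennreal (1 / (1 + (-t)\<^sup>2)) * indicator {0..} (-t) \<partial>(lborel::real measure))"
    by (intro nn_integral_mono) (auto simp: indicator_def)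
  moreover have "ennreal (pi / 2) + ennreal (pi / 2) < \<infinity>" by simp
  ultimately show ?thesis by order
qed

text \<open>The total mass of the Laplacian of \<open>ln |z|\<close>. Its value (which is \<open>2 pi\<close>) is never needed.\<close>

definition kap :: real where
  "kap = (\<integral>z. 2 / (1 + (cmod z)\<^sup>2)\<^sup>2 \<partial>(lborel::complex measure))"

text \<open>The integrand is the Laplacian of \<open>reg_log 1\<close>. Since (1 + x^2)(1 + y^2) <=
  (1 + x^2 + y^2)^2, it is dominated by twice a product of functions of one variable, each
  integrated with the arctangent.\<close>

lemma kap_integrable: "integrable lborel (\<lambda>z::complex. 2 / (1 + (cmod z)\<^sup>2)\<^sup>2)"
proof (rule integrableI_nonneg)
  have "(\<integral>\<^sup>+z. ennreal (2 / (1 + (cmod z)\<^sup>2)\<^sup>2) \<partial>lborel) \<le> (\<integral>\<^sup>+z. 2 * (\<Prod>b\<in>Basis. ennreal (1 / (1 + ((z::complex) \<bullet> b)\<^sup>2))) \<partial>lborel)"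
  proof (intro nn_integral_mono)
    fix z :: complex
    have ab: "(1 + a) * (1 + b) \<le> (1 + a + b)\<^sup>2" if "a \<ge> 0" "b \<ge> 0" for a b :: real
      using that mult_nonneg_nonneg[OF that] by (simp add: power2_eq_square algebra_simps)
    have "0 \<le> (Re z)\<^sup>2" "0 \<le> (Im z)\<^sup>2" by auto
    then have "(1 + (Re z)\<^sup>2) * (1 + (Im z)\<^sup>2) \<le> (1 + (Re z)\<^sup>2 + (Im z)\<^sup>2)\<^sup>2"
      by (rule ab)
    then have "2 / (1 + (cmod z)\<^sup>2)\<^sup>2 \<le> 2 / ((1 + (Re z)\<^sup>2) * (1 + (Im z)\<^sup>2))"
      by (intro frac_le) (auto simp: cmod_power2 add.assoc add_pos_nonneg intro!: mult_pos_pos)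
    then have "ennreal (2 / (1 + (cmod z)\<^sup>2)\<^sup>2) \<le> ennreal (2 * (1 / (1 + (Re z)\<^sup>2) * (1 / (1 + (Im z)\<^sup>2))))"
      by (intro ennreal_leI) simp
    also have "\<dots> = 2 * (\<Prod>b\<in>Basis. ennreal (1 / (1 + (z \<bullet> b)\<^sup>2)))"
      by (subst ennreal_mult) (auto simp: Basis_complex_def ennreal_mult[symmetric])
    finally show "ennreal (2 / (1 + (cmod z)\<^sup>2)\<^sup>2) \<le> 2 * (\<Prod>b\<in>Basis. ennreal (1 / (1 + (z \<bullet> b)\<^sup>2)))" .
  qed
  also have "\<dots> = 2 * (\<Prod>b\<in>(Basis::complex set). (\<integral>\<^sup>+t. ennreal (1 / (1 + t\<^sup>2)) \<partial>lborel))"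
    using nn_integral_lborel_prod[where f="\<lambda>_::complex. \<lambda>t. ennreal (1 / (1 + t\<^sup>2))"]
    by (subst nn_integral_cmult) (simp_all del: prod_constant)
  also have "\<dots> < \<infinity>"
    using nn_integral_inverse_1_plus_square_finite by (simp add: Basis_complex_def ennreal_mult_less_top)
  finally show "(\<integral>\<^sup>+z. ennreal (2 / (1 + (cmod z)\<^sup>2)\<^sup>2) \<partial>lborel) < \<infinity>" .
qed auto

lemma kap_pos: "kap > 0"
proof -
  have "kap \<ge> 0" unfolding kap_def by (intro Bochner_Integration.integral_nonneg) auto
  moreover have "kap \<noteq> 0"
  proof
    assume "kap = 0"
    then have "AE z in lborel. 2 / (1 + (cmod z)\<^sup>2)\<^sup>2 = 0"
      unfolding kap_def by (subst (asm) integral_nonneg_eq_0_iff_AE[OF kap_integrable]) auto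
    moreover have "2 / (1 + (cmod z)\<^sup>2)\<^sup>2 \<noteq> 0" for z
      by (metis add_pos_nonneg zero_less_one zero_le_power2 divide_eq_0_iff power_not_zero order_less_irrefl zero_neq_numeral)
    ultimately have "AE z in (lborel :: complex measure). False" by simp
    then show False by (simp add: AE_iff_null null_sets_def)
  qed
  ultimately show ?thesis by simp
qed

lemma abs_ln_le: "x > 0 \<Longrightarrow> \<bar>ln x\<bar> \<le> x + 1 / (x::real)"
proof -
  assume x: "x > 0"
  have "ln x \<le> x" using ln_le_minus_one[OF x] by simp
  moreover have "- ln x \<le> 1 / x" using ln_le_minus_one[of "1/x"] x by (simp add: ln_div)
  moreover have "x > 0" "1 / x > 0" using x by auto
  ultimately show ?thesis by linarith
qed

lemma ln_norm_measurable [measurable]: "(\<lambda>z::complex. ln (cmod z)) \<in> borel_measurable borel"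
  by measurable

lemma loc_int_ln_norm: "loc_int (\<lambda>z::complex. ln (cmod z))"
  unfolding loc_int_def
proof (intro conjI allI)
  fix r
  show "integrable lborel (\<lambda>z. indicat_real (cball 0 r) z * ln (cmod z))"
  proof (rule Bochner_Integration.integrable_bound)
    have "integrable lborel (\<lambda>z::complex. indicat_real (cball 0 r) z * cmod z)"
      using loc_int_continuous[of "\<lambda>z::complex. cmod z"] by (auto simp: loc_int_def intro: continuous_intros)
    then show "integrable lborel (\<lambda>z::complex. indicat_real (cball 0 r) z * cmod z + indicat_real (cball 0 r) z / cmod z)"
      using integrable_inverse_norm by (rule Bochner_Integration.integrable_add)
    show "AE z in lborel. norm (indicat_real (cball 0 r) z * ln (cmod z)) \<le> norm (indicat_real (cball 0 r) z * cmod z + indicat_real (cball 0 r) z / cmod z)"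
      using AE_lborel_singleton[of "0::complex"]
    proof eventually_elim
      fix z :: complex assume "z \<noteq> 0"
      then show "norm (indicat_real (cball 0 r) z * ln (cmod z)) \<le> norm (indicat_real (cball 0 r) z * cmod z + indicat_real (cball 0 r) z / cmod z)"
        using abs_ln_le[of "cmod z"] by (auto simp: indicator_def)
    qed
  qed (intro borel_measurable_times borel_measurable_indicator, simp_all add: ln_norm_measurable del: measurable_lborel1)
qed (rule ln_norm_measurable)

text \<open>A smooth regularisation of ln |z|. Its Laplacian is concentrated near the origin at
  scale \<open>e\<close>, and the substitution z = e w turns it into the fixed density that defines
  \<open>kap\<close>.\<close>

definition reg_log :: "real \<Rightarrow> complex \<Rightarrow> real" where
  "reg_log e z = ln ((cmod z)\<^sup>2 + e\<^sup>2) / 2"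

lemma C_k_norm_square: "C_k k (\<lambda>z::complex. (cmod z)\<^sup>2 + c)"
proof -
  have "(\<lambda>z::complex. (cmod z)\<^sup>2 + c) = (\<lambda>z. Re z * Re z + Im z * Im z + c)"
    by (rule ext) (simp only: cmod_power2, simp add: power2_eq_square)
  then show ?thesis by (simp only:) (intro C_k_add C_k_mult C_k_const C_k_linear[OF bounded_linear_Re] C_k_linear[OF bounded_linear_Im])
qed

lemma norm_square_has_derivative:
  "((\<lambda>z::complex. (cmod z)\<^sup>2 + c) has_derivative (\<lambda>v. 2 * (z \<bullet> v))) (at z)"
  unfolding power2_norm_eq_inner by (auto intro!: derivative_eq_intros simp: inner_commute)

lemma reg_log_has_derivative:
  assumes e: "e > 0"
  shows "(reg_log e has_derivative (\<lambda>v. (z \<bullet> v) * (1 / ((cmod z)\<^sup>2 + e\<^sup>2)))) (at z)"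
proof -
  have p: "(cmod z)\<^sup>2 + e\<^sup>2 > 0" using e by (simp add: add_nonneg_pos)
  have "((\<lambda>z. ln ((cmod z)\<^sup>2 + e\<^sup>2)) has_derivative (\<lambda>v. 1 / ((cmod z)\<^sup>2 + e\<^sup>2) * (2 * (z \<bullet> v)))) (at z)"
    by (rule has_derivative_compose[OF norm_square_has_derivative DERIV_ln_divide[OF p, unfolded has_field_derivative_def]])
  then have "((\<lambda>z. 1 / 2 * ln ((cmod z)\<^sup>2 + e\<^sup>2)) has_derivative (\<lambda>v. 1 / 2 * (1 / ((cmod z)\<^sup>2 + e\<^sup>2) * (2 * (z \<bullet> v))))) (at z)"
    by (rule has_derivative_mult_right)
  then show ?thesis by (simp add: reg_log_def[abs_def])
qed

lemma has_derivative_recip: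
  fixes f :: "'a::real_normed_vector \<Rightarrow> real"
  assumes "(f has_derivative f') (at x)" "f x \<noteq> 0"
  shows "((\<lambda>x. 1 / f x) has_derivative (\<lambda>v. - (f' v * ((1 / f x) * (1 / f x))))) (at x)"
  using assms by (auto intro!: derivative_eq_intros simp: field_simps)

lemma C_k_reg_log:
  assumes e: "e > 0" shows "C_k k (reg_log e)"
proof -
  have p: "(cmod z)\<^sup>2 + e\<^sup>2 \<noteq> 0" for z using e by (simp add: add_nonneg_eq_0_iff)
  have "C_k (Suc k) (reg_log e)"
    by (rule C_k_SucI[OF reg_log_has_derivative[OF e]])
       (intro C_k_mult C_k_linear bounded_linear_inner_left C_k_inverse p C_k_norm_square)
  then show ?thesis by (rule C_k_Suc_imp)
qed

lemma laplacian_reg_log: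
  assumes e: "e > 0"
  shows "laplacian (reg_log e) z = 2 * e\<^sup>2 / ((cmod z)\<^sup>2 + e\<^sup>2)\<^sup>2"
proof -
  define p where "p = (cmod z)\<^sup>2 + e\<^sup>2"
  have p: "p > 0" using e by (simp add: add_nonneg_pos p_def)
  have fd1: "fd (reg_log e) v = (\<lambda>z. (z \<bullet> v) * (1 / ((cmod z)\<^sup>2 + e\<^sup>2)))" for v
    using fd_eq[OF reg_log_has_derivative[OF e]] by auto
  have "((\<lambda>z. (z \<bullet> v) * (1 / ((cmod z)\<^sup>2 + e\<^sup>2))) has_derivative
      (\<lambda>w. (z \<bullet> v) * - (2 * (z \<bullet> w) * ((1 / p) * (1 / p))) + (w \<bullet> v) * (1 / p))) (at z)" for v
    unfolding p_def using p[unfolded p_def]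
    by (intro has_derivative_mult has_derivative_recip norm_square_has_derivative has_derivative_inner_left has_derivative_ident)
       linarith
  from fd_eq[OF this] have fd2: "fd (fd (reg_log e) v) v z = (v \<bullet> v) / p - 2 * (z \<bullet> v)\<^sup>2 / p\<^sup>2" for v
    unfolding fd1 by (simp add: power2_eq_square)
  have "(cmod z)\<^sup>2 = (z \<bullet> 1)\<^sup>2 + (z \<bullet> \<i>)\<^sup>2" by (simp add: cmod_power2)
  then have "laplacian (reg_log e) z = 2 / p - 2 * (cmod z)\<^sup>2 / p\<^sup>2"
    unfolding laplacian_def fd2 by (simp add: Basis_complex_def add_divide_distrib)
  also have "\<dots> = 2 * (p - (cmod z)\<^sup>2) / p\<^sup>2"
    using p by (simp add: field_simps power2_eq_square)
  also have "p - (cmod z)\<^sup>2 = e\<^sup>2" by (simp add: p_def)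
  finally show ?thesis by (simp add: p_def)
qed

lemma reg_log_bound:
  assumes "0 < e" "e \<le> 1" "z \<noteq> 0"
  shows "\<bar>reg_log e z\<bar> \<le> \<bar>ln (cmod z)\<bar> + (cmod z)\<^sup>2"
proof -
  have z: "cmod z > 0" using assms by simp
  have "ln (cmod z) = ln ((cmod z)\<^sup>2) / 2" using z by (simp add: ln_realpow)
  also have "\<dots> \<le> reg_log e z" unfolding reg_log_def using z by (intro divide_right_mono) (auto simp: add_pos_nonneg)
  finally have 1: "ln (cmod z) \<le> reg_log e z" .
  have "e\<^sup>2 \<le> 1" using assms by (simp add: power_le_one)
  then have "ln ((cmod z)\<^sup>2 + e\<^sup>2) \<le> ln (1 + (cmod z)\<^sup>2)"
    using z by (intro ln_mono) (auto simp: add_pos_nonneg)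
  also have "\<dots> \<le> (cmod z)\<^sup>2" by (rule ln_add_one_self_le_self) simp
  finally have "reg_log e z \<le> (cmod z)\<^sup>2 / 2" by (simp add: reg_log_def)
  moreover have "(cmod z)\<^sup>2 \<ge> 0" by simp
  ultimately show ?thesis using 1 by linarith
qed

lemma reg_log_tendsto:
  assumes "e \<longlonglongrightarrow> 0" "z \<noteq> 0"
  shows "(\<lambda>n. reg_log (e n) z) \<longlonglongrightarrow> ln (cmod z)"
proof -
  have "(\<lambda>n. reg_log (e n) z) \<longlonglongrightarrow> ln ((cmod z)\<^sup>2 + 0\<^sup>2) / 2"
    unfolding reg_log_def using assms by (intro tendsto_intros) auto
  then show ?thesis using assms by (simp add: ln_realpow)
qed

text \<open>For \<open>reg_log e\<close> in place of the logarithm, Green's identity moves the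
  Laplacian off \<open>f\<close>, and rescaling by \<open>e\<close> leaves the density of
  \<open>kap\<close> against f(e z). As e tends to 0 both sides converge by domination, the right
  one to \<open>kap * f 0\<close>.\<close>

lemma fundamental_solution:
  fixes f :: "complex \<Rightarrow> real"
  assumes f: "C_k 2 f" "bounded {x. f x \<noteq> 0}"
  shows "(\<integral>z. ln (cmod z) * laplacian f z \<partial>lborel) = kap * f 0"
proof -
  define e where "e n = inverse (real (Suc n))" for n
  have e: "e n > 0" "e n \<le> 1" "e \<longlonglongrightarrow> 0" for n
    using LIMSEQ_inverse_real_of_nat by (auto simp: e_def[abs_def] inverse_le_1_iff simp del: of_nat_Suc)
  have fc: "continuous_on UNIV f" using C_k_imp_continuous f by blast
  have lc: "continuous_on UNIV (laplacian f)" using laplacian_continuous f by blast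
  have [measurable]: "f \<in> borel_measurable borel" "laplacian f \<in> borel_measurable borel"
    using fc lc continuous_measurable by auto
  have mL [measurable]: "reg_log (e n) \<in> borel_measurable borel" for n
    using C_k_imp_continuous[OF C_k_reg_log[OF e(1)]] continuous_measurable by blast
  have L1: "(\<lambda>n. \<integral>z. reg_log (e n) z * laplacian f z \<partial>lborel) \<longlonglongrightarrow> (\<integral>z. ln (cmod z) * laplacian f z \<partial>lborel)"
  proof (rule integral_dominated_convergence[where w="\<lambda>z. (\<bar>ln (cmod z)\<bar> + (cmod z)\<^sup>2) * \<bar>laplacian f z\<bar>"])
    have "loc_int (\<lambda>z::complex. \<bar>ln (cmod z)\<bar>)"
      unfolding loc_int_def
    proof (intro conjI allI)
      fix r
      have "integrable lborel (\<lambda>z::complex. \<bar>indicat_real (cball 0 r) z * ln (cmod z)\<bar>)"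
        using loc_int_ln_norm by (simp add: loc_int_def)
      then show "integrable lborel (\<lambda>z::complex. indicat_real (cball 0 r) z * \<bar>ln (cmod z)\<bar>)"
        by (simp add: abs_mult)
    qed simp
    moreover have "loc_int (\<lambda>z::complex. (cmod z)\<^sup>2)"
      by (intro loc_int_continuous continuous_intros)
    ultimately have "loc_int (\<lambda>z::complex. \<bar>ln (cmod z)\<bar> + (cmod z)\<^sup>2)"
      by (rule loc_int_add)
    moreover have "continuous_on UNIV (\<lambda>z. \<bar>laplacian f z\<bar>)" using lc by (intro continuous_intros)
    moreover have "bounded {z. \<bar>laplacian f z\<bar> \<noteq> 0}" using bounded_support_laplacian[OF f(2)] by simp
    ultimately show "integrable lborel (\<lambda>z. (\<bar>ln (cmod z)\<bar> + (cmod z)\<^sup>2) * \<bar>laplacian f z\<bar>)"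
      by (rule loc_int_mult_continuous)
    show "AE z in lborel. (\<lambda>n. reg_log (e n) z * laplacian f z) \<longlonglongrightarrow> ln (cmod z) * laplacian f z"
      using AE_lborel_singleton[of "0::complex"]
      by eventually_elim (intro tendsto_mult reg_log_tendsto tendsto_const e)
    show "AE z in lborel. norm (reg_log (e n) z * laplacian f z) \<le> (\<bar>ln (cmod z)\<bar> + (cmod z)\<^sup>2) * \<bar>laplacian f z\<bar>" for n
      using AE_lborel_singleton[of "0::complex"]
    proof eventually_elim
      fix z :: complex assume "z \<noteq> 0"
      from reg_log_bound[OF e(1,2) this]
      show "norm (reg_log (e n) z * laplacian f z) \<le> (\<bar>ln (cmod z)\<bar> + (cmod z)\<^sup>2) * \<bar>laplacian f z\<bar>"
        by (simp add: abs_mult mult_right_mono)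
    qed
  qed measurable
  have eq: "(\<integral>z. reg_log (e n) z * laplacian f z \<partial>lborel) = (\<integral>z. 2 / (1 + (cmod z)\<^sup>2)\<^sup>2 * f (e n *\<^sub>R z) \<partial>lborel)" for n
  proof -
    have "(\<integral>z. reg_log (e n) z * laplacian f z \<partial>lborel) = (\<integral>z. laplacian (reg_log (e n)) z * f z \<partial>lborel)"
      by (intro green_identity C_k_reg_log e f)
    also have "\<dots> = (\<integral>z. 2 * (e n)\<^sup>2 / ((cmod z)\<^sup>2 + (e n)\<^sup>2)\<^sup>2 * f z \<partial>lborel)"
      by (simp add: laplacian_reg_log e)
    also have "\<dots> = \<bar>e n\<bar> ^ 2 * (\<integral>z. 2 * (e n)\<^sup>2 / ((cmod (0 + e n *\<^sub>R z))\<^sup>2 + (e n)\<^sup>2)\<^sup>2 * f (0 + e n *\<^sub>R z) \<partial>lborel)"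
      using integral_affine(1)[of "e n" "\<lambda>z. 2 * (e n)\<^sup>2 / ((cmod z)\<^sup>2 + (e n)\<^sup>2)\<^sup>2 * f z" 0] e(1)[of n] by simp
    also have "\<dots> = (\<integral>z. \<bar>e n\<bar> ^ 2 * (2 * (e n)\<^sup>2 / ((cmod (0 + e n *\<^sub>R z))\<^sup>2 + (e n)\<^sup>2)\<^sup>2 * f (0 + e n *\<^sub>R z)) \<partial>lborel)"
      by (rule integral_mult_right_zero[symmetric])
    also have "\<dots> = (\<integral>z. 2 / (1 + (cmod z)\<^sup>2)\<^sup>2 * f (e n *\<^sub>R z) \<partial>lborel)"
    proof (intro Bochner_Integration.integral_cong refl)
      fix z :: complex
      define E where "E = (e n)\<^sup>2"
      have E: "E > 0" using e(1)[of n] by (simp add: E_def)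
      have "(cmod (0 + e n *\<^sub>R z))\<^sup>2 + (e n)\<^sup>2 = E * (1 + (cmod z)\<^sup>2)"
        by (simp add: power_mult_distrib E_def algebra_simps)
      moreover have "E * (2 * E / (E * (1 + (cmod z)\<^sup>2))\<^sup>2 * F) = 2 / (1 + (cmod z)\<^sup>2)\<^sup>2 * F" for F
        using E by (simp add: power2_eq_square)
      ultimately show "\<bar>e n\<bar> ^ 2 * (2 * (e n)\<^sup>2 / ((cmod (0 + e n *\<^sub>R z))\<^sup>2 + (e n)\<^sup>2)\<^sup>2 * f (0 + e n *\<^sub>R z)) = 2 / (1 + (cmod z)\<^sup>2)\<^sup>2 * f (e n *\<^sub>R z)"
        by (simp add: E_def[symmetric])
    qed
    finally show ?thesis .
  qed
  obtain B r where B: "B > 0" "r > 0" "\<And>x. \<bar>f x\<bar> \<le> B * indicator (cball 0 r) x"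
    using continuous_bounded_support[OF fc f(2)] by blast
  have B': "\<bar>f x\<bar> \<le> B" for x using B(3)[of x] B(1) by (cases "x \<in> cball 0 r") auto
  have "(\<lambda>n. \<integral>z. 2 / (1 + (cmod z)\<^sup>2)\<^sup>2 * f (e n *\<^sub>R z) \<partial>lborel) \<longlonglongrightarrow> (\<integral>z. 2 / (1 + (cmod z)\<^sup>2)\<^sup>2 * f 0 \<partial>lborel)"
  proof (rule integral_dominated_convergence[where w="\<lambda>z. 2 / (1 + (cmod z)\<^sup>2)\<^sup>2 * B"])
    show "integrable lborel (\<lambda>z::complex. 2 / (1 + (cmod z)\<^sup>2)\<^sup>2 * B)"
      using kap_integrable by (rule integrable_mult_left)
    show "AE z in lborel. (\<lambda>n. 2 / (1 + (cmod z)\<^sup>2)\<^sup>2 * f (e n *\<^sub>R z)) \<longlonglongrightarrow> 2 / (1 + (cmod z)\<^sup>2)\<^sup>2 * f 0"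
    proof (intro AE_I2 tendsto_mult tendsto_const)
      fix z :: complex
      have "(\<lambda>n. e n *\<^sub>R z) \<longlonglongrightarrow> 0 *\<^sub>R z" using e by (intro tendsto_intros)
      then have "(\<lambda>n. e n *\<^sub>R z) \<longlonglongrightarrow> 0" by simp
      moreover have "isCont f 0" using fc by (simp add: continuous_on_eq_continuous_at)
      ultimately show "(\<lambda>n. f (e n *\<^sub>R z)) \<longlonglongrightarrow> f 0" by (rule isCont_tendsto_compose[rotated])
    qed
    show "AE z in lborel. norm (2 / (1 + (cmod z)\<^sup>2)\<^sup>2 * f (e n *\<^sub>R z)) \<le> 2 / (1 + (cmod z)\<^sup>2)\<^sup>2 * B" for n
    proof (intro AE_I2)
      fix z :: complex
      show "norm (2 / (1 + (cmod z)\<^sup>2)\<^sup>2 * f (e n *\<^sub>R z)) \<le> 2 / (1 + (cmod z)\<^sup>2)\<^sup>2 * B"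
        unfolding norm_mult by (intro mult_mono) (use B' in auto)
    qed
  qed measurable
  then have "(\<lambda>n. \<integral>z. reg_log (e n) z * laplacian f z \<partial>lborel) \<longlonglongrightarrow> kap * f 0"
    unfolding eq by (simp only: kap_def integral_mult_left_zero)
  with L1 show ?thesis by (rule LIMSEQ_unique)
qed

lemma laplacian_reflect:
  assumes f: "C_k 2 f"
  shows "laplacian (\<lambda>x. f (z - x)) x = laplacian f (z - x)"
proof -
  have "fd (\<lambda>x. f (z - x)) v = (\<lambda>x. - fd f v (z - x))" for v
    using fd_reflect[OF C_k_2D(2)[OF f]] by auto
  moreover have "fd (\<lambda>x. - fd f v (z - x)) v x = fd (fd f v) v (z - x)" for v
  proof -
    have "((\<lambda>x. fd f v (z - x)) has_derivative (\<lambda>w. fd (\<lambda>x. fd f v (z - x)) w x)) (at x)"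
      using C_k_SucD(1)[OF C_k_reflect[OF C_k_2D(3)[OF f]]] .
    then have "((\<lambda>x. - fd f v (z - x)) has_derivative (\<lambda>w. - fd (\<lambda>x. fd f v (z - x)) w x)) (at x)"
      by (rule has_derivative_minus)
    from fd_eq[OF this] show ?thesis by (simp add: fd_reflect[OF C_k_2D(3)[OF f]])
  qed
  ultimately show ?thesis by (simp add: laplacian_def)
qed

lemma bounded_support_reflect:
  fixes f :: "'a::real_normed_vector \<Rightarrow> real"
  assumes "bounded {x. f x \<noteq> 0}" shows "bounded {x. f (w - x) \<noteq> 0}"
proof -
  obtain r where r: "\<And>x. f x \<noteq> 0 \<Longrightarrow> norm x \<le> r" using assms by (auto simp: bounded_iff)
  have "norm x \<le> norm w + r" if "f (w - x) \<noteq> 0" for x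
    using r[OF that] norm_triangle_ineq2[of x w] by (simp add: norm_minus_commute)
  then show ?thesis by (auto simp: bounded_iff)
qed

lemma fundamental_solution_shift:
  fixes f :: "complex \<Rightarrow> real"
  assumes f: "C_k 2 f" "bounded {x. f x \<noteq> 0}"
  shows "(\<integral>z. ln (cmod (z - w)) * laplacian f z \<partial>lborel) = kap * f w"
proof -
  have [measurable]: "laplacian f \<in> borel_measurable borel"
    using laplacian_continuous[OF f(1)] continuous_measurable by auto
  have b: "bounded {x. f (w - x) \<noteq> 0}" by (rule bounded_support_reflect[OF f(2)])
  have "(\<integral>z. ln (cmod (z - w)) * laplacian f z \<partial>lborel) = (\<integral>z. ln (cmod ((w - z) - w)) * laplacian f (w - z) \<partial>lborel)"
    by (subst integral_reflect(1)[of "\<lambda>z. ln (cmod (z - w)) * laplacian f z"]) auto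
  also have "\<dots> = (\<integral>z. ln (cmod z) * laplacian (\<lambda>x. f (w - x)) z \<partial>lborel)"
    by (simp add: laplacian_reflect[OF f(1)])
  also have "\<dots> = kap * f w"
    using fundamental_solution[OF C_k_reflect[OF f(1)] b] by simp
  finally show ?thesis .
qed

section \<open>The logarithmic potential of a finite mass\<close>

lemma cball_borel [measurable]: "cball a r \<in> sets borel"
  by (intro borel_closed closed_cball)

lemma indicator_cball_measurable [measurable]: "indicat_real (cball a r) \<in> borel_measurable borel"
  by (intro borel_measurable_indicator cball_borel)

lemma inverse_norm_measurable: "(\<lambda>z::complex. indicat_real (cball 0 r) z / cmod z) \<in> borel_measurable borel"
  by (intro borel_measurable_divide indicator_cball_measurable borel_measurable_norm)

lemma one_plus_norm_pos: "0 < 1 + norm z"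
  by (simp add: add_pos_nonneg)

lemma loc_int_shift:
  assumes h: "loc_int h" shows "loc_int (\<lambda>x. h (x + t))"
  unfolding loc_int_def
proof (intro conjI allI)
  have hm [measurable]: "h \<in> borel_measurable borel" using h by (simp add: loc_int_def)
  show "(\<lambda>x. h (x + t)) \<in> borel_measurable borel" by measurable
  fix r
  have "integrable lborel (\<lambda>x. h x * indicat_real (cball t r) x)"
  proof (rule loc_int_mult[OF h, of _ 1 "norm t + \<bar>r\<bar>"])
    fix x show "\<bar>indicat_real (cball t r) x\<bar> \<le> 1 * indicat_real (cball 0 (norm t + \<bar>r\<bar>)) x"
      using norm_triangle_ineq2[of x t] by (auto simp: indicator_def dist_norm norm_minus_commute)
  qed measurable
  then have "integrable lborel (\<lambda>x. h (x + t) * indicat_real (cball t r) (x + t))"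
    by (subst integral_shift(2)[of "\<lambda>x. h x * indicat_real (cball t r) x"])
       (intro borel_measurable_times hm indicator_cball_measurable, assumption)
  moreover have "(\<lambda>x. h (x + t) * indicat_real (cball t r) (x + t)) = (\<lambda>x. indicat_real (cball 0 r) x * h (x + t))"
    by (auto simp: fun_eq_iff indicator_def dist_norm)
  ultimately show "integrable lborel (\<lambda>x. indicat_real (cball 0 r) x * h (x + t))" by simp
qed

definition csing :: real where
  "csing = (\<integral>z. indicat_real (cball 0 1) z / cmod z \<partial>lborel)"

lemma csing_nonneg: "csing \<ge> 0"
  unfolding csing_def by (intro Bochner_Integration.integral_nonneg) auto

lemma nn_integral_csing:
  "(\<integral>\<^sup>+z. ennreal (indicat_real (cball 0 1) (z - w) / cmod (z - w)) \<partial>lborel) = ennreal csing"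
proof -
  have "(\<integral>\<^sup>+z. ennreal (indicat_real (cball 0 1) (z - w) / cmod (z - w)) \<partial>lborel)
     = (\<integral>\<^sup>+z. ennreal (indicat_real (cball 0 1) z / cmod z) \<partial>lborel)"
    by (subst nn_integral_affine[of 1 "\<lambda>z. ennreal (indicat_real (cball 0 1) z / cmod z)" "- w"]) (use inverse_norm_measurable in auto)
  also have "\<dots> = ennreal csing"
    unfolding csing_def by (rule nn_integral_eq_integral[OF integrable_inverse_norm]) auto
  finally show ?thesis .
qed

text \<open>The point is uniformity in \<open>w\<close>. Within distance 1 of \<open>w\<close> the
  singularity costs at most \<open>csing\<close>; elsewhere the integrand is at most 1 on the
  ball.\<close>

lemma nn_integral_singular:
  "(\<integral>\<^sup>+z. ennreal (indicat_real (cball 0 r) z / cmod (z - w)) \<partial>lborel) \<le> ennreal (measure lborel (cball (0::complex) r) + csing)"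
proof -
  have "(\<integral>\<^sup>+z. ennreal (indicat_real (cball 0 r) z / cmod (z - w)) \<partial>lborel)
    \<le> (\<integral>\<^sup>+z. indicator (cball 0 r) z + ennreal (indicat_real (cball 0 1) (z - w) / cmod (z - w)) \<partial>lborel)"
  proof (intro nn_integral_mono)
    fix z :: complex
    have "indicat_real (cball 0 r) z / cmod (z - w) \<le> indicat_real (cball 0 r) z + indicat_real (cball 0 1) (z - w) / cmod (z - w)"
    proof (cases "cmod (z - w) \<le> 1")
      case False
      then have "1 / cmod (z - w) \<le> 1" by (simp add: divide_le_eq)
      then show ?thesis using False by (auto simp: indicator_def)
    qed (auto simp: indicator_def)
    then have "ennreal (indicat_real (cball 0 r) z / cmod (z - w)) \<le> ennreal (indicat_real (cball 0 r) z + indicat_real (cball 0 1) (z - w) / cmod (z - w))"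
      by (rule ennreal_leI)
    then show "ennreal (indicat_real (cball 0 r) z / cmod (z - w)) \<le> indicator (cball 0 r) z + ennreal (indicat_real (cball 0 1) (z - w) / cmod (z - w))"
      by (simp add: ennreal_plus ennreal_indicator)
  qed
  also have "\<dots> = emeasure lborel (cball (0::complex) r) + ennreal csing"
    by (subst nn_integral_add) (auto simp: nn_integral_csing)
  also have "\<dots> = ennreal (measure lborel (cball (0::complex) r) + csing)"
    using csing_nonneg emeasure_lborel_cball_finite[of "0::complex" r]
    by (subst emeasure_eq_ennreal_measure) auto
  finally show ?thesis .
qed

text \<open>The term ln (1 + |w|) renormalises the logarithmic kernel. A density of finite mass may
  lack a logarithmic moment, but with this term the kernel stays bounded as w tends to infinity;
  formally it alters the potential by a constant. On the diagonal \<open>ln 0 = 0\<close> leaves ln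
  (1 + |w|).\<close>

definition lker :: "complex \<Rightarrow> complex \<Rightarrow> real" where
  "lker z w = ln (1 + cmod w) - ln (cmod (z - w))"

lemma lker_measurable [measurable]: "(\<lambda>(z, w). lker z w) \<in> borel_measurable (borel \<Otimes>\<^sub>M borel)"
  unfolding lker_def by measurable

text \<open>The bound is uniform in \<open>w\<close> because |z - w| <= (1 + |z|)(1 + |w|). It is
  what limits how fast the potential can decrease.\<close>

lemma lker_lower: "- ln (1 + cmod z) \<le> lker z w"
proof (cases "z = w")
  case True
  have "0 \<le> ln (1 + cmod w)" by simp
  then show ?thesis using True by (simp add: lker_def)
next
  case False
  have "cmod (z - w) \<le> cmod z + cmod w" by (rule norm_triangle_ineq4)
  also have "\<dots> \<le> (1 + cmod z) * (1 + cmod w)" by (simp add: algebra_simps)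
  finally have "ln (cmod (z - w)) \<le> ln ((1 + cmod z) * (1 + cmod w))" using False by (intro ln_mono) auto
  also have "\<dots> = ln (1 + cmod z) + ln (1 + cmod w)" by (intro ln_mult_pos one_plus_norm_pos)
  finally show ?thesis by (simp add: lker_def)
qed

lemma lker_upper: "z \<noteq> w \<Longrightarrow> lker z w \<le> ln (1 + (1 + cmod z) / cmod (z - w))"
proof -
  assume zw: "z \<noteq> w"
  have "lker z w = ln ((1 + cmod w) / cmod (z - w))"
    unfolding lker_def using zw by (subst ln_divide_pos) (auto simp: one_plus_norm_pos)
  also have "\<dots> \<le> ln (1 + (1 + cmod z) / cmod (z - w))"
  proof (intro ln_mono)
    have "1 + cmod w \<le> cmod (z - w) + (1 + cmod z)" using norm_triangle_ineq2[of w z] by (simp add: norm_minus_commute)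
    then have "(1 + cmod w) / cmod (z - w) \<le> (cmod (z - w) + (1 + cmod z)) / cmod (z - w)"
      by (intro divide_right_mono) auto
    then show "(1 + cmod w) / cmod (z - w) \<le> 1 + (1 + cmod z) / cmod (z - w)"
      using zw by (simp add: add_divide_distrib)
  qed (use zw in \<open>auto intro!: divide_pos_pos add_pos_nonneg\<close>)
  finally show ?thesis .
qed

lemma lker_abs: "\<bar>lker z w\<bar> \<le> (1 + cmod z) * (1 + 1 / cmod (z - w))"
proof -
  have l: "ln (1 + cmod z) \<le> cmod z" by (rule ln_add_one_self_le_self) simp
  have 1: "- lker z w \<le> (1 + cmod z) * (1 + 1 / cmod (z - w))"
  proof -
    have "- lker z w \<le> cmod z" using lker_lower[of z w] l by linarith
    also have "\<dots> \<le> (1 + cmod z) * 1" by simp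
    also have "\<dots> \<le> (1 + cmod z) * (1 + 1 / cmod (z - w))" by (intro mult_left_mono) auto
    finally show ?thesis .
  qed
  have 2: "lker z w \<le> (1 + cmod z) * (1 + 1 / cmod (z - w))"
  proof (cases "z = w")
    case True
    then show ?thesis using l by (simp add: lker_def)
  next
    case False
    have "lker z w \<le> (1 + cmod z) / cmod (z - w)"
      using lker_upper[OF False] ln_add_one_self_le_self[of "(1 + cmod z) / cmod (z - w)"] by simp
    also have "\<dots> \<le> (1 + cmod z) * (1 + 1 / cmod (z - w))" by (simp add: algebra_simps)
    finally show ?thesis .
  qed
  from 1 2 show ?thesis by linarith
qed

locale finite_mass =
  fixes g :: "complex \<Rightarrow> real"
  assumes g_int: "integrable lborel g" and g_nonneg: "\<And>w. g w \<ge> 0"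
begin

definition "mass = (\<integral>w. g w \<partial>lborel)"

text \<open>Division by \<open>kap\<close> normalises the potential so that its negative Laplacian
  is \<open>g\<close>. At a point where the kernel is not integrable the value is the default 0,
  which can happen only on a null set.\<close>

definition "logpot z = (\<integral>w. lker z w * g w \<partial>lborel) / kap"

text \<open>Finiteness of the Riesz potential implies integrability of the logarithmic kernel, and
  it is also what the gradient of \<open>logpot\<close> requires.\<close>

definition "good z \<longleftrightarrow> integrable lborel (\<lambda>w. g w / cmod (z - w))"

lemma g_meas [measurable]: "g \<in> borel_measurable borel"
  using g_int by simp

lemma mass_nonneg: "mass \<ge> 0"
  unfolding mass_def using g_nonneg by (intro Bochner_Integration.integral_nonneg) auto

text \<open>The integral in \<open>z\<close> over a ball is bounded uniformly in \<open>w\<close>,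
  so finite mass gives a majorant on the product space. Every later exchange of integrals for the
  potential rests on it.\<close>

lemma pair_integrable:
  "integrable (lborel \<Otimes>\<^sub>M lborel) (\<lambda>(z, w). indicat_real (cball 0 r) z * (g w * (1 + 1 / cmod (z - w))))"
proof (rule integrableI_nonneg)
  let ?f = "\<lambda>z w. indicat_real (cball 0 r) z * (g w * (1 + 1 / cmod (z - w)))"
  have [measurable]: "(\<lambda>(z, w). ennreal (?f z w)) \<in> borel_measurable (lborel \<Otimes>\<^sub>M lborel)"
    by measurable
  have inner: "(\<integral>\<^sup>+z. ennreal (?f z w) \<partial>lborel) \<le> ennreal (g w) * ennreal (2 * measure lborel (cball (0::complex) r) + csing)" for w
  proof -
    have "(\<integral>\<^sup>+z. ennreal (?f z w) \<partial>lborel)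
      = (\<integral>\<^sup>+z. ennreal (g w) * (indicator (cball 0 r) z + ennreal (indicat_real (cball 0 r) z / cmod (z - w))) \<partial>lborel)"
      by (intro nn_integral_cong) (auto simp: indicator_def ennreal_mult[symmetric] g_nonneg ennreal_plus[symmetric] simp del: ennreal_plus simp flip: ennreal_1)
    also have "\<dots> = ennreal (g w) * (emeasure lborel (cball (0::complex) r) + (\<integral>\<^sup>+z. ennreal (indicat_real (cball 0 r) z / cmod (z - w)) \<partial>lborel))"
      by (subst nn_integral_cmult, simp, subst nn_integral_add) auto
    also have "\<dots> \<le> ennreal (g w) * (emeasure lborel (cball (0::complex) r) + ennreal (measure lborel (cball (0::complex) r) + csing))"
      by (intro mult_left_mono add_left_mono nn_integral_singular) auto
    also have "\<dots> = ennreal (g w) * ennreal (2 * measure lborel (cball (0::complex) r) + csing)"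
      using csing_nonneg emeasure_lborel_cball_finite[of "0::complex" r]
      by (subst emeasure_eq_ennreal_measure) (auto simp: ennreal_plus[symmetric] simp del: ennreal_plus)
    finally show ?thesis .
  qed
  have "(\<integral>\<^sup>+x. ennreal (case x of (z, w) \<Rightarrow> ?f z w) \<partial>(lborel \<Otimes>\<^sub>M lborel)) = (\<integral>\<^sup>+w. (\<integral>\<^sup>+z. ennreal (?f z w) \<partial>lborel) \<partial>lborel)"
    using lborel_pair.nn_integral_snd[of "\<lambda>x. ennreal (case x of (z, w) \<Rightarrow> ?f z w)"] by (simp add: split_beta')
  also have "\<dots> \<le> (\<integral>\<^sup>+w. ennreal (g w) * ennreal (2 * measure lborel (cball (0::complex) r) + csing) \<partial>lborel)"
    by (intro nn_integral_mono inner)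
  also have "\<dots> < \<infinity>"
    using g_int by (subst nn_integral_multc) (auto simp: nn_integral_eq_integral g_nonneg ennreal_mult_less_top)
  finally show "(\<integral>\<^sup>+x. ennreal (case x of (z, w) \<Rightarrow> ?f z w) \<partial>(lborel \<Otimes>\<^sub>M lborel)) < \<infinity>" .
qed (auto simp: g_nonneg)

lemma pair_lker_integrable:
  assumes [measurable]: "f \<in> borel_measurable borel" and f: "\<And>z. \<bar>f z\<bar> \<le> B * indicat_real (cball 0 r) z"
  shows "integrable (lborel \<Otimes>\<^sub>M lborel) (\<lambda>(z, w). f z * (lker z w * g w))"
proof (rule Bochner_Integration.integrable_bound)
  show "integrable (lborel \<Otimes>\<^sub>M lborel) (\<lambda>x. (\<bar>B\<bar> * (1 + \<bar>r\<bar>)) * (case x of (z, w) \<Rightarrow> indicat_real (cball 0 r) z * (g w * (1 + 1 / cmod (z - w)))))"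
    by (intro integrable_mult_right pair_integrable)
  show "(\<lambda>(z, w). f z * (lker z w * g w)) \<in> borel_measurable (lborel \<Otimes>\<^sub>M lborel)" by measurable
  show "AE x in lborel \<Otimes>\<^sub>M lborel. norm (case x of (z, w) \<Rightarrow> f z * (lker z w * g w))
     \<le> norm ((\<bar>B\<bar> * (1 + \<bar>r\<bar>)) * (case x of (z, w) \<Rightarrow> indicat_real (cball 0 r) z * (g w * (1 + 1 / cmod (z - w)))))"
  proof (intro AE_I2)
    fix x :: "complex \<times> complex"
    obtain z w where x: "x = (z, w)" by (cases x)
    have "\<bar>f z * (lker z w * g w)\<bar> \<le> (\<bar>B\<bar> * (1 + \<bar>r\<bar>)) * (indicat_real (cball 0 r) z * (g w * (1 + 1 / cmod (z - w))))"
    proof (cases "z \<in> cball 0 r")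
      case True
      have "\<bar>lker z w\<bar> \<le> (1 + \<bar>r\<bar>) * (1 + 1 / cmod (z - w))"
        using True by (intro order_trans[OF lker_abs] mult_right_mono) (auto simp: add_nonneg_nonneg)
      moreover have "\<bar>f z\<bar> \<le> \<bar>B\<bar>" using f[of z] True by simp
      ultimately have "\<bar>f z\<bar> * (\<bar>lker z w\<bar> * g w) \<le> \<bar>B\<bar> * ((1 + \<bar>r\<bar>) * (1 + 1 / cmod (z - w)) * g w)"
        using g_nonneg[of w] by (intro mult_mono mult_right_mono) auto
      then show ?thesis using True g_nonneg[of w] by (simp add: abs_mult mult_ac)
    next
      case False
      then show ?thesis using f[of z] by simp
    qed
    then show "norm (case x of (z, w) \<Rightarrow> f z * (lker z w * g w))
     \<le> norm ((\<bar>B\<bar> * (1 + \<bar>r\<bar>)) * (case x of (z, w) \<Rightarrow> indicat_real (cball 0 r) z * (g w * (1 + 1 / cmod (z - w)))))"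
      unfolding x by simp
  qed
qed

lemma AE_good: "AE z in lborel. good z"
proof -
  have "AE z in lborel. z \<in> cball 0 (real n) \<longrightarrow> good z" for n
  proof -
    have "AE z in lborel. integrable lborel (\<lambda>w. indicat_real (cball 0 (real n)) z * (g w * (1 + 1 / cmod (z - w))))"
      using lborel_pair.AE_integrable_fst'[OF pair_integrable[of "real n"]] by simp
    then show ?thesis
    proof eventually_elim
      fix z assume i: "integrable lborel (\<lambda>w. indicat_real (cball 0 (real n)) z * (g w * (1 + 1 / cmod (z - w))))"
      show "z \<in> cball 0 (real n) \<longrightarrow> good z"
      proof
        assume "z \<in> cball 0 (real n)"
        then have "integrable lborel (\<lambda>w. g w * (1 + 1 / cmod (z - w)) - g w)"
          using i g_int by (intro Bochner_Integration.integrable_diff) auto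
        then show "good z" by (simp add: good_def algebra_simps)
      qed
    qed
  qed
  then have "AE z in lborel. \<forall>n. z \<in> cball 0 (real n) \<longrightarrow> good z" by (intro AE_all_countable[THEN iffD2] allI)
  then show ?thesis by eventually_elim (meson mem_cball_0 real_arch_simple)
qed

lemma good_lker_integrable:
  assumes "good z" shows "integrable lborel (\<lambda>w. lker z w * g w)"
proof (rule Bochner_Integration.integrable_bound)
  show "integrable lborel (\<lambda>w. (1 + cmod z) * (g w + g w / cmod (z - w)))"
    using assms g_int by (simp add: good_def)
  show "AE w in lborel. norm (lker z w * g w) \<le> norm ((1 + cmod z) * (g w + g w / cmod (z - w)))"
  proof (intro AE_I2)
    fix w
    have "\<bar>lker z w\<bar> * g w \<le> (1 + cmod z) * (1 + 1 / cmod (z - w)) * g w"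
      using g_nonneg by (intro mult_right_mono lker_abs)
    then show "norm (lker z w * g w) \<le> norm ((1 + cmod z) * (g w + g w / cmod (z - w)))"
      using g_nonneg[of w] by (simp add: abs_mult algebra_simps add_nonneg_nonneg)
  qed
qed measurable

lemma loc_int_logpot: "loc_int logpot"
  unfolding loc_int_def
proof (intro conjI allI)
  show m: "logpot \<in> borel_measurable borel"
    unfolding logpot_def[abs_def] by measurable
  fix r
  have "integrable lborel (\<lambda>z. \<integral>w. indicat_real (cball 0 r) z * (lker z w * g w) \<partial>lborel)"
    using lborel_pair.integrable_fst'[OF pair_lker_integrable[of "indicat_real (cball 0 r)" 1 r]] by simp
  then have "integrable lborel (\<lambda>z. (indicat_real (cball 0 r) z * (\<integral>w. lker z w * g w \<partial>lborel)) / kap)"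
    by simp
  then show "integrable lborel (\<lambda>z. indicat_real (cball 0 r) z * logpot z)"
    by (simp add: logpot_def)
qed

text \<open>Integrating \<open>lker_lower\<close> against the mass gives the bound, and the default
  value 0 at points without integrability satisfies it as well.\<close>

lemma logpot_lower: "- logpot z \<le> mass / kap * ln (1 + cmod z)"
proof (cases "integrable lborel (\<lambda>w. lker z w * g w)")
  case True
  have "(\<integral>w. - ln (1 + cmod z) * g w \<partial>lborel) \<le> (\<integral>w. lker z w * g w \<partial>lborel)"
    using g_int True g_nonneg by (intro integral_mono mult_right_mono lker_lower) auto
  then have "- (ln (1 + cmod z) * mass) / kap \<le> logpot z"
    unfolding logpot_def mass_def using kap_pos by (intro divide_right_mono) auto
  then show ?thesis by (simp add: mult.commute)
next
  case False
  then have "logpot z = 0" by (simp add: logpot_def not_integrable_integral_eq)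
  then show ?thesis using mass_nonneg kap_pos by simp
qed

text \<open>After Fubini the inner integral is taken in \<open>z\<close>. There the renormalising
  term ln (1 + |w|) is a constant and integrates to 0 against a Laplacian, and the logarithm is the
  fundamental solution.\<close>

lemma logpot_weak:
  assumes \<phi>: "C_k 2 \<phi>" "bounded {x. \<phi> x \<noteq> 0}"
  shows "(\<integral>z. logpot z * laplacian \<phi> z \<partial>lborel) = - (\<integral>w. g w * \<phi> w \<partial>lborel)"
proof -
  have lc: "continuous_on UNIV (laplacian \<phi>)" using laplacian_continuous \<phi> by blast
  have lb: "bounded {x. laplacian \<phi> x \<noteq> 0}" using bounded_support_laplacian \<phi> by blast
  have [measurable]: "laplacian \<phi> \<in> borel_measurable borel" using lc continuous_measurable by auto
  obtain B r where B: "\<And>x. \<bar>laplacian \<phi> x\<bar> \<le> B * indicat_real (cball 0 r) x"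
    using continuous_bounded_support[OF lc lb] by blast
  have lap0: "(\<integral>z. laplacian \<phi> z \<partial>lborel) = 0"
    using green_identity[OF C_k_const[of 2 1] \<phi>] by (simp add: laplacian_def frechet_derivative_const)
  have int1: "integrable lborel (\<lambda>z. ln (cmod (z - w)) * laplacian \<phi> z)" for w
    using loc_int_mult_continuous[OF loc_int_shift[OF loc_int_ln_norm, of "- w"] lc lb] by simp
  have int2: "integrable lborel (laplacian \<phi>)"
    using loc_int_mult_continuous[OF loc_int_continuous[of "\<lambda>_. 1"] lc lb] by simp
  have inner: "(\<integral>z. laplacian \<phi> z * (lker z w * g w) \<partial>lborel) = - kap * (g w * \<phi> w)" for w
  proof -
    have "(\<integral>z. laplacian \<phi> z * (lker z w * g w) \<partial>lborel) = (\<integral>z. (ln (1 + cmod w) * g w) * laplacian \<phi> z - g w * (ln (cmod (z - w)) * laplacian \<phi> z) \<partial>lborel)"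
      by (intro Bochner_Integration.integral_cong) (auto simp: lker_def algebra_simps)
    also have "\<dots> = (ln (1 + cmod w) * g w) * (\<integral>z. laplacian \<phi> z \<partial>lborel) - g w * (\<integral>z. ln (cmod (z - w)) * laplacian \<phi> z \<partial>lborel)"
      using int1 int2 by simp
    also have "\<dots> = - kap * (g w * \<phi> w)"
      using lap0 fundamental_solution_shift[OF \<phi>, of w] by simp
    finally show ?thesis .
  qed
  have "(\<integral>z. logpot z * laplacian \<phi> z \<partial>lborel) = (\<integral>z. (\<integral>w. laplacian \<phi> z * (lker z w * g w) \<partial>lborel) / kap \<partial>lborel)"
    by (simp add: logpot_def mult.commute)
  also have "\<dots> = (\<integral>z. (\<integral>w. laplacian \<phi> z * (lker z w * g w) \<partial>lborel) \<partial>lborel) / kap" by simp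
  also have "\<dots> = (\<integral>w. (\<integral>z. laplacian \<phi> z * (lker z w * g w) \<partial>lborel) \<partial>lborel) / kap"
    using pair_lker_integrable[OF _ B] by (subst lborel_pair.Fubini_integral) (auto simp: split_beta')
  also have "\<dots> = (- kap * (\<integral>w. g w * \<phi> w \<partial>lborel)) / kap"
    unfolding inner by simp
  finally show ?thesis using kap_pos by simp
qed

end

text \<open>By harmonicity H_x - i H_y is entire, so \<open>H\<close> is, up to a constant, the real
  part of an entire function F. The modulus of exp (F / n) involves only H, so a bound from above
  suffices to make exp (F / n) of linear growth. It is then affine by Liouville's theorem, and
  constant because it has no zero.\<close>

lemma harmonic_log_bound_const:
  fixes H :: "complex \<Rightarrow> real"
  assumes H: "C_k 2 H" and lap: "\<And>z. laplacian H z = 0" and up: "\<And>z. H z \<le> C + D * ln (1 + cmod z)"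
  shows "H z = H 0"
proof -
  define f where "f z = Complex (fd H 1 z) (- fd H \<i> z)" for z
  have lin: "fd h v z = Re v * fd h 1 z + Im v * fd h \<i> z" if "C_k (Suc 0) h" for h and v z :: complex
  proof -
    have "fd h v z = fd h (Re v *\<^sub>R 1 + Im v *\<^sub>R \<i>) z"
      by (rule arg_cong[where f="\<lambda>v. fd h v z"]) (simp add: complex_eq_iff)
    then show ?thesis by (simp add: linear_add[OF fd_linear[OF that]] linear_scale[OF fd_linear[OF that]])
  qed
  have der: "(f has_field_derivative Complex (fd (fd H 1) 1 z) (- fd (fd H 1) \<i> z)) (at z)" for z
  proof -
    have a: "fd (fd H \<i>) \<i> z = - fd (fd H 1) 1 z" using lap[of z] by (simp add: laplacian_def Basis_complex_def)
    have b: "fd (fd H \<i>) 1 z = fd (fd H 1) \<i> z" by (rule fd_symmetric[OF H])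
    have "((\<lambda>z. complex_of_real (fd H 1 z) - \<i> * complex_of_real (fd H \<i> z)) has_derivative
       (\<lambda>v. complex_of_real (fd (fd H 1) v z) - \<i> * complex_of_real (fd (fd H \<i>) v z))) (at z)"
      by (intro has_derivative_diff has_derivative_of_real has_derivative_mult_right C_k_SucD(1)[OF C_k_2D(3)[OF H]])
    moreover have "(\<lambda>z. complex_of_real (fd H 1 z) - \<i> * complex_of_real (fd H \<i> z)) = f"
      by (auto simp: f_def complex_eq_iff)
    moreover have "complex_of_real (fd (fd H 1) v z) - \<i> * complex_of_real (fd (fd H \<i>) v z) = Complex (fd (fd H 1) 1 z) (- fd (fd H 1) \<i> z) * v" for v
    proof -
      have "fd (fd H 1) v z = Re v * fd (fd H 1) 1 z + Im v * fd (fd H 1) \<i> z"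
        "fd (fd H \<i>) v z = Re v * fd (fd H \<i>) 1 z + Im v * fd (fd H \<i>) \<i> z"
        by (rule lin[OF C_k_2D(3)[OF H]])+
      then show ?thesis unfolding a b by (simp add: complex_eq_iff)
    qed
    ultimately have "(f has_derivative (\<lambda>v. Complex (fd (fd H 1) 1 z) (- fd (fd H 1) \<i> z) * v)) (at z)" by simp
    then show ?thesis unfolding has_field_derivative_def .
  qed
  then have holf: "f holomorphic_on UNIV"
    by (meson field_differentiable_at_within field_differentiable_def holomorphic_on_def)
  obtain F where F: "\<And>z. (F has_field_derivative f z) (at z)"
    using holomorphic_convex_primitive'[OF _ _ holf] by auto
  have ReF: "((\<lambda>z. Re (F z)) has_derivative (\<lambda>v. fd H v z)) (at z)" for z
  proof -
    have "((\<lambda>z. Re (F z)) has_derivative (\<lambda>v. Re (f z * v))) (at z)"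
      using F[of z] unfolding has_field_derivative_def by (rule has_derivative_Re)
    moreover have "Re (f z * v) = fd H v z" for v
      by (subst lin[OF C_k_2D(2)[OF H]]) (simp add: f_def)
    ultimately show ?thesis by simp
  qed
  have "((\<lambda>z. Re (F z) - H z) has_derivative (\<lambda>v. 0)) (at z within UNIV)" for z
    using has_derivative_diff[OF ReF C_k_SucD(1)[OF C_k_2D(2)[OF H]], of z] by simp
  then obtain d where d: "\<And>z. Re (F z) - H z = d"
    using has_derivative_zero_constant[of UNIV "\<lambda>z. Re (F z) - H z"] by auto
  \<comment> \<open>Dividing by n >= D reduces growth of order |z|^D to linear growth; n >= 1 keeps
    the division meaningful.\<close>
  obtain n :: nat where n: "real n \<ge> max D 1" using real_arch_simple by blast
  define E where "E z = exp (F z / of_nat n)" for z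
  have nE: "cmod (E z) = exp ((H z + d) / real n)" for z
    using d[of z] by (simp add: E_def algebra_simps)
  have holE: "E holomorphic_on UNIV"
    unfolding E_def using F n
    by (intro holomorphic_intros) (auto simp: holomorphic_on_def field_differentiable_def intro: has_field_derivative_at_within)
  have bd: "cmod (E z) \<le> (2 * exp ((C + d) / real n)) * cmod z ^ 1" if z: "1 \<le> cmod z" for z
  proof -
    have "D * ln (1 + cmod z) \<le> real n * ln (1 + cmod z)" using n by (intro mult_right_mono) auto
    then have "(H z + d) / real n \<le> (C + d + real n * ln (1 + cmod z)) / real n"
      using up[of z] n by (intro divide_right_mono) auto
    also have "\<dots> = (C + d) / real n + ln (1 + cmod z)" using n by (simp add: add_divide_distrib)
    finally have "cmod (E z) \<le> exp ((C + d) / real n + ln (1 + cmod z))" by (simp add: nE)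
    also have "\<dots> = exp ((C + d) / real n) * (1 + cmod z)" using z by (simp add: exp_add)
    also have "\<dots> \<le> exp ((C + d) / real n) * (2 * cmod z)" using z by (intro mult_left_mono) auto
    finally show ?thesis by simp
  qed
  define E1 where "E1 = deriv E 0"
  have E: "E z = E 0 + E1 * z" for z
    using Liouville_polynomial[OF holE bd, where \<xi>=z] by (simp add: E1_def)
  have "E1 = 0"
  proof (rule ccontr)
    assume "E1 \<noteq> 0"
    then have "E (- E 0 / E1) = 0" by (subst E) simp
    then show False by (simp add: E_def)
  qed
  then have "cmod (E z) = cmod (E 0)" by (subst E) simp
  then show ?thesis using n by (simp add: nE)
qed

lemma test_function_reflect: "test_function \<phi> \<Longrightarrow> test_function (\<lambda>x. \<phi> (z - x))"
  using test_functionD[of \<phi>] C_k_reflect bounded_support_reflect by (intro test_functionI) blast+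

lemma AE_lborel_imp_ex:
  assumes "AE w in (lborel :: 'a::euclidean_space measure). P w" shows "\<exists>w. P w"
proof (rule ccontr)
  assume "\<nexists>w. P w"
  with assms have "AE w in (lborel :: 'a measure). False" by simp
  then show False by (simp add: AE_iff_null null_sets_def)
qed

lemma test_function_measurable: "test_function \<phi> \<Longrightarrow> \<phi> \<in> borel_measurable borel"
  using C_k_imp_continuous[OF test_functionD(1)[of \<phi> 0]] continuous_measurable by blast

lemma fd_convolution:
  assumes "loc_int h" "bounded {x. h x \<noteq> 0} \<or> bounded {x. f x \<noteq> 0}" "C_k (Suc k) f"
  shows "fd (\<lambda>z. \<integral>w. h w * f (z - w) \<partial>lborel) v z = (\<integral>w. h w * fd f v (z - w) \<partial>lborel)"
  by (rule fd_eq[OF convolution_has_derivative[OF assms]])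

lemma laplacian_convolution:
  assumes h: "loc_int h" and \<phi>: "test_function \<phi>"
  shows "laplacian (\<lambda>z. \<integral>w. h w * \<phi> (z - w) \<partial>lborel) z = (\<integral>w. h w * laplacian (\<lambda>x. \<phi> (z - x)) w \<partial>lborel)"
proof -
  have b: "bounded {x. \<phi> x \<noteq> 0}" "bounded {x. fd \<phi> v x \<noteq> 0}" for v
    using test_functionD[OF \<phi>] test_functionD[OF test_function_fd[OF \<phi>]] by auto
  have t2: "test_function (\<lambda>w. fd (fd \<phi> v) v (z - w))" for v
    by (intro test_function_reflect test_function_fd \<phi>)
  have i: "integrable lborel (\<lambda>w. h w * fd (fd \<phi> v) v (z - w))" for v
    using loc_int_mult_continuous[OF h C_k_imp_continuous[OF test_functionD(1)[OF t2]] test_functionD(2)[OF t2]] .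
  have "fd (\<lambda>z. \<integral>w. h w * \<phi> (z - w) \<partial>lborel) v z = (\<integral>w. h w * fd \<phi> v (z - w) \<partial>lborel)" for v z
    by (rule fd_convolution[OF h disjI2 test_functionD(1)[OF \<phi>]]) (rule b)
  moreover have "fd (\<lambda>z. \<integral>w. h w * fd \<phi> v (z - w) \<partial>lborel) v z = (\<integral>w. h w * fd (fd \<phi> v) v (z - w) \<partial>lborel)" for v
    by (rule fd_convolution[OF h disjI2 test_functionD(1)[OF test_function_fd[OF \<phi>]]]) (rule b)
  ultimately have "laplacian (\<lambda>z. \<integral>w. h w * \<phi> (z - w) \<partial>lborel) z = (\<Sum>v\<in>Basis. \<integral>w. h w * fd (fd \<phi> v) v (z - w) \<partial>lborel)"
    by (simp add: laplacian_def)
  also have "\<dots> = (\<integral>w. (\<Sum>v\<in>Basis. h w * fd (fd \<phi> v) v (z - w)) \<partial>lborel)"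
    using i by (intro Bochner_Integration.integral_sum[symmetric])
  also have "\<dots> = (\<integral>w. h w * laplacian \<phi> (z - w) \<partial>lborel)"
    by (simp add: laplacian_def sum_distrib_left)
  finally show ?thesis by (simp add: laplacian_reflect[OF test_functionD(1)[OF \<phi>]])
qed

text \<open>Each convolution with a nonnegative test function is harmonic with a logarithmic upper
  bound, hence constant. So \<open>h\<close> has equal integrals against all translates of a test
  function, which makes it almost everywhere invariant under each single translation. Fubini
  exchanges the two quantifiers and yields one point \<open>w0\<close> whose value is taken almost
  everywhere; no limit of mollifiers is involved.\<close>

lemma weakly_harmonic_const:
  fixes h :: "complex \<Rightarrow> real"
  assumes h: "loc_int h"
    and wh: "\<And>\<phi>. test_function \<phi> \<Longrightarrow> (\<integral>w. h w * laplacian \<phi> w \<partial>lborel) = 0"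
    and up: "\<And>\<phi>. test_function \<phi> \<Longrightarrow> (\<And>x. \<phi> x \<ge> 0) \<Longrightarrow>
      \<exists>C D. \<forall>z. (\<integral>w. h w * \<phi> (z - w) \<partial>lborel) \<le> C + D * ln (1 + cmod z)"
  shows "\<exists>c. AE z in lborel. h z = c"
proof -
  have hm [measurable]: "h \<in> borel_measurable borel" using h by (simp add: loc_int_def)
  have const: "(\<integral>w. h w * \<phi> (z - w) \<partial>lborel) = (\<integral>w. h w * \<phi> (0 - w) \<partial>lborel)"
    if \<phi>: "test_function \<phi>" "\<And>x. \<phi> x \<ge> 0" for \<phi> z
  proof -
    obtain C D where CD: "\<And>z. (\<integral>w. h w * \<phi> (z - w) \<partial>lborel) \<le> C + D * ln (1 + cmod z)"
      using up[OF \<phi>] by blast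
    show ?thesis
    proof (rule harmonic_log_bound_const[OF _ _ CD])
      show "C_k 2 (\<lambda>z. \<integral>w. h w * \<phi> (z - w) \<partial>lborel)"
        using test_functionD[OF \<phi>(1)] by (intro C_k_convolution[OF h]) auto
      show "laplacian (\<lambda>z. \<integral>w. h w * \<phi> (z - w) \<partial>lborel) z = 0" for z
        using wh[OF test_function_reflect[OF \<phi>(1)]] laplacian_convolution[OF h \<phi>(1)] by simp
    qed
  qed
  have per: "AE w in lborel. h (w + v) - h w = 0" for v
  proof (rule integral_test_eq_0_imp_AE_0)
    show "loc_int (\<lambda>w. h (w + v) - h w)" by (intro loc_int_diff loc_int_shift h)
    fix \<eta> :: "complex \<Rightarrow> real" assume \<eta>: "test_function \<eta>" "\<And>x. \<eta> x \<ge> 0"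
    have [measurable]: "\<eta> \<in> borel_measurable borel" using test_function_measurable[OF \<eta>(1)] .
    have i: "integrable lborel (\<lambda>w. h w * \<eta> w)" "integrable lborel (\<lambda>w. h (w + v) * \<eta> w)"
      using loc_int_mult_continuous[OF _ C_k_imp_continuous[OF test_functionD(1)[OF \<eta>(1)]] test_functionD(2)[OF \<eta>(1)]]
        h loc_int_shift[OF h] by blast+
    have "(\<integral>w. h w * \<eta> (0 - (v - w)) \<partial>lborel) = (\<integral>w. h w * \<eta> (0 - (0 - w)) \<partial>lborel)"
      using const[OF test_function_reflect[OF \<eta>(1)], of 0 v] \<eta>(2) by simp
    then have "(\<integral>w. h w * \<eta> (w - v) \<partial>lborel) = (\<integral>w. h w * \<eta> w \<partial>lborel)" by simp
    moreover have "(\<integral>w. h w * \<eta> (w - v) \<partial>lborel) = (\<integral>w. h (w + v) * \<eta> w \<partial>lborel)"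
      using integral_shift(1)[of "\<lambda>w. h w * \<eta> (w - v)" v] by simp
    ultimately show "(\<integral>w. (h (w + v) - h w) * \<eta> w \<partial>lborel) = 0"
      using i by (simp add: left_diff_distrib)
  qed
  have "AE v in lborel. AE w in lborel. h (w + v) = h w" using per by simp
  moreover have "{x \<in> space (lborel \<Otimes>\<^sub>M lborel). h (fst x + snd x) = h (fst x)} \<in> sets (lborel \<Otimes>\<^sub>M (lborel :: complex measure))"
    by measurable
  ultimately have "AE w in lborel. AE v in lborel. h (w + v) = h w"
    using lborel_pair.AE_commute[of "\<lambda>w v. h (w + v) = h w"] by blast
  then obtain w0 where w0: "AE v in lborel. h (w0 + v) = h w0"
    using AE_lborel_imp_ex by blast
  have "AE v in distr lborel borel (\<lambda>x. w0 + x). h v = h w0"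
    using w0 by (subst AE_distr_iff) auto
  then have "AE z in lborel. h z = h w0"
    by (simp only: lborel_distr_plus)
  then show ?thesis by blast
qed

context finite_mass
begin

text \<open>Far out \<open>u\<close> is at most \<open>g\<close>, whose convolution is at most the
  supremum of \<phi> times the mass, and the negative potential is at most logarithmic. On the
  remaining bounded set the convolution is continuous, hence bounded.\<close>

lemma convolution_log_upper_bound:
  assumes u: "loc_int u" and \<rho>: "\<And>w. cmod w \<ge> \<rho> \<Longrightarrow> u w \<le> g w"
    and \<phi>: "test_function \<phi>" "\<And>x. \<phi> x \<ge> 0"
  shows "\<exists>C D. \<forall>z. (\<integral>w. (u w - logpot w) * \<phi> (z - w) \<partial>lborel) \<le> C + D * ln (1 + cmod z)"
proof -
  define h where "h w = u w - logpot w" for w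
  have h: "loc_int h" unfolding h_def by (intro loc_int_diff u loc_int_logpot)
  have \<phi>c: "continuous_on UNIV \<phi>" using C_k_imp_continuous[OF test_functionD(1)[OF \<phi>(1)]] .
  have [measurable]: "\<phi> \<in> borel_measurable borel" using test_function_measurable[OF \<phi>(1)] .
  obtain B r where B: "B > 0" "r > 0" "\<And>x. \<bar>\<phi> x\<bar> \<le> B * indicat_real (cball 0 r) x"
    using continuous_bounded_support[OF \<phi>c test_functionD(2)[OF \<phi>(1)]] by blast
  define H where "H z = (\<integral>w. h w * \<phi> (z - w) \<partial>lborel)" for z
  have Hc: "continuous_on UNIV H"
    unfolding H_def using test_functionD[OF \<phi>(1)] C_k_convolution[OF h, of \<phi> 0] by simp
  have "bounded (H ` cball 0 (\<rho> + r))"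
    by (intro compact_imp_bounded compact_continuous_image continuous_on_subset[OF Hc]) auto
  then obtain C2 where C2: "C2 > 0" "\<And>z. cmod z \<le> \<rho> + r \<Longrightarrow> \<bar>H z\<bar> \<le> C2" by (auto simp: bounded_pos)
  define m where "m = mass / kap"
  have m: "m \<ge> 0" using mass_nonneg kap_pos by (simp add: m_def)
  define I where "I = (\<integral>w. \<phi> w \<partial>lborel)"
  have I: "I \<ge> 0" unfolding I_def using \<phi> by (intro Bochner_Integration.integral_nonneg) auto
  have \<phi>int: "integrable lborel (\<lambda>w. \<phi> (z - w))" for z
    using loc_int_mult_continuous[OF loc_int_continuous[of "\<lambda>_. 1"] \<phi>c test_functionD(2)[OF \<phi>(1)]]
      integral_reflect(2)[of \<phi> z] by simp
  have big: "H z \<le> B * mass + m * (ln (1 + r) + ln (1 + cmod z)) * I" if z: "cmod z \<ge> \<rho> + r" for z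
  proof -
    have "H z \<le> (\<integral>w. B * g w + (m * (ln (1 + r) + ln (1 + cmod z))) * \<phi> (z - w) \<partial>lborel)"
      unfolding H_def
    proof (rule integral_mono)
      show "integrable lborel (\<lambda>w. h w * \<phi> (z - w))"
        using loc_int_mult_continuous[OF h C_k_imp_continuous[OF test_functionD(1)] test_functionD(2)]
          test_function_reflect[OF \<phi>(1), of z] by blast
      show "integrable lborel (\<lambda>w. B * g w + (m * (ln (1 + r) + ln (1 + cmod z))) * \<phi> (z - w))"
        using g_int \<phi>int by simp
      fix w
      show "h w * \<phi> (z - w) \<le> B * g w + (m * (ln (1 + r) + ln (1 + cmod z))) * \<phi> (z - w)"
      proof (cases "\<phi> (z - w) = 0")
        case True
        then show ?thesis using B g_nonneg[of w] by simp
      next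
        case False
        then have zw: "cmod (z - w) \<le> r" using B(3)[of "z - w"] by (cases "cmod (z - w) \<le> r") auto
        have w1: "cmod w \<ge> \<rho>" using z zw norm_triangle_ineq2[of z w] by linarith
        have "cmod w \<le> cmod z + r" using zw norm_triangle_ineq2[of w z] by (simp add: norm_minus_commute)
        moreover have "0 \<le> r * cmod z" using B(2) by simp
        ultimately have w2: "1 + cmod w \<le> (1 + r) * (1 + cmod z)" by (simp add: distrib_left distrib_right)
        have "ln (1 + cmod w) \<le> ln ((1 + r) * (1 + cmod z))"
          using w2 one_plus_norm_pos[of w] by (intro ln_mono)
        also have "\<dots> = ln (1 + r) + ln (1 + cmod z)"
          using B(2) one_plus_norm_pos[of z] by (intro ln_mult_pos) linarith+
        finally have "m * ln (1 + cmod w) \<le> m * (ln (1 + r) + ln (1 + cmod z))" using m by (intro mult_left_mono)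
        then have "h w \<le> g w + m * (ln (1 + r) + ln (1 + cmod z))"
          using \<rho>[OF w1] logpot_lower[of w] by (simp add: h_def m_def)
        then have "h w * \<phi> (z - w) \<le> (g w + m * (ln (1 + r) + ln (1 + cmod z))) * \<phi> (z - w)"
          using \<phi>(2) by (intro mult_right_mono)
        moreover have "g w * \<phi> (z - w) \<le> g w * B"
          using B(3)[of "z - w"] zw g_nonneg[of w] by (intro mult_left_mono) auto
        ultimately show ?thesis by (simp add: algebra_simps)
      qed
    qed
    also have "\<dots> = B * mass + m * (ln (1 + r) + ln (1 + cmod z)) * I"
      using g_int \<phi>int integral_reflect(1)[of \<phi> z] by (simp add: mass_def I_def)
    finally show ?thesis .
  qed
  have "H z \<le> (C2 + B * mass + m * ln (1 + r) * I) + (m * I) * ln (1 + cmod z)" for z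
  proof (cases "cmod z \<ge> \<rho> + r")
    case True
    have "m * (ln (1 + r) + ln (1 + cmod z)) * I = m * ln (1 + r) * I + (m * I) * ln (1 + cmod z)"
      by (simp only: distrib_left distrib_right mult_ac)
    then show ?thesis using big[OF True] C2(1) by linarith
  next
    case False
    have "0 \<le> B * mass" "0 \<le> m * ln (1 + r) * I" "0 \<le> (m * I) * ln (1 + cmod z)"
      using B(1,2) mass_nonneg m I by simp_all
    then show ?thesis using C2(2)[of z] False by linarith
  qed
  note bound = this
  show ?thesis
  proof (rule exI[of _ "C2 + B * mass + m * ln (1 + r) * I"], rule exI[of _ "m * I"], rule allI)
    fix z
    show "(\<integral>w. (u w - logpot w) * \<phi> (z - w) \<partial>lborel) \<le> C2 + B * mass + m * ln (1 + r) * I + (m * I) * ln (1 + cmod z)"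
      using bound[of z] by (simp only: H_def h_def)
  qed
qed

lemma weak_solution_representation:
  assumes u: "loc_int u" and \<rho>: "\<And>w. cmod w \<ge> \<rho> \<Longrightarrow> u w \<le> g w"
    and weak: "\<And>\<phi>. test_function \<phi> \<Longrightarrow> - (\<integral>z. u z * laplacian \<phi> z \<partial>lborel) = (\<integral>z. g z * \<phi> z \<partial>lborel)"
  shows "\<exists>c. AE z in lborel. u z = c + logpot z"
proof -
  have "\<exists>c. AE z in lborel. u z - logpot z = c"
  proof (rule weakly_harmonic_const)
    show "loc_int (\<lambda>z. u z - logpot z)" by (intro loc_int_diff u loc_int_logpot)
    fix \<phi> :: "complex \<Rightarrow> real" assume \<phi>: "test_function \<phi>"
    note lc = laplacian_continuous[OF test_functionD(1)[OF \<phi>]] bounded_support_laplacian[OF test_functionD(2)[OF \<phi>]]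
    show "(\<integral>w. (u w - logpot w) * laplacian \<phi> w \<partial>lborel) = 0"
      using weak[OF \<phi>] logpot_weak[OF test_functionD[OF \<phi>]]
        loc_int_mult_continuous[OF u lc] loc_int_mult_continuous[OF loc_int_logpot lc]
      by (simp add: left_diff_distrib)
  qed (rule convolution_log_upper_bound[OF u \<rho>])
  then obtain c where "AE z in lborel. u z - logpot z = c" by blast
  then have "AE z in lborel. u z = c + logpot z" by eventually_elim simp
  then show ?thesis by blast
qed

end

section \<open>Boundedness and decay\<close>

lemma measure_cball_complex: "r \<ge> 0 \<Longrightarrow> measure lborel (cball (z::complex) r) = measure lborel (cball (0::complex) 1) * r\<^sup>2"
  by (simp add: content_cball)

lemma measure_unit_ball_pos: "measure lborel (cball (0::complex) 1) > 0"
  by (simp add: content_cball)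

lemma exp_ge_half_square: "(x::real) \<ge> 0 \<Longrightarrow> x\<^sup>2 / 2 \<le> exp x"
  using exp_lower_Taylor_quadratic[of x] by linarith

text \<open>A Young inequality pairing \<open>exp k\<close> with x^2. For k <= L the linear term
  suffices; above L the excess d = k - L is treated by completing a square with weights e^(L/2) and
  e^(-L/2), using d^2 / 2 <= e^d. The free parameter L damps the quadratic term by e^(-L) at the
  price of L x.\<close>

lemma young_exp:
  fixes k x L :: real
  assumes "x \<ge> 0" "k \<ge> 0"
  shows "k * x \<le> L * x + exp k + exp (- L) * x\<^sup>2 / 2"
proof (cases "k \<le> L")
  case True
  then have "k * x \<le> L * x" using assms by (intro mult_right_mono)
  moreover have "0 \<le> exp k" "0 \<le> exp (- L) * x\<^sup>2 / 2" by auto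
  ultimately show ?thesis by linarith
next
  case False
  define d where "d = k - L"
  have d: "d \<ge> 0" using False by (simp add: d_def)
  define p q where "p = exp (L / 2)" and "q = exp (- L / 2)"
  have pq: "p * q = 1" "p\<^sup>2 = exp L" "q\<^sup>2 = exp (- L)"
    by (simp_all add: p_def q_def exp_add[symmetric] power2_eq_square)
  have "0 \<le> (p * d - q * x)\<^sup>2" by simp
  also have "\<dots> = p\<^sup>2 * d\<^sup>2 + q\<^sup>2 * x\<^sup>2 - 2 * (p * q) * d * x" by (simp add: power2_eq_square algebra_simps)
  finally have "d * x \<le> exp L * (d\<^sup>2 / 2) + exp (- L) * x\<^sup>2 / 2" unfolding pq by simp
  also have "exp L * (d\<^sup>2 / 2) \<le> exp L * exp d" using exp_ge_half_square[OF d] by (intro mult_left_mono) auto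
  also have "exp L * exp d = exp k" by (simp add: exp_add[symmetric] d_def)
  finally show ?thesis by (simp add: d_def algebra_simps)
qed

text \<open>A positive substitute for ln |z| on the whole plane, so that powers of |z| become
  \<open>exp (m * lg z)\<close>. The shift absorbs the additive constants in the kernel
  bounds.\<close>

definition lg :: "complex \<Rightarrow> real" where "lg z = ln (3 + cmod z)"

lemma lg_nonneg: "lg z \<ge> 0"
  by (simp add: lg_def)

lemma exp_lg: "exp (lg z) = 3 + cmod z"
  using norm_ge_zero[of z] by (simp add: lg_def add_pos_nonneg del: norm_ge_zero)

definition near_log :: "real \<Rightarrow> complex \<Rightarrow> real" where
  "near_log \<delta> v = (if cmod v < \<delta> then ln (1 / cmod v) else 0)"

lemma near_log_measurable [measurable]: "near_log \<delta> \<in> borel_measurable borel"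
  unfolding near_log_def[abs_def] by measurable

lemma near_log_nonneg: "\<delta> \<le> 1 \<Longrightarrow> near_log \<delta> v \<ge> 0"
  by (cases "v = 0") (auto simp: near_log_def)

lemma exp_near_log: "v \<noteq> 0 \<Longrightarrow> exp (near_log \<delta> v) = (if cmod v < \<delta> then 1 / cmod v else 1)"
  by (simp add: near_log_def)

lemma near_log_le: "near_log \<delta> v \<le> 1 / cmod v"
proof (cases "v = 0 \<or> \<not> cmod v < \<delta>")
  case False
  then show ?thesis using ln_le_minus_one[of "1 / cmod v"] by (simp add: near_log_def)
qed (auto simp: near_log_def)

text \<open>Close to the diagonal 1 + |w| is at most 3 + |z| and the singularity is exactly
  \<open>near_log\<close>. At distance at least \<delta> the bound \<open>lker_upper\<close> loses
  only ln (1 / \<delta>).\<close>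

lemma lker_le_near_log:
  assumes \<delta>: "0 < \<delta>" "\<delta> \<le> 1"
  shows "lker z w \<le> lg z + ln (1 / \<delta>) + near_log \<delta> (z - w)"
proof (cases "cmod (z - w) < \<delta>")
  case True
  have "1 + cmod w \<le> 3 + cmod z" using True \<delta> norm_triangle_ineq2[of w z] by (simp add: norm_minus_commute)
  then have "ln (1 + cmod w) \<le> lg z" unfolding lg_def using one_plus_norm_pos[of w] by (intro ln_mono)
  moreover have "ln (1 / \<delta>) \<ge> 0" using \<delta> by simp
  moreover have "near_log \<delta> (z - w) = - ln (cmod (z - w))" using True by (simp add: near_log_def ln_div)
  ultimately show ?thesis by (simp add: lker_def)
next
  case False
  then have zw: "z \<noteq> w" using \<delta> by auto
  have "1 + (1 + cmod z) / cmod (z - w) \<le> 1 / \<delta> + (1 + cmod z) / \<delta>"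
    using False \<delta> zw by (intro add_mono divide_left_mono) auto
  also have "\<dots> \<le> (3 + cmod z) * (1 / \<delta>)" using \<delta> by (simp add: field_simps)
  finally have "ln (1 + (1 + cmod z) / cmod (z - w)) \<le> ln ((3 + cmod z) * (1 / \<delta>))"
    by (intro ln_mono) (auto simp: add_pos_nonneg)
  also have "\<dots> = lg z + ln (1 / \<delta>)" unfolding lg_def using \<delta> by (intro ln_mult_pos) (auto simp: add_pos_nonneg)
  finally show ?thesis using lker_upper[OF zw] False by (simp add: near_log_def)
qed

lemma quadratic_upper:
  obtains C where "C > 0" "\<And>z::complex. cmod (a * z\<^sup>2 + b * z + c) \<le> C * exp (2 * lg z)"
proof
  let ?C = "cmod a + cmod b + cmod c + 1"
  show "?C > 0" by (simp add: add_nonneg_pos)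
  fix z :: complex
  have e: "exp (2 * lg z) = (3 + cmod z)\<^sup>2" using exp_lg[of z] by (simp add: exp_double)
  have t: "cmod z ^ 2 \<le> (3 + cmod z)\<^sup>2" "cmod z \<le> (3 + cmod z)\<^sup>2" "1 \<le> (3 + cmod z)\<^sup>2"
    by (simp_all add: power2_eq_square algebra_simps)
  have "cmod (a * z\<^sup>2 + b * z + c) \<le> cmod (a * z\<^sup>2) + cmod (b * z) + cmod c"
    by (meson norm_triangle_ineq norm_triangle_le add_right_mono order_trans)
  also have "\<dots> = cmod a * cmod z ^ 2 + cmod b * cmod z + cmod c * 1" by (simp add: norm_mult norm_power)
  also have "\<dots> \<le> cmod a * (3 + cmod z)\<^sup>2 + cmod b * (3 + cmod z)\<^sup>2 + cmod c * (3 + cmod z)\<^sup>2"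
    using t by (intro add_mono mult_left_mono) auto
  also have "\<dots> \<le> ?C * (3 + cmod z)\<^sup>2" by (simp add: algebra_simps)
  finally show "cmod (a * z\<^sup>2 + b * z + c) \<le> ?C * exp (2 * lg z)" by (simp add: e)
qed

lemma quadratic_lower:
  assumes a: "a \<noteq> (0::complex)"
  obtains \<rho> where "\<rho> \<ge> 1" "\<And>z. cmod z \<ge> \<rho> \<Longrightarrow> cmod (a * z\<^sup>2 + b * z + c) \<ge> cmod a / 2 * (cmod z)\<^sup>2"
proof
  let ?r = "1 + 2 * (cmod b + cmod c) / cmod a"
  have "0 \<le> 2 * (cmod b + cmod c) / cmod a" by (intro divide_nonneg_nonneg) auto
  then show r: "?r \<ge> 1" by linarith
  fix z :: complex assume z: "cmod z \<ge> ?r"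
  then have z1: "cmod z \<ge> 1" using r by linarith
  have "(cmod b + cmod c) \<le> cmod a / 2 * cmod z"
    using z a norm_ge_zero[of a] by (simp add: field_simps del: norm_ge_zero)
  then have "(cmod b + cmod c) * cmod z \<le> cmod a / 2 * cmod z * cmod z"
    by (intro mult_right_mono) auto
  moreover have "cmod c \<le> cmod c * cmod z" using mult_left_mono[OF z1 norm_ge_zero[of c]] by simp
  moreover have "cmod (a * z\<^sup>2) \<le> cmod (a * z\<^sup>2 + b * z + c) + cmod (b * z) + cmod c"
    using norm_triangle_ineq4[of "a * z\<^sup>2 + b * z + c" "b * z + c"] norm_triangle_ineq[of "b * z" c] by simp
  ultimately show "cmod (a * z\<^sup>2 + b * z + c) \<ge> cmod a / 2 * (cmod z)\<^sup>2"
    by (simp add: norm_mult norm_power power2_eq_square algebra_simps)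
qed

context finite_mass
begin

text \<open>Absolute continuity, uniform in the centre. Cutting \<open>g\<close> off at a height n
  leaves a remainder of integral below e/2, and the part below n has mass at most n times the area
  of the disc.\<close>

lemma uniformly_small_mass:
  assumes e: "e > 0"
  obtains \<delta> where "0 < \<delta>" "\<delta> \<le> 1" "\<And>z. (\<integral>w. indicat_real (cball z \<delta>) w * g w \<partial>lborel) \<le> e"
proof -
  have int: "integrable lborel (\<lambda>w. g w - min (g w) (real n))" for n
  proof (rule Bochner_Integration.integrable_bound[OF g_int])
    show "AE w in lborel. norm (g w - min (g w) (real n)) \<le> norm (g w)"
      by (intro AE_I2) (auto simp: g_nonneg min_def)
  qed measurable
  have "(\<lambda>n. \<integral>w. g w - min (g w) (real n) \<partial>lborel) \<longlonglongrightarrow> (\<integral>w. 0 \<partial>(lborel::complex measure))"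
  proof (rule integral_dominated_convergence[where w=g])
    show "AE w in lborel. (\<lambda>n. g w - min (g w) (real n)) \<longlonglongrightarrow> 0"
    proof (intro AE_I2)
      fix w :: complex
      obtain N where N: "g w \<le> real N" using real_arch_simple by blast
      have "\<forall>\<^sub>F n in sequentially. 0 = g w - min (g w) (real n)"
        using eventually_ge_at_top[of N] by eventually_elim (use N in \<open>auto simp: min_def\<close>)
      then show "(\<lambda>n. g w - min (g w) (real n)) \<longlonglongrightarrow> 0" by (rule Lim_transform_eventually[OF tendsto_const])
    qed
    show "AE w in lborel. norm (g w - min (g w) (real n)) \<le> g w" for n
      by (intro AE_I2) (auto simp: g_nonneg min_def)
  qed (use g_int in auto)
  then have "\<forall>\<^sub>F n in sequentially. (\<integral>w. g w - min (g w) (real n) \<partial>lborel) < e / 2"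
    using e by (intro order_tendstoD(2)) auto
  then obtain n where n: "(\<integral>w. g w - min (g w) (real n) \<partial>lborel) < e / 2"
    by (meson eventually_sequentially order_refl)
  define v where "v = measure lborel (cball (0::complex) 1)"
  have v: "v > 0" unfolding v_def by (rule measure_unit_ball_pos)
  \<comment> \<open>As \<delta> <= 1, the area is at most \<open>v * \<delta>\<close>, and the
    quotient bounds the truncated mass by e/2.\<close>
  define \<delta> where "\<delta> = min 1 (e / (2 * (real n + 1) * v))"
  have \<delta>: "0 < \<delta>" "\<delta> \<le> 1" "\<delta> \<le> e / (2 * (real n + 1) * v)" using e v by (auto simp: \<delta>_def)
  show thesis
  proof (rule that[OF \<delta>(1,2)])
    fix z :: complex
    have ic: "integrable lborel (indicat_real (cball (z::complex) \<delta>))"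
      using emeasure_lborel_cball_finite[of z \<delta>] by (intro integrable_real_indicator) auto
    have "(\<integral>w. indicat_real (cball z \<delta>) w * g w \<partial>lborel) \<le> (\<integral>w. (g w - min (g w) (real n)) + real n * indicat_real (cball z \<delta>) w \<partial>lborel)"
    proof (rule integral_mono)
      show "integrable lborel (\<lambda>w. indicat_real (cball z \<delta>) w * g w)"
        using integrable_bound_mult[OF g_int, of "indicat_real (cball z \<delta>)" 1] by (simp add: mult.commute)
      show "integrable lborel (\<lambda>w. g w - min (g w) (real n) + real n * indicat_real (cball z \<delta>) w)"
        using int[of n] ic by simp
    qed (auto simp: indicator_def min_def g_nonneg)
    also have "\<dots> = (\<integral>w. g w - min (g w) (real n) \<partial>lborel) + real n * (v * \<delta>\<^sup>2)"
      using int[of n] ic \<delta>(1) measure_cball_complex[of \<delta> z] by (simp add: v_def)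
    also have "real n * (v * \<delta>\<^sup>2) \<le> (real n + 1) * (v * \<delta>)"
    proof (intro mult_mono)
      show "\<delta>\<^sup>2 \<le> \<delta>" using \<delta> by (simp add: power2_eq_square mult_left_le)
    qed (use v \<delta> in auto)
    also have "(real n + 1) * (v * \<delta>) \<le> e / 2"
    proof -
      have "\<delta> * (2 * (real n + 1) * v) \<le> e" using \<delta>(3) v by (subst pos_le_divide_eq[symmetric]) auto
      then show ?thesis by (simp add: algebra_simps)
    qed
    finally show "(\<integral>w. indicat_real (cball z \<delta>) w * g w \<partial>lborel) \<le> e" using n by simp
  qed
qed

definition "near_pot \<delta> z = (\<integral>w. near_log \<delta> (z - w) * g w \<partial>lborel)"

definition "near_riesz z = (\<integral>w. indicat_real (cball 0 1) (z - w) * (g w / cmod (z - w)) \<partial>lborel)"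

lemma near_log_integrable:
  assumes z: "good z" and \<delta>: "\<delta> \<le> 1" and [measurable]: "S \<in> sets borel"
  shows "integrable lborel (\<lambda>w. indicat_real S w * (near_log \<delta> (z - w) * g w))"
proof (rule Bochner_Integration.integrable_bound)
  show "integrable lborel (\<lambda>w. g w / cmod (z - w))" using z by (simp add: good_def)
  show "AE w in lborel. norm (indicat_real S w * (near_log \<delta> (z - w) * g w)) \<le> norm (g w / cmod (z - w))"
  proof (intro AE_I2)
    fix w
    have "near_log \<delta> (z - w) * g w \<le> 1 / cmod (z - w) * g w" using g_nonneg by (intro mult_right_mono near_log_le)
    then show "norm (indicat_real S w * (near_log \<delta> (z - w) * g w)) \<le> norm (g w / cmod (z - w))"
      using near_log_nonneg[OF \<delta>, of "z - w"] g_nonneg[of w] by (auto simp: indicator_def)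
  qed
qed measurable

lemma near_riesz_integrable:
  assumes z: "good z"
  shows "integrable lborel (\<lambda>w. indicat_real (cball 0 1) (z - w) * (g w / cmod (z - w)))"
proof (rule Bochner_Integration.integrable_bound)
  show "integrable lborel (\<lambda>w. g w / cmod (z - w))" using z by (simp add: good_def)
qed (auto simp: indicator_def)

text \<open>Jensen's inequality, proved by integrating the tangent line of \<open>exp\<close> at the mean.\<close>

lemma exp_near_pot:
  assumes z: "good z" and \<delta>: "0 < \<delta>" "\<delta> \<le> 1" and s: "s > 0"
    and small: "(\<integral>w. indicat_real (cball z \<delta>) w * g w \<partial>lborel) \<le> s"
  shows "exp (near_pot \<delta> z / s) \<le> 1 + near_riesz z / s"
proof -
  define t where "t = near_pot \<delta> z / s"
  define p where "p = (\<integral>w. indicat_real (cball z \<delta>) w * g w \<partial>lborel) / s"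
  have ip: "integrable lborel (\<lambda>w. indicat_real (cball z \<delta>) w * g w)"
    using integrable_bound_mult[OF g_int, of "indicat_real (cball z \<delta>)" 1] by (simp add: mult.commute)
  have il: "integrable lborel (\<lambda>w. near_log \<delta> (z - w) * g w)"
    using near_log_integrable[OF z \<delta>(2), of UNIV] by simp
  have p: "0 \<le> p" "p \<le> 1" using s small by (auto simp: p_def g_nonneg intro!: Bochner_Integration.integral_nonneg)
  have "(\<integral>w. exp t * ((1 - t) * (indicat_real (cball z \<delta>) w * g w) + near_log \<delta> (z - w) * g w) \<partial>lborel) \<le> near_riesz z"
    unfolding near_riesz_def
  proof (rule integral_mono_AE)
    show "integrable lborel (\<lambda>w. exp t * ((1 - t) * (indicat_real (cball z \<delta>) w * g w) + near_log \<delta> (z - w) * g w))"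
      using ip il by simp
    show "integrable lborel (\<lambda>w. indicat_real (cball 0 1) (z - w) * (g w / cmod (z - w)))" by (rule near_riesz_integrable[OF z])
    show "AE w in lborel. exp t * ((1 - t) * (indicat_real (cball z \<delta>) w * g w) + near_log \<delta> (z - w) * g w)
      \<le> indicat_real (cball 0 1) (z - w) * (g w / cmod (z - w))"
      using AE_lborel_singleton[of z]
    proof eventually_elim
      fix w assume wz: "w \<noteq> z"
      define k where "k = near_log \<delta> (z - w)"
      show "exp t * ((1 - t) * (indicat_real (cball z \<delta>) w * g w) + near_log \<delta> (z - w) * g w)
        \<le> indicat_real (cball 0 1) (z - w) * (g w / cmod (z - w))"
      proof (cases "w \<in> cball z \<delta>")
        case True
        have "1 + (k - t) \<le> exp (k - t)" by (rule exp_ge_add_one_self)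
        then have "exp t * (1 + (k - t)) \<le> exp t * exp (k - t)" by (intro mult_left_mono) auto
        then have "exp t * (1 - t + k) \<le> exp k" by (simp add: exp_add[symmetric] algebra_simps)
        also have "exp k \<le> 1 / cmod (z - w)"
          using wz True \<delta> unfolding k_def by (subst exp_near_log) (auto simp: dist_norm)
        finally have "exp t * (1 - t + k) * g w \<le> 1 / cmod (z - w) * g w" using g_nonneg by (intro mult_right_mono)
        moreover have "indicat_real (cball 0 1) (z - w) = 1" using True \<delta> by (simp add: dist_norm indicator_def norm_minus_commute)
        ultimately show ?thesis using True by (simp add: k_def algebra_simps)
      next
        case False
        then have "near_log \<delta> (z - w) = 0" by (simp add: near_log_def dist_norm)
        then show ?thesis using False g_nonneg[of w] by simp
      qed
    qed
  qed
  moreover have "(\<integral>w. exp t * ((1 - t) * (indicat_real (cball z \<delta>) w * g w) + near_log \<delta> (z - w) * g w) \<partial>lborel)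
     = exp t * ((1 - t) * (s * p) + s * t)"
    using ip il s by (simp add: p_def t_def near_pot_def)
  ultimately have 1: "exp t * ((1 - t) * p + t) \<le> near_riesz z / s" using s by (simp add: field_simps)
  \<comment> \<open>The disc carries mass p <= 1 after division by \<open>s\<close>, not exactly 1
    as in Jensen's inequality for probability measures. The deficit 1 - p is covered by e^t (1 - t)
    <= 1, which costs the summand 1 in the conclusion.\<close>
  have "exp t * (1 - t) \<le> exp t * exp (- t)" using exp_ge_add_one_self[of "- t"] by (intro mult_left_mono) auto
  then have "exp t * (1 - t) \<le> 1" by (simp add: exp_add[symmetric])
  then have "(1 - p) * (exp t * (1 - t)) \<le> (1 - p) * 1" using p by (intro mult_left_mono) auto
  then have "exp t \<le> 1 - p + exp t * ((1 - t) * p + t)" by (simp add: algebra_simps)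
  then show ?thesis using 1 p by (simp add: t_def)
qed

lemma near_riesz_nonneg: "near_riesz z \<ge> 0"
  unfolding near_riesz_def using g_nonneg by (intro Bochner_Integration.integral_nonneg) auto

text \<open>By Fubini each unit of mass contributes at most \<open>csing\<close>. Together with
  \<open>exp_near_pot\<close> this makes the exponential of the near potential locally
  integrable.\<close>

lemma nn_integral_near_riesz:
  "(\<integral>\<^sup>+z. indicator A z * ennreal (near_riesz z) \<partial>lborel) \<le> ennreal (mass * csing)"
proof -
  let ?f = "\<lambda>z w. ennreal (indicat_real (cball 0 1) (z - w) * (g w / cmod (z - w)))"
  have [measurable]: "(\<lambda>(z, w). ?f z w) \<in> borel_measurable (lborel \<Otimes>\<^sub>M lborel)"
    by measurable
  have "(\<integral>\<^sup>+z. indicator A z * ennreal (near_riesz z) \<partial>lborel) \<le> (\<integral>\<^sup>+z. (\<integral>\<^sup>+w. ?f z w \<partial>lborel) \<partial>lborel)"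
  proof (rule nn_integral_mono_AE)
    show "AE z in lborel. indicator A z * ennreal (near_riesz z) \<le> (\<integral>\<^sup>+w. ?f z w \<partial>lborel)"
      using AE_good
    proof eventually_elim
      fix z assume "good z"
      then have "(\<integral>\<^sup>+w. ?f z w \<partial>lborel) = ennreal (near_riesz z)"
        unfolding near_riesz_def using near_riesz_integrable g_nonneg by (intro nn_integral_eq_integral) auto
      then show "indicator A z * ennreal (near_riesz z) \<le> (\<integral>\<^sup>+w. ?f z w \<partial>lborel)"
        by (auto simp: indicator_def)
    qed
  qed
  also have "\<dots> = (\<integral>\<^sup>+w. (\<integral>\<^sup>+z. ?f z w \<partial>lborel) \<partial>lborel)"
    using lborel_pair.Fubini'[of ?f] by simp
  also have "\<dots> = (\<integral>\<^sup>+w. ennreal (g w) * ennreal csing \<partial>lborel)"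
  proof (intro nn_integral_cong)
    fix w
    have "(\<integral>\<^sup>+z. ?f z w \<partial>lborel) = (\<integral>\<^sup>+z. ennreal (g w) * ennreal (indicat_real (cball 0 1) (z - w) / cmod (z - w)) \<partial>lborel)"
      by (intro nn_integral_cong) (simp add: ennreal_mult[symmetric] g_nonneg mult.commute)
    also have "\<dots> = ennreal (g w) * ennreal csing" by (subst nn_integral_cmult) (measurable, simp add: nn_integral_csing)
    finally show "(\<integral>\<^sup>+z. ?f z w \<partial>lborel) = ennreal (g w) * ennreal csing" .
  qed
  also have "\<dots> = ennreal (mass * csing)"
    using g_int g_nonneg csing_nonneg mass_nonneg
    by (subst nn_integral_multc) (auto simp: nn_integral_eq_integral mass_def ennreal_mult)
  finally show ?thesis .
qed

text \<open>\<open>near_pot\<close> isolates the only part of the potential that the total mass and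
  \<open>lg z\<close> do not bound.\<close>

lemma logpot_upper_near_pot:
  assumes z: "good z" and \<delta>: "0 < \<delta>" "\<delta> \<le> 1"
  shows "kap * logpot z \<le> mass * (lg z + ln (1 / \<delta>)) + near_pot \<delta> z"
proof -
  have il: "integrable lborel (\<lambda>w. near_log \<delta> (z - w) * g w)"
    using near_log_integrable[OF z \<delta>(2), of UNIV] by simp
  have "kap * logpot z = (\<integral>w. lker z w * g w \<partial>lborel)" using kap_pos by (simp add: logpot_def)
  also have "\<dots> \<le> (\<integral>w. (lg z + ln (1 / \<delta>)) * g w + near_log \<delta> (z - w) * g w \<partial>lborel)"
  proof (rule integral_mono)
    show "integrable lborel (\<lambda>w. lker z w * g w)" by (rule good_lker_integrable[OF z])
    show "integrable lborel (\<lambda>w. (lg z + ln (1 / \<delta>)) * g w + near_log \<delta> (z - w) * g w)"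
      using g_int il by simp
    show "lker z w * g w \<le> (lg z + ln (1 / \<delta>)) * g w + near_log \<delta> (z - w) * g w" for w
      using mult_right_mono[OF lker_le_near_log[OF \<delta>, of z w] g_nonneg[of w]] by (simp add: algebra_simps)
  qed
  also have "\<dots> = mass * (lg z + ln (1 / \<delta>)) + near_pot \<delta> z"
    using g_int il by (simp add: mass_def near_pot_def)
  finally show ?thesis .
qed

end

lemma integral_csing:
  "integrable lborel (\<lambda>w. indicat_real (cball 0 1) (z - w) / cmod (z - w))"
  "(\<integral>w. indicat_real (cball 0 1) (z - w) / cmod (z - w) \<partial>lborel) = csing"
  using integral_reflect[OF inverse_norm_measurable[of 1], of z] integrable_inverse_norm[of 1]
  by (simp_all add: csing_def)

lemma lg_ball: "dist z1 z \<le> 1 \<Longrightarrow> lg z \<le> lg z1 + ln 2"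
proof -
  assume d: "dist z1 z \<le> 1"
  have "cmod (z - z1) \<le> 1" using d by (simp add: dist_norm norm_minus_commute)
  then have "3 + cmod z \<le> (3 + cmod z1) * 2"
    using norm_triangle_ineq2[of z z1] norm_ge_zero[of z1] unfolding distrib_right by linarith
  then have "ln (3 + cmod z) \<le> ln ((3 + cmod z1) * 2)" by (intro ln_mono) (auto simp: add_pos_nonneg)
  also have "\<dots> = lg z1 + ln 2" unfolding lg_def by (intro ln_mult_pos) (auto simp: add_pos_nonneg)
  finally show ?thesis by (simp add: lg_def)
qed

text \<open>The equation is stated as a relation between \<open>g\<close> and its own potential,
  valid at every point and not just almost everywhere. A weak solution is brought into this form by
  changing \<open>g\<close> on a null set; \<open>c0\<close> is the constant left by the Liouville
  argument.\<close>

locale liouville = finite_mass +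
  fixes a b c :: complex and c0 :: real
  assumes a_nz: "a \<noteq> 0"
    and g_eq: "\<And>z. g z = (cmod (a * z\<^sup>2 + b * z + c))\<^sup>2 * exp (c0 + logpot z)"
begin

text \<open>The Brezis-Merle step. At a radius \<delta> where every disc has mass at most
  \<open>s\<close>, the exponential of 2 \<open>logpot\<close> is controlled by that of
  \<open>near_pot / s\<close>, hence by 1 + \<open>near_riesz\<close> / s, which is locally
  integrable. So g^2 is integrable on unit discs, with at most polynomial growth in the
  centre.\<close>

lemma square_bound:
  obtains A C where "A \<ge> 0" "C \<ge> 0"
    "\<And>z. integrable lborel (\<lambda>w. indicat_real (cball z 1) w * (g w)\<^sup>2)"
    "\<And>z. (\<integral>w. indicat_real (cball z 1) w * (g w)\<^sup>2 \<partial>lborel) \<le> C * exp (A * lg z)"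
proof -
  \<comment> \<open>With this \<open>s\<close> the exponent 2 \<open>logpot\<close> that belongs to
    g^2 equals \<open>kap * logpot / s\<close>.\<close>
  define s where "s = kap / 2"
  have s: "s > 0" using kap_pos by (simp add: s_def)
  obtain \<delta> where \<delta>: "0 < \<delta>" "\<delta> \<le> 1" and small: "\<And>z. (\<integral>w. indicat_real (cball z \<delta>) w * g w \<partial>lborel) \<le> s"
    using uniformly_small_mass[OF s] by blast
  obtain CR where CR: "CR > 0" "\<And>z. cmod (a * z\<^sup>2 + b * z + c) \<le> CR * exp (2 * lg z)"
    using quadratic_upper by blast
  \<comment> \<open>The 8 comes from |R|^4 and the quotient from the term \<open>mass * lg z\<close>
    in the bound for the potential.\<close>
  define A where "A = 8 + mass / s"
  have A: "A \<ge> 0" using mass_nonneg s by (simp add: A_def add_nonneg_nonneg)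
  define C1 where "C1 = CR ^ 4 * exp (2 * c0 + mass * ln (1 / \<delta>) / s)"
  have C1: "C1 \<ge> 0" using CR by (simp add: C1_def)
  have g2: "(g z)\<^sup>2 \<le> C1 * exp (A * lg z) * (1 + near_riesz z / s)" if z: "good z" for z
  proof -
    have "(cmod (a * z\<^sup>2 + b * z + c)) ^ 4 \<le> (CR * exp (2 * lg z)) ^ 4" by (intro power_mono CR) auto
    also have "\<dots> = CR ^ 4 * exp (8 * lg z)" by (simp add: power_mult_distrib exp_of_nat_mult[symmetric])
    finally have 1: "(cmod (a * z\<^sup>2 + b * z + c)) ^ 4 \<le> CR ^ 4 * exp (8 * lg z)" .
    have "2 * logpot z = kap * logpot z / s" using kap_pos by (simp add: s_def)
    also have "\<dots> \<le> (mass * (lg z + ln (1 / \<delta>)) + near_pot \<delta> z) / s"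
      using logpot_upper_near_pot[OF z \<delta>] s by (intro divide_right_mono) auto
    also have "\<dots> = mass / s * lg z + mass * ln (1 / \<delta>) / s + near_pot \<delta> z / s"
      by (simp add: add_divide_distrib distrib_left)
    finally have "exp (2 * (c0 + logpot z)) \<le> exp (2 * c0 + mass * ln (1 / \<delta>) / s + mass / s * lg z + near_pot \<delta> z / s)"
      by simp
    also have "\<dots> = exp (2 * c0 + mass * ln (1 / \<delta>) / s) * exp (mass / s * lg z) * exp (near_pot \<delta> z / s)"
      by (simp add: exp_add)
    also have "\<dots> \<le> exp (2 * c0 + mass * ln (1 / \<delta>) / s) * exp (mass / s * lg z) * (1 + near_riesz z / s)"
      by (intro mult_left_mono exp_near_pot z \<delta> s small) auto
    finally have 2: "exp (2 * (c0 + logpot z)) \<le> exp (2 * c0 + mass * ln (1 / \<delta>) / s) * exp (mass / s * lg z) * (1 + near_riesz z / s)" .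
    have "(g z)\<^sup>2 = (cmod (a * z\<^sup>2 + b * z + c)) ^ 4 * exp (2 * (c0 + logpot z))"
      unfolding g_eq[of z] by (simp only: power_mult_distrib exp_double power_mult[symmetric]) simp
    also have "\<dots> \<le> (CR ^ 4 * exp (8 * lg z)) * (exp (2 * c0 + mass * ln (1 / \<delta>) / s) * exp (mass / s * lg z) * (1 + near_riesz z / s))"
      by (intro mult_mono 1 2) (use CR in auto)
    also have "\<dots> = C1 * exp (A * lg z) * (1 + near_riesz z / s)"
    proof -
      have "exp (A * lg z) = exp (8 * lg z) * exp (mass / s * lg z)" by (simp add: A_def distrib_right exp_add)
      then show ?thesis by (simp only: C1_def mult_ac)
    qed
    finally show ?thesis .
  qed
  define v where "v = measure lborel (cball (0::complex) 1)"
  define C where "C = C1 * exp (A * ln 2) * (v + mass * csing / s)"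
  have C: "C \<ge> 0" using C1 s mass_nonneg csing_nonneg by (simp add: C_def v_def)
  have nn: "(\<integral>\<^sup>+w. ennreal (indicat_real (cball z 1) w * (g w)\<^sup>2) \<partial>lborel) \<le> ennreal (C * exp (A * lg z))" for z
  proof -
    define D where "D = C1 * exp (A * ln 2) * exp (A * lg z)"
    have D: "D \<ge> 0" using C1 by (simp add: D_def)
    have "(\<integral>\<^sup>+w. ennreal (indicat_real (cball z 1) w * (g w)\<^sup>2) \<partial>lborel)
      \<le> (\<integral>\<^sup>+w. ennreal D * (indicator (cball z 1) w + ennreal (1 / s) * (indicator (cball z 1) w * ennreal (near_riesz w))) \<partial>lborel)"
    proof (rule nn_integral_mono_AE)
      show "AE w in lborel. ennreal (indicat_real (cball z 1) w * (g w)\<^sup>2)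
         \<le> ennreal D * (indicator (cball z 1) w + ennreal (1 / s) * (indicator (cball z 1) w * ennreal (near_riesz w)))"
        using AE_good
      proof eventually_elim
        fix w assume w: "good w"
        show "ennreal (indicat_real (cball z 1) w * (g w)\<^sup>2)
         \<le> ennreal D * (indicator (cball z 1) w + ennreal (1 / s) * (indicator (cball z 1) w * ennreal (near_riesz w)))"
        proof (cases "w \<in> cball z 1")
          case True
          have "A * lg w \<le> A * (lg z + ln 2)" using True A by (intro mult_left_mono lg_ball) auto
          then have "exp (A * lg w) \<le> exp (A * ln 2) * exp (A * lg z)" by (simp add: exp_add[symmetric] algebra_simps)
          then have "C1 * exp (A * lg w) \<le> D" using C1 unfolding D_def mult.assoc by (intro mult_left_mono)
          then have "C1 * exp (A * lg w) * (1 + near_riesz w / s) \<le> D * (1 + near_riesz w / s)"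
            using near_riesz_nonneg[of w] s by (intro mult_right_mono) auto
          with g2[OF w] have "(g w)\<^sup>2 \<le> D * (1 + near_riesz w / s)" by simp
          then have "ennreal ((g w)\<^sup>2) \<le> ennreal (D * (1 + 1 / s * near_riesz w))" by (intro ennreal_leI) simp
          also have "\<dots> = ennreal D * (1 + ennreal (1 / s) * ennreal (near_riesz w))"
            using D s near_riesz_nonneg[of w] by (simp only: ennreal_mult' ennreal_mult ennreal_plus zero_le_one ennreal_1 mult_nonneg_nonneg zero_le_divide_1_iff less_imp_le)
          finally show ?thesis using True by simp
        qed simp
      qed
    qed
    also have "\<dots> = ennreal D * (emeasure lborel (cball z 1) + ennreal (1 / s) * (\<integral>\<^sup>+w. indicator (cball z 1) w * ennreal (near_riesz w) \<partial>lborel))"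
    proof -
      have [measurable]: "near_riesz \<in> borel_measurable borel" unfolding near_riesz_def[abs_def] by measurable
      show ?thesis
        by (subst nn_integral_cmult, simp, subst nn_integral_add, simp, simp, subst nn_integral_cmult) auto
    qed
    also have "\<dots> \<le> ennreal D * (ennreal v + ennreal (1 / s) * ennreal (mass * csing))"
    proof (intro mult_left_mono add_mono nn_integral_near_riesz)
      show "emeasure lborel (cball z 1) \<le> ennreal v"
        using emeasure_lborel_cball_finite[of z 1] measure_cball_complex[of 1 z]
        by (subst emeasure_eq_ennreal_measure) (auto simp: v_def)
    qed auto
    also have "\<dots> = ennreal (D * (v + 1 / s * (mass * csing)))"
      using D s mass_nonneg csing_nonneg by (subst ennreal_mult) (auto simp: v_def ennreal_mult[symmetric] ennreal_plus[symmetric] simp del: ennreal_plus)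
    also have "D * (v + 1 / s * (mass * csing)) = C * exp (A * lg z)" by (simp add: C_def D_def)
    finally show ?thesis .
  qed
  show thesis
  proof (rule that[OF A C])
    fix z
    show i: "integrable lborel (\<lambda>w. indicat_real (cball z 1) w * (g w)\<^sup>2)"
    proof (rule integrableI_nonneg)
      show "(\<integral>\<^sup>+w. ennreal (indicat_real (cball z 1) w * (g w)\<^sup>2) \<partial>lborel) < \<infinity>"
        using nn[of z] by (rule le_less_trans) simp
      show "(\<lambda>w. indicat_real (cball z 1) w * (g w)\<^sup>2) \<in> borel_measurable lborel"
        by (intro borel_measurable_times borel_measurable_power) simp_all
    qed simp
    have "ennreal (\<integral>w. indicat_real (cball z 1) w * (g w)\<^sup>2 \<partial>lborel) \<le> ennreal (C * exp (A * lg z))"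
      using nn[of z] nn_integral_eq_integral[OF i] by simp
    then show "(\<integral>w. indicat_real (cball z 1) w * (g w)\<^sup>2 \<partial>lborel) \<le> C * exp (A * lg z)"
      using C by (subst (asm) ennreal_le_iff) auto
  qed
qed

text \<open>Young's inequality with L = A lg z bounds \<open>near_log\<close> times \<open>g\<close>
  by L g + 1 / |z - w| + e^(-L) g^2 / 2. The damping e^(-L) cancels the growth in
  \<open>square_bound\<close>. What is left grows like \<open>lg z\<close> times the mass in
  \<open>S\<close>, a small factor when \<open>S\<close> lies far out.\<close>

lemma near_pot_bound:
  assumes \<delta>: "0 < \<delta>" "\<delta> \<le> 1"
  obtains A C where "A \<ge> 0" "C \<ge> 0"
    "\<And>z S. good z \<Longrightarrow> S \<in> sets borel \<Longrightarrow>
       (\<integral>w. indicat_real S w * (near_log \<delta> (z - w) * g w) \<partial>lborel)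
         \<le> A * lg z * (\<integral>w. indicat_real S w * g w \<partial>lborel) + C"
proof -
  obtain A C where A: "A \<ge> 0" and C: "C \<ge> 0"
    and i2: "\<And>z. integrable lborel (\<lambda>w. indicat_real (cball z 1) w * (g w)\<^sup>2)"
    and b2: "\<And>z. (\<integral>w. indicat_real (cball z 1) w * (g w)\<^sup>2 \<partial>lborel) \<le> C * exp (A * lg z)"
    using square_bound by blast
  show thesis
  proof (rule that[of A "csing + C / 2", OF A])
    show "csing + C / 2 \<ge> 0" using csing_nonneg C by simp
    fix z :: complex and S :: "complex set" assume z: "good z" and S [measurable]: "S \<in> sets borel"
    define L where "L = A * lg z"
    have iS: "integrable lborel (\<lambda>w. indicat_real S w * g w)"
      using integrable_bound_mult[OF g_int, of "indicat_real S" 1] by (simp add: mult.commute)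
    have "(\<integral>w. indicat_real S w * (near_log \<delta> (z - w) * g w) \<partial>lborel)
      \<le> (\<integral>w. L * (indicat_real S w * g w) + indicat_real (cball 0 1) (z - w) / cmod (z - w)
             + exp (- L) / 2 * (indicat_real (cball z 1) w * (g w)\<^sup>2) \<partial>lborel)"
    proof (rule integral_mono_AE)
      show "integrable lborel (\<lambda>w. indicat_real S w * (near_log \<delta> (z - w) * g w))"
        by (rule near_log_integrable[OF z \<delta>(2) S])
      show "integrable lborel (\<lambda>w. L * (indicat_real S w * g w) + indicat_real (cball 0 1) (z - w) / cmod (z - w)
             + exp (- L) / 2 * (indicat_real (cball z 1) w * (g w)\<^sup>2))"
        using iS i2[of z] integral_csing(1)[of z] by (intro Bochner_Integration.integrable_add integrable_mult_right)
      show "AE w in lborel. indicat_real S w * (near_log \<delta> (z - w) * g w)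
        \<le> L * (indicat_real S w * g w) + indicat_real (cball 0 1) (z - w) / cmod (z - w)
             + exp (- L) / 2 * (indicat_real (cball z 1) w * (g w)\<^sup>2)"
        using AE_lborel_singleton[of z]
      proof eventually_elim
        fix w assume wz: "w \<noteq> z"
        have L: "L \<ge> 0" using A lg_nonneg by (simp add: L_def)
        have nn: "0 \<le> L * (indicat_real S w * g w)" "0 \<le> indicat_real (cball 0 1) (z - w) / cmod (z - w)"
          "0 \<le> exp (- L) / 2 * (indicat_real (cball z 1) w * (g w)\<^sup>2)"
          using L g_nonneg[of w] by auto
        show "indicat_real S w * (near_log \<delta> (z - w) * g w)
          \<le> L * (indicat_real S w * g w) + indicat_real (cball 0 1) (z - w) / cmod (z - w)
             + exp (- L) / 2 * (indicat_real (cball z 1) w * (g w)\<^sup>2)"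
        proof (cases "w \<in> S \<and> cmod (z - w) < \<delta>")
          case True
          then have w1: "indicat_real (cball z 1) w = 1" "indicat_real (cball 0 1) (z - w) = 1"
            using \<delta> by (auto simp: indicator_def dist_norm norm_minus_commute)
          have "exp (near_log \<delta> (z - w)) = 1 / cmod (z - w)" using True wz by (subst exp_near_log) auto
          then show ?thesis
            using young_exp[OF g_nonneg near_log_nonneg[OF \<delta>(2)], of "z - w" w L] True w1 by simp
        next
          case False
          then have "indicat_real S w * (near_log \<delta> (z - w) * g w) = 0"
            by (auto simp: near_log_def)
          then show ?thesis using nn by linarith
        qed
      qed
    qed
    also have "\<dots> = L * (\<integral>w. indicat_real S w * g w \<partial>lborel) + csing + exp (- L) / 2 * (\<integral>w. indicat_real (cball z 1) w * (g w)\<^sup>2 \<partial>lborel)"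
      using iS i2[of z] integral_csing[of z] by simp
    also have "exp (- L) / 2 * (\<integral>w. indicat_real (cball z 1) w * (g w)\<^sup>2 \<partial>lborel) \<le> exp (- L) / 2 * (C * exp L)"
      using b2[of z] by (intro mult_left_mono) (auto simp: L_def)
    also have "exp (- L) / 2 * (C * exp L) = C / 2" by (simp add: exp_minus)
    finally show "(\<integral>w. indicat_real S w * (near_log \<delta> (z - w) * g w) \<partial>lborel)
         \<le> A * lg z * (\<integral>w. indicat_real S w * g w \<partial>lborel) + (csing + C / 2)" by (simp add: L_def)
  qed
qed

lemma small_tail:
  assumes e: "e > 0"
  obtains \<rho> where "\<rho> \<ge> 1" "(\<integral>w. indicat_real (- cball 0 \<rho>) w * g w \<partial>lborel) \<le> e"
proof -
  have "(\<lambda>n. \<integral>w. indicat_real (- cball 0 (real n)) w * g w \<partial>lborel) \<longlonglongrightarrow> (\<integral>w. 0 \<partial>(lborel::complex measure))"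
  proof (rule integral_dominated_convergence[where w=g])
    show "AE w in lborel. (\<lambda>n. indicat_real (- cball 0 (real n)) w * g w) \<longlonglongrightarrow> 0"
    proof (intro AE_I2)
      fix w :: complex
      obtain N where N: "cmod w \<le> real N" using real_arch_simple by blast
      have "\<forall>\<^sub>F n in sequentially. 0 = indicat_real (- cball 0 (real n)) w * g w"
        using eventually_ge_at_top[of N] by eventually_elim (use N in \<open>auto simp: indicator_def\<close>)
      then show "(\<lambda>n. indicat_real (- cball 0 (real n)) w * g w) \<longlonglongrightarrow> 0" by (rule Lim_transform_eventually[OF tendsto_const])
    qed
    show "AE w in lborel. norm (indicat_real (- cball 0 (real n)) w * g w) \<le> g w" for n
      by (intro AE_I2) (auto simp: g_nonneg indicator_def)
    show "(\<lambda>w. indicat_real (- cball 0 (real n)) w * g w) \<in> borel_measurable lborel" for n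
      by (intro borel_measurable_times borel_measurable_indicator) auto
  qed (use g_int in auto)
  then have "\<forall>\<^sub>F n in sequentially. (\<integral>w. indicat_real (- cball 0 (real n)) w * g w \<partial>lborel) < e"
    using e by (intro order_tendstoD(2)) auto
  then obtain N where N: "\<And>n. n \<ge> N \<Longrightarrow> (\<integral>w. indicat_real (- cball 0 (real n)) w * g w \<partial>lborel) < e"
    by (meson eventually_sequentially)
  show thesis using that[of "real (max N 1)"] N[of "max N 1"] by auto
qed

text \<open>Only a mass \<open>e1\<close> lies outside a large disc. For z at twice the radius or
  more, the mass inside sees a kernel of size -lg z up to a constant and produces the main term. The
  outer mass costs a multiple of \<open>e1 * lg z\<close>, which the choice of \<open>e1\<close>
  limits to \<open>e * kap * lg z\<close>. Points nearer to the origin are covered by the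
  constant.\<close>

lemma logpot_decay_good:
  assumes e: "e > 0"
  obtains C where "\<And>z. good z \<Longrightarrow> logpot z \<le> C - (mass / kap - e) * lg z"
proof -
  define \<delta> :: real where "\<delta> = 1"
  have \<delta>: "0 < \<delta>" "\<delta> \<le> 1" by (simp_all add: \<delta>_def)
  obtain A C3 where A: "A \<ge> 0" and C3: "C3 \<ge> 0"
    and np: "\<And>z S. good z \<Longrightarrow> S \<in> sets borel \<Longrightarrow>
       (\<integral>w. indicat_real S w * (near_log \<delta> (z - w) * g w) \<partial>lborel)
         \<le> A * lg z * (\<integral>w. indicat_real S w * g w \<partial>lborel) + C3"
    using near_pot_bound[OF \<delta>] by blast
  \<comment> \<open>The outer mass is missing from the main term, it contributes \<open>lg z\<close>
    through the far part of the kernel, and \<open>A * lg z\<close> through the near part: in total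
    2 + A.\<close>
  define e1 where "e1 = e * kap / (2 + A)"
  have e1: "e1 > 0" using e kap_pos A by (simp add: e1_def)
  obtain \<rho> where \<rho>: "\<rho> \<ge> 1" "(\<integral>w. indicat_real (- cball 0 \<rho>) w * g w \<partial>lborel) \<le> e1"
    using small_tail[OF e1] by blast
  define ld where "ld = ln (1 / \<delta>)"
  have ld: "ld \<ge> 0" using \<delta> by (simp add: ld_def)
  define far where "far = (\<integral>w. indicat_real (- cball 0 \<rho>) w * g w \<partial>lborel)"
  have far: "0 \<le> far" "far \<le> e1" using \<rho>(2) by (auto simp: far_def g_nonneg intro!: Bochner_Integration.integral_nonneg)
  define q where "q = ln (1 + \<rho>) + ln 8"
  have q: "q \<ge> 0" using \<rho> by (simp add: q_def)
  have [measurable]: "- cball (0::complex) \<rho> \<in> sets borel" by auto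
  have iF: "integrable lborel (\<lambda>w. indicat_real (- cball 0 \<rho>) w * g w)"
    using integrable_bound_mult[OF g_int, of "indicat_real (- cball 0 \<rho>)" 1] by (simp add: mult.commute)
  have iN: "integrable lborel (\<lambda>w. indicat_real (cball 0 \<rho>) w * g w)"
    using integrable_bound_mult[OF g_int, of "indicat_real (cball 0 \<rho>)" 1] by (simp add: mult.commute)
  have split: "(\<integral>w. indicat_real (cball 0 \<rho>) w * g w \<partial>lborel) = mass - far"
  proof -
    have "mass = (\<integral>w. indicat_real (cball 0 \<rho>) w * g w + indicat_real (- cball 0 \<rho>) w * g w \<partial>lborel)"
      unfolding mass_def by (intro Bochner_Integration.integral_cong) (auto simp: indicator_def)
    then show ?thesis using iF iN by (simp add: far_def)
  qed
  have outer: "kap * logpot z \<le> mass * q + e1 * ld + C3 - (mass - (2 + A) * e1) * lg z" if z: "good z" and zr: "cmod z \<ge> 2 * \<rho>" for z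
  proof -
    have iL: "integrable lborel (\<lambda>w. indicat_real (- cball 0 \<rho>) w * (near_log \<delta> (z - w) * g w))"
      by (rule near_log_integrable[OF z \<delta>(2)]) measurable
    have "kap * logpot z = (\<integral>w. lker z w * g w \<partial>lborel)" using kap_pos by (simp add: logpot_def)
    also have "\<dots> \<le> (\<integral>w. (q - lg z) * (indicat_real (cball 0 \<rho>) w * g w)
        + ((lg z + ld) * (indicat_real (- cball 0 \<rho>) w * g w) + indicat_real (- cball 0 \<rho>) w * (near_log \<delta> (z - w) * g w)) \<partial>lborel)"
    proof (rule integral_mono)
      show "integrable lborel (\<lambda>w. lker z w * g w)" by (rule good_lker_integrable[OF z])
      show "integrable lborel (\<lambda>w. (q - lg z) * (indicat_real (cball 0 \<rho>) w * g w)
        + ((lg z + ld) * (indicat_real (- cball 0 \<rho>) w * g w) + indicat_real (- cball 0 \<rho>) w * (near_log \<delta> (z - w) * g w)))"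
        using iF iN iL by (intro Bochner_Integration.integrable_add integrable_mult_right)
      fix w
      show "lker z w * g w \<le> (q - lg z) * (indicat_real (cball 0 \<rho>) w * g w)
        + ((lg z + ld) * (indicat_real (- cball 0 \<rho>) w * g w) + indicat_real (- cball 0 \<rho>) w * (near_log \<delta> (z - w) * g w))"
      proof (cases "cmod w \<le> \<rho>")
        case True
        have d: "cmod (z - w) \<ge> cmod z / 2" using True zr norm_triangle_ineq2[of z w] by linarith
        have z2: "cmod z \<ge> 2" using zr \<rho> by linarith
        have "ln (3 + cmod z) \<le> ln (8 * cmod (z - w))" using d z2 by (intro ln_mono) auto
        also have "\<dots> = ln 8 + ln (cmod (z - w))" using d z2 by (intro ln_mult_pos) auto
        finally have "lg z \<le> ln 8 + ln (cmod (z - w))" by (simp add: lg_def)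
        moreover have "ln (1 + cmod w) \<le> ln (1 + \<rho>)" using True one_plus_norm_pos[of w] by (intro ln_mono) auto
        ultimately have "lker z w \<le> q - lg z" by (simp add: lker_def q_def)
        then have "lker z w * g w \<le> (q - lg z) * g w" using g_nonneg by (intro mult_right_mono)
        then show ?thesis using True by simp
      next
        case False
        have "lker z w * g w \<le> (lg z + ld + near_log \<delta> (z - w)) * g w"
          unfolding ld_def using g_nonneg by (intro mult_right_mono lker_le_near_log \<delta>)
        then show ?thesis using False by (simp add: algebra_simps)
      qed
    qed
    also have "\<dots> = (q - lg z) * (mass - far) + ((lg z + ld) * far + (\<integral>w. indicat_real (- cball 0 \<rho>) w * (near_log \<delta> (z - w) * g w) \<partial>lborel))"
      using iF iN iL split by (simp add: far_def)
    also have "\<dots> \<le> (q - lg z) * (mass - far) + ((lg z + ld) * far + (A * lg z * far + C3))"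
      using np[OF z, of "- cball 0 \<rho>"] by (simp add: far_def)
    also have "\<dots> = q * mass - q * far + ld * far + C3 - mass * lg z + (2 + A) * (far * lg z)"
      by (simp add: algebra_simps)
    also have "\<dots> \<le> mass * q + e1 * ld + C3 - (mass - (2 + A) * e1) * lg z"
    proof -
      have "0 \<le> q * far" using q far by simp
      moreover have "ld * far \<le> e1 * ld" using mult_left_mono[OF far(2) ld] by (simp add: mult.commute)
      moreover have "(2 + A) * (far * lg z) \<le> (2 + A) * (e1 * lg z)"
        using A far lg_nonneg by (intro mult_left_mono mult_right_mono) auto
      ultimately show ?thesis by (simp add: algebra_simps)
    qed
    finally show ?thesis .
  qed
  define m where "m = mass / kap - e"
  have mk: "kap * m = mass - (2 + A) * e1"
  proof -
    have "(2 + A) * e1 = e * kap" using A by (simp add: e1_def)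
    then show ?thesis using kap_pos by (simp add: m_def right_diff_distrib mult.commute)
  qed
  define l0 where "l0 = ln (3 + 2 * \<rho>)"
  have inner: "kap * logpot z \<le> mass * (l0 + ld) + A * l0 * mass + C3" if z: "good z" and zr: "cmod z \<le> 2 * \<rho>" for z
  proof -
    have l: "lg z \<le> l0" unfolding lg_def l0_def using zr by (intro ln_mono) (auto simp: add_pos_nonneg)
    have "near_pot \<delta> z \<le> A * lg z * mass + C3"
      using np[OF z, of UNIV] by (simp add: near_pot_def mass_def)
    also have "\<dots> \<le> A * l0 * mass + C3" using l A mass_nonneg by (intro add_right_mono mult_right_mono mult_left_mono) auto
    finally have "near_pot \<delta> z \<le> A * l0 * mass + C3" .
    moreover have "mass * (lg z + ln (1 / \<delta>)) \<le> mass * (l0 + ld)"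
      using l mass_nonneg by (intro mult_left_mono) (auto simp: ld_def)
    ultimately show ?thesis using logpot_upper_near_pot[OF z \<delta>] by linarith
  qed
  \<comment> \<open>The last summand handles the inner region, where \<open>lg z\<close> is at most
    \<open>l0\<close> but the sign of \<open>m\<close> is unknown.\<close>
  define C where "C = mass * q + e1 * ld + mass * (l0 + ld) + A * l0 * mass + C3 + \<bar>kap * m\<bar> * l0"
  have l0: "l0 \<ge> 0" using \<rho> by (simp add: l0_def)
  show thesis
  proof (rule that[of "C / kap"])
    fix z assume z: "good z"
    have nn: "0 \<le> mass * q" "0 \<le> e1 * ld" "0 \<le> mass * (l0 + ld)" "0 \<le> A * l0 * mass" "0 \<le> \<bar>kap * m\<bar> * l0"
      using mass_nonneg q e1 ld l0 A by auto
    have "kap * logpot z \<le> C - (kap * m) * lg z"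
    proof (cases "cmod z \<ge> 2 * \<rho>")
      case True
      show ?thesis using outer[OF z True] nn unfolding mk[symmetric] C_def by linarith
    next
      case False
      have l: "lg z \<le> l0" unfolding lg_def l0_def using False by (intro ln_mono) (auto simp: add_pos_nonneg)
      have "(kap * m) * lg z \<le> \<bar>kap * m\<bar> * l0" using l lg_nonneg[of z] by (intro mult_mono) auto
      then show ?thesis using inner[OF z] False nn unfolding C_def by linarith
    qed
    then have "logpot z \<le> (C - (kap * m) * lg z) / kap" using kap_pos by (simp add: pos_le_divide_eq mult.commute)
    also have "\<dots> = C / kap - m * lg z" using kap_pos by (simp add: diff_divide_distrib)
    finally show "logpot z \<le> C / kap - (mass / kap - e) * lg z" by (simp add: m_def)
  qed
qed

end

lemma integral_inverse_norm_cball: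
  assumes r: "r > 0"
  shows "integrable lborel (\<lambda>w. indicat_real (cball 0 r) (z - w) / cmod (z - w))"
    "(\<integral>w. indicat_real (cball 0 r) (z - w) / cmod (z - w) \<partial>lborel) = r * csing"
proof -
  let ?f = "\<lambda>w::complex. indicat_real (cball 0 r) w / cmod w"
  have "(\<integral>w. ?f w \<partial>lborel) = \<bar>r\<bar> ^ DIM(complex) * (\<integral>w. ?f (0 + r *\<^sub>R w) \<partial>lborel)"
    using r by (intro integral_affine inverse_norm_measurable) auto
  also have "(\<integral>w. ?f (0 + r *\<^sub>R w) \<partial>lborel) = (\<integral>w. (1 / r) * (indicat_real (cball 0 1) w / cmod w) \<partial>lborel)"
    using r by (intro Bochner_Integration.integral_cong) (auto simp: indicator_def)
  also have "\<dots> = (1 / r) * csing" unfolding csing_def by (rule integral_mult_right_zero)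
  finally have "(\<integral>w. ?f w \<partial>lborel) = r * csing" using r by (simp add: power2_eq_square)
  then show "(\<integral>w. indicat_real (cball 0 r) (z - w) / cmod (z - w) \<partial>lborel) = r * csing"
    using integral_reflect(1)[OF inverse_norm_measurable[of r], of z] by simp
  show "integrable lborel (\<lambda>w. indicat_real (cball 0 r) (z - w) / cmod (z - w))"
    using integral_reflect(2)[OF inverse_norm_measurable[of r], of z] integrable_inverse_norm[of r] by simp
qed

section \<open>Sharp enough decay of the density and of its Riesz potential\<close>

context liouville
begin

lemma g_upper:
  obtains C where "C > 0" "\<And>z D m. logpot z \<le> D - m * lg z \<Longrightarrow> g z \<le> C * exp D * exp ((4 - m) * lg z)"
proof -
  obtain CR where CR: "CR > 0" "\<And>z. cmod (a * z\<^sup>2 + b * z + c) \<le> CR * exp (2 * lg z)"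
    using quadratic_upper by blast
  show thesis
  proof (rule that[of "CR\<^sup>2 * exp c0"])
    show "CR\<^sup>2 * exp c0 > 0" using CR by simp
    fix z D m assume l: "logpot z \<le> D - m * lg z"
    have "(cmod (a * z\<^sup>2 + b * z + c))\<^sup>2 \<le> (CR * exp (2 * lg z))\<^sup>2" using CR by (intro power_mono) auto
    also have "\<dots> = CR\<^sup>2 * exp (4 * lg z)" by (simp add: power_mult_distrib exp_double[symmetric])
    finally have 1: "(cmod (a * z\<^sup>2 + b * z + c))\<^sup>2 \<le> CR\<^sup>2 * exp (4 * lg z)" .
    have "g z = (cmod (a * z\<^sup>2 + b * z + c))\<^sup>2 * exp (c0 + logpot z)" by (rule g_eq)
    also have "\<dots> \<le> (CR\<^sup>2 * exp (4 * lg z)) * exp (c0 + (D - m * lg z))"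
      using l by (intro mult_mono 1) auto
    also have "\<dots> = CR\<^sup>2 * exp c0 * exp D * exp ((4 - m) * lg z)"
    proof -
      have "exp (4 * lg z) * exp (c0 + (D - m * lg z)) = exp c0 * exp D * exp ((4 - m) * lg z)"
        by (simp only: exp_add[symmetric]) (simp add: algebra_simps)
      then show ?thesis by (simp only: mult.assoc)
    qed
    finally show "g z \<le> CR\<^sup>2 * exp c0 * exp D * exp ((4 - m) * lg z)" .
  qed
qed

text \<open>The decay known at almost every point already bounds \<open>g\<close> almost everywhere
  on each unit disc. Then 1 / |z - w| is integrable against \<open>g\<close> at every z, and no
  exceptional set remains.\<close>

lemma all_good: "good z"
proof -
  obtain C where C: "C > 0" "\<And>z D m. logpot z \<le> D - m * lg z \<Longrightarrow> g z \<le> C * exp D * exp ((4 - m) * lg z)"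
    using g_upper by blast
  obtain D where D: "\<And>z. good z \<Longrightarrow> logpot z \<le> D - (mass / kap - 1) * lg z"
    using logpot_decay_good[of 1] by auto
  \<comment> \<open>The absolute value is taken since the sign of the exponent is not known at this
    stage; only a local bound is sought.\<close>
  define p where "p = \<bar>4 - (mass / kap - 1)\<bar>"
  define B where "B = C * exp D * exp (p * (lg z + ln 2))"
  have gB: "g w \<le> B" if w: "good w" "dist z w \<le> 1" for w
  proof -
    have "(4 - (mass / kap - 1)) * lg w \<le> p * (lg z + ln 2)"
      unfolding p_def using lg_ball[OF w(2)] lg_nonneg[of w] by (intro mult_mono) auto
    then have "C * exp D * exp ((4 - (mass / kap - 1)) * lg w) \<le> B"
      unfolding B_def using C(1) by (intro mult_left_mono) auto
    then show ?thesis using C(2)[OF D[OF w(1)]] by linarith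
  qed
  show ?thesis
    unfolding good_def
  proof (rule Bochner_Integration.integrable_bound)
    show "integrable lborel (\<lambda>w. g w + B * (indicat_real (cball 0 1) (z - w) / cmod (z - w)))"
      using g_int integral_csing(1)[of z] by (intro Bochner_Integration.integrable_add integrable_mult_right)
    show "AE w in lborel. norm (g w / cmod (z - w)) \<le> norm (g w + B * (indicat_real (cball 0 1) (z - w) / cmod (z - w)))"
      using AE_good
    proof eventually_elim
      fix w assume w: "good w"
      have B: "B \<ge> 0" using C by (simp add: B_def)
      have "g w / cmod (z - w) \<le> g w + B * (indicat_real (cball 0 1) (z - w) / cmod (z - w))"
      proof (cases "cmod (z - w) \<le> 1")
        case True
        then have "g w / cmod (z - w) \<le> B / cmod (z - w)"
          using gB[OF w] by (intro divide_right_mono) (auto simp: dist_norm)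
        then show ?thesis using True g_nonneg[of w] by (simp add: add_increasing)
      next
        case False
        then have "g w / cmod (z - w) \<le> g w / 1" using g_nonneg[of w] by (intro divide_left_mono) auto
        then show ?thesis using False by simp
      qed
      then show "norm (g w / cmod (z - w)) \<le> norm (g w + B * (indicat_real (cball 0 1) (z - w) / cmod (z - w)))"
        using g_nonneg[of w] B by simp
    qed
  qed measurable
qed

text \<open>If the potential fell no faster than -(59/10) ln |z|, then \<open>g\<close> would be at
  least a constant times |z|^(-19/10) far out. The disc of radius t around 2 t has area of order
  t^2, so it would carry mass of order t^(1/10), unbounded in t. The same works for every number
  below 6; 59/10 leaves room for the later losses.\<close>

lemma mass_lower: "mass / kap \<ge> 59 / 10"
proof (rule ccontr)
  assume "\<not> mass / kap \<ge> 59 / 10"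
  then have m: "mass / kap < 59 / 10" by simp
  obtain \<rho> where \<rho>: "\<rho> \<ge> 1" "\<And>z. cmod z \<ge> \<rho> \<Longrightarrow> cmod (a * z\<^sup>2 + b * z + c) \<ge> cmod a / 2 * (cmod z)\<^sup>2"
    using quadratic_lower[OF a_nz] by blast
  \<comment> \<open>The corrections with ln 2 and ln 3 come from 1 + |z| <= 2 |z| and |z| <= 3 t on
    the disc below.\<close>
  define C where "C = (cmod a / 2)\<^sup>2 * exp (c0 - 59 / 10 * ln 2 - 19 / 10 * ln 3)"
  have C: "C > 0" using a_nz by (simp add: C_def)
  define v where "v = measure lborel (cball (0::complex) 1)"
  have v: "v > 0" unfolding v_def by (rule measure_unit_ball_pos)
  \<comment> \<open>Chosen so that C v X exceeds the mass; t >= X^10 then makes t^(1/10) at least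
    X.\<close>
  define X where "X = mass / (C * v) + 1"
  have X: "X \<ge> 1" using mass_nonneg C v by (simp add: X_def)
  define t where "t = max \<rho> (X ^ 10)"
  have t: "t \<ge> \<rho>" "t \<ge> X ^ 10" "t \<ge> 1" using \<rho> by (auto simp: t_def)
  have low: "g z \<ge> C * exp (- (19 / 10) * ln t)" if z: "dist (complex_of_real (2 * t)) z \<le> t" for z
  proof -
    have n2: "cmod (complex_of_real (2 * t)) = 2 * t" using t by simp
    have z1: "t \<le> cmod z" "cmod z \<le> 3 * t"
      using z norm_triangle_ineq2[of "complex_of_real (2 * t)" z] norm_triangle_ineq2[of z "complex_of_real (2 * t)"]
      unfolding n2 dist_norm by (simp_all add: norm_minus_commute)
    have z0: "cmod z \<ge> 1" using z1 t by linarith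
    define l where "l = ln (cmod z)"
    have l: "l \<le> ln 3 + ln t"
    proof -
      have "l \<le> ln (3 * t)" unfolding l_def using z0 z1 by (intro ln_mono) auto
      also have "\<dots> = ln 3 + ln t" using t by (intro ln_mult_pos) auto
      finally show ?thesis .
    qed
    have l1: "ln (1 + cmod z) \<le> ln 2 + l"
    proof -
      have "ln (1 + cmod z) \<le> ln (2 * cmod z)" using z0 by (intro ln_mono) auto
      also have "\<dots> = ln 2 + l" unfolding l_def using z0 by (intro ln_mult_pos) auto
      finally show ?thesis .
    qed
    have "mass / kap * ln (1 + cmod z) \<le> 59 / 10 * (ln 2 + l)"
      using m l1 z0 by (intro mult_mono) (auto simp: l_def)
    then have lp: "logpot z \<ge> - (59 / 10) * (ln 2 + l)" using logpot_lower[of z] by linarith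
    have "(cmod a / 2 * (cmod z)\<^sup>2)\<^sup>2 \<le> (cmod (a * z\<^sup>2 + b * z + c))\<^sup>2"
      using \<rho>(2)[of z] z1 t by (intro power_mono) auto
    moreover have "(cmod a / 2 * (cmod z)\<^sup>2)\<^sup>2 = (cmod a / 2)\<^sup>2 * exp (4 * l)"
    proof -
      have "cmod z > 0" using z0 by linarith
      then have "exp l = cmod z" by (simp add: l_def)
      then have "exp (4 * l) = cmod z ^ 4" using exp_of_nat_mult[of 4 l] by simp
      then show ?thesis by (simp add: power_mult_distrib power_divide power_mult[symmetric])
    qed
    ultimately have r: "(cmod a / 2)\<^sup>2 * exp (4 * l) \<le> (cmod (a * z\<^sup>2 + b * z + c))\<^sup>2" by (simp only:)
    have "C * exp (- (19 / 10) * ln t) = (cmod a / 2)\<^sup>2 * exp (c0 - 59 / 10 * ln 2 - 19 / 10 * (ln 3 + ln t))"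
      by (simp only: C_def mult.assoc exp_add[symmetric]) (simp add: algebra_simps)
    also have "\<dots> \<le> (cmod a / 2)\<^sup>2 * exp (c0 - 59 / 10 * ln 2 - 19 / 10 * l)"
      using l by (intro mult_left_mono) auto
    also have "\<dots> = ((cmod a / 2)\<^sup>2 * exp (4 * l)) * exp (c0 + (- (59 / 10) * (ln 2 + l)))"
      by (simp only: mult.assoc exp_add[symmetric]) (simp add: algebra_simps)
    also have "\<dots> \<le> (cmod (a * z\<^sup>2 + b * z + c))\<^sup>2 * exp (c0 + logpot z)"
      using lp by (intro mult_mono r) auto
    also have "\<dots> = g z" by (rule g_eq[symmetric])
    finally show ?thesis .
  qed
  let ?B = "cball (complex_of_real (2 * t)) t"
  have ib: "integrable lborel (indicat_real ?B)"
    using emeasure_lborel_cball_finite[of "complex_of_real (2 * t)" t] by (intro integrable_real_indicator) auto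
  have "(\<integral>z. (C * exp (- (19 / 10) * ln t)) * indicat_real ?B z \<partial>lborel) \<le> (\<integral>z. g z \<partial>lborel)"
  proof (intro integral_mono integrable_mult_right ib g_int)
    fix z show "(C * exp (- (19 / 10) * ln t)) * indicat_real ?B z \<le> g z"
      using low[of z] g_nonneg[of z] by (cases "z \<in> ?B") simp_all
  qed
  then have "C * exp (- (19 / 10) * ln t) * (v * t\<^sup>2) \<le> mass"
    using measure_cball_complex[of t "complex_of_real (2 * t)"] t ib by (simp add: mass_def v_def)
  moreover have "exp (- (19 / 10) * ln t) * t\<^sup>2 = exp (ln t / 10)"
  proof -
    have "t\<^sup>2 = exp (2 * ln t)" using t by (simp add: exp_double)
    then show ?thesis by (simp add: exp_add[symmetric])
  qed
  ultimately have "(C * v) * exp (ln t / 10) \<le> mass" by (simp add: mult_ac)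
  moreover have "X \<le> exp (ln t / 10)"
  proof -
    have "10 * ln X = ln (X ^ 10)" using X by (simp add: ln_realpow)
    also have "\<dots> \<le> ln t" using t X by (intro ln_mono) auto
    finally have "exp (ln X) \<le> exp (ln t / 10)" by simp
    then show ?thesis using X by simp
  qed
  moreover have "0 < C * v" using C v by simp
  ultimately have "(C * v) * X \<le> mass" by (meson less_imp_le mult_left_mono order_trans)
  moreover have "q * (mass / q + 1) = mass + q" if "q > 0" for q :: real
    using that by (simp add: distrib_left)
  ultimately show False using \<open>0 < C * v\<close> unfolding X_def by (metis add_le_same_cancel1 not_le)
qed

text \<open>The exponent is 4 from |R|^2, minus 59/10 from the mass, plus a loss of 1/10: in total
  -9/5.\<close>

lemma g_decay:
  obtains C where "C > 0" "\<And>z. g z \<le> C * exp (- (9 / 5) * lg z)"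
proof -
  obtain C where C: "C > 0" "\<And>z D m. logpot z \<le> D - m * lg z \<Longrightarrow> g z \<le> C * exp D * exp ((4 - m) * lg z)"
    using g_upper by blast
  obtain D where D: "\<And>z. good z \<Longrightarrow> logpot z \<le> D - (mass / kap - 1 / 10) * lg z"
    using logpot_decay_good[of "1/10"] by auto
  show thesis
  proof (rule that[of "C * exp D"])
    show "C * exp D > 0" using C by simp
    fix z
    have "58 / 10 * lg z \<le> (mass / kap - 1 / 10) * lg z"
    proof (rule mult_right_mono)
      show "58 / 10 \<le> mass / kap - 1 / 10" using mass_lower by linarith
    qed (rule lg_nonneg)
    then have "logpot z \<le> D - 58 / 10 * lg z" using D[OF all_good, of z] by linarith
    from C(2)[OF this] show "g z \<le> C * exp D * exp (- (9 / 5) * lg z)" by simp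
  qed
qed

text \<open>The integral is split at |z - w| = r, half of 3 + |z|. Inside, \<open>w\<close> is
  comparable to \<open>z\<close>, so \<open>g\<close> is of order |z|^(-9/5) and integrating 1 / |z
  - w| gains a factor r. Outside, the integrand is at most g / r, which contributes order
  |z|^(-1).\<close>

lemma riesz_decay:
  obtains C where "C > 0" "\<And>z. (\<integral>w. g w / cmod (z - w) \<partial>lborel) \<le> C * exp (- (4 / 5) * lg z)"
proof -
  obtain C where C: "C > 0" "\<And>z. g z \<le> C * exp (- (9 / 5) * lg z)" using g_decay by blast
  define C' where "C' = C * exp (9 / 5 * ln 2) * csing / 2 + 2 * mass + 1"
  show thesis
  proof (rule that[of C'])
    show "C' > 0" using C csing_nonneg mass_nonneg by (simp add: C'_def add_nonneg_pos)
    fix z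
    define r where "r = exp (lg z) / 2"
    have r: "r > 0" by (simp add: r_def)
    define E where "E = C * exp (9 / 5 * ln 2) * exp (- (9 / 5) * lg z)"
    have E: "E > 0" using C by (simp add: E_def)
    have "(\<integral>w. g w / cmod (z - w) \<partial>lborel)
      \<le> (\<integral>w. E * (indicat_real (cball 0 r) (z - w) / cmod (z - w)) + (1 / r) * g w \<partial>lborel)"
    proof (rule integral_mono)
      show "integrable lborel (\<lambda>w. g w / cmod (z - w))" using all_good by (simp add: good_def)
      show "integrable lborel (\<lambda>w. E * (indicat_real (cball 0 r) (z - w) / cmod (z - w)) + (1 / r) * g w)"
        using g_int integral_inverse_norm_cball(1)[OF r, of z] by (intro Bochner_Integration.integrable_add integrable_mult_right)
      fix w
      show "g w / cmod (z - w) \<le> E * (indicat_real (cball 0 r) (z - w) / cmod (z - w)) + (1 / r) * g w"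
      proof (cases "cmod (z - w) \<le> r")
        case True
        have "3 + cmod z \<le> (3 + cmod w) * 2"
        proof -
          have "cmod (z - w) \<le> (3 + cmod z) / 2" using True by (simp add: r_def exp_lg)
          then show ?thesis using norm_triangle_ineq2[of z w] by (simp add: field_simps)
        qed
        then have "ln (3 + cmod z) \<le> ln ((3 + cmod w) * 2)" by (intro ln_mono) (auto simp: add_pos_nonneg)
        also have "\<dots> = lg w + ln 2" unfolding lg_def by (intro ln_mult_pos) (auto simp: add_pos_nonneg)
        finally have "- (9 / 5) * lg w \<le> 9 / 5 * ln 2 + - (9 / 5) * lg z" by (simp add: lg_def)
        then have "C * exp (- (9 / 5) * lg w) \<le> C * exp (9 / 5 * ln 2 + - (9 / 5) * lg z)"
          using C by (intro mult_left_mono) (simp_all only: exp_le_cancel_iff less_imp_le)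
        also have "\<dots> = E" by (simp only: E_def exp_add mult.assoc)
        finally have "g w \<le> E" using C(2)[of w] by linarith
        then have "g w / cmod (z - w) \<le> E / cmod (z - w)" by (intro divide_right_mono) auto
        then show ?thesis using True r g_nonneg[of w] by (simp add: add_increasing2)
      next
        case False
        moreover from this have "0 < cmod (z - w)" using r by linarith
        ultimately have "g w / cmod (z - w) \<le> g w / r" using g_nonneg[of w] r by (intro divide_left_mono) auto
        then show ?thesis using False by simp
      qed
    qed
    also have "\<dots> = E * (r * csing) + (1 / r) * mass"
      using g_int integral_inverse_norm_cball[OF r, of z]
      by (subst Bochner_Integration.integral_add)
         (auto simp only: integral_mult_right_zero mass_def intro!: integrable_mult_right)
    also have "E * (r * csing) = C * exp (9 / 5 * ln 2) * csing / 2 * exp (- (4 / 5) * lg z)"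
    proof -
      have "exp (- (9 / 5) * lg z) * exp (lg z) = exp (- (4 / 5) * lg z)" by (simp add: exp_add[symmetric])
      then show ?thesis by (simp add: E_def r_def)
    qed
    also have "(1 / r) * mass \<le> 2 * mass * exp (- (4 / 5) * lg z)"
    proof -
      have "1 / r = 2 * exp (- lg z)" by (simp add: r_def exp_minus field_simps)
      also have "\<dots> \<le> 2 * exp (- (4 / 5) * lg z)" using lg_nonneg[of z] by simp
      finally have "(1 / r) * mass \<le> (2 * exp (- (4 / 5) * lg z)) * mass" using mass_nonneg by (rule mult_right_mono)
      then show ?thesis by (simp only: mult_ac)
    qed
    finally have "(\<integral>w. g w / cmod (z - w) \<partial>lborel) \<le> (C' - 1) * exp (- (4 / 5) * lg z)"
      by (simp add: C'_def algebra_simps)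
    also have "\<dots> \<le> C' * exp (- (4 / 5) * lg z)" by (intro mult_right_mono) auto
    finally show "(\<integral>w. g w / cmod (z - w) \<partial>lborel) \<le> C' * exp (- (4 / 5) * lg z)" .
  qed
qed

end

section \<open>Regularity\<close>

text \<open>The derivative of ln |u| in direction \<open>v\<close>; at the origin division by 0
  gives the value 0.\<close>

definition grad_ker :: "complex \<Rightarrow> complex \<Rightarrow> real" where
  "grad_ker v u = (u \<bullet> v) * (1 / (cmod u)\<^sup>2)"

lemma grad_ker_measurable [measurable]: "grad_ker v \<in> borel_measurable borel"
  unfolding grad_ker_def[abs_def] by measurable

lemma grad_ker_bound: "\<bar>grad_ker v u\<bar> \<le> norm v / cmod u"
proof (cases "u = 0")
  case False
  have "\<bar>grad_ker v u\<bar> = \<bar>u \<bullet> v\<bar> / (cmod u)\<^sup>2" by (simp add: grad_ker_def abs_mult)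
  also have "\<dots> \<le> cmod u * cmod v / (cmod u)\<^sup>2"
    by (intro divide_right_mono Cauchy_Schwarz_ineq2) auto
  also have "\<dots> = norm v / cmod u" using False by (simp add: power2_eq_square)
  finally show ?thesis .
qed (simp add: grad_ker_def)

lemma square_ratio_le_sqrt:
  assumes "e > 0" "r > 0"
  shows "e\<^sup>2 / (r\<^sup>2 + e\<^sup>2) \<le> sqrt (e / (r::real))"
proof (cases "e \<le> r")
  case True
  then have x: "0 < e / r" "e / r \<le> 1" using assms by auto
  have "e\<^sup>2 / (r\<^sup>2 + e\<^sup>2) \<le> e\<^sup>2 / r\<^sup>2" using assms by (intro divide_left_mono) (auto simp: add_pos_pos)
  also have "\<dots> = (e / r) * (e / r)" by (simp add: power2_eq_square)
  also have "\<dots> \<le> (e / r) * 1" using x by (intro mult_left_mono) auto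
  also have "\<dots> = sqrt (e / r) * sqrt (e / r)" using assms by simp
  also have "\<dots> \<le> sqrt (e / r) * 1" using x by (intro mult_left_mono) auto
  finally show ?thesis by simp
next
  case False
  have "e\<^sup>2 / (r\<^sup>2 + e\<^sup>2) \<le> 1" using assms by (simp add: add_pos_pos)
  also have "1 \<le> sqrt (e / r)" using False assms by simp
  finally show ?thesis .
qed

text \<open>The two kernels differ by the factor e^2 / (r^2 + e^2) with r = |u|. Bounding it by sqrt
  (e / r) leaves the singularity r^(-3/2), still integrable in the plane, and a rate sqrt e that
  does not depend on u.\<close>

lemma grad_ker_approx:
  assumes e: "e > 0" and u: "u \<noteq> 0"
  shows "\<bar>(u \<bullet> v) * (1 / ((cmod u)\<^sup>2 + e\<^sup>2)) - grad_ker v u\<bar>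
     \<le> norm v * sqrt e * (indicat_real (cball 0 1) u * cmod u powr (- 2 * (3 / 4)) + 1)"
proof -
  define r where "r = cmod u"
  have r: "r > 0" using u by (simp add: r_def)
  have re: "r\<^sup>2 + e\<^sup>2 > 0" using r e by (simp add: add_pos_pos)
  have "1 / (r\<^sup>2 + e\<^sup>2) - 1 / r\<^sup>2 = - (e\<^sup>2 / (r\<^sup>2 + e\<^sup>2)) / r\<^sup>2"
    using r re by (simp add: field_simps)
  then have "(u \<bullet> v) * (1 / (r\<^sup>2 + e\<^sup>2)) - grad_ker v u = - ((u \<bullet> v) * ((e\<^sup>2 / (r\<^sup>2 + e\<^sup>2)) / r\<^sup>2))"
    unfolding grad_ker_def r_def[symmetric]
    by (simp only: right_diff_distrib[symmetric] minus_divide_left[symmetric] mult_minus_right)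
  then have "\<bar>(u \<bullet> v) * (1 / (r\<^sup>2 + e\<^sup>2)) - grad_ker v u\<bar> = \<bar>u \<bullet> v\<bar> * ((e\<^sup>2 / (r\<^sup>2 + e\<^sup>2)) / r\<^sup>2)"
    using r re by (simp add: abs_mult)
  also have "\<dots> \<le> (r * norm v) * (sqrt (e / r) / r\<^sup>2)"
    unfolding r_def using r e by (intro mult_mono divide_right_mono square_ratio_le_sqrt Cauchy_Schwarz_ineq2) (auto simp: r_def)
  also have "\<dots> = norm v * sqrt e * (1 / (r * sqrt r))"
    using r by (simp add: power2_eq_square real_sqrt_divide)
  also have "\<dots> \<le> norm v * sqrt e * (indicat_real (cball 0 1) u * r powr (- 2 * (3 / 4)) + 1)"
  proof (intro mult_left_mono)
    show "1 / (r * sqrt r) \<le> indicat_real (cball 0 1) u * r powr (- 2 * (3 / 4)) + 1"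
    proof (cases "r \<le> 1")
      case True
      have "r powr (3 / 2) = r powr 1 * r powr (1 / 2)" by (simp only: powr_add[symmetric]) simp
      then have "r * sqrt r = r powr (3 / 2)" using r by (simp add: powr_half_sqrt)
      then have "1 / (r * sqrt r) = r powr (- 2 * (3 / 4))" by (simp add: powr_minus inverse_eq_divide)
      then show ?thesis using True by (simp add: r_def)
    next
      case False
      then have "1 \<le> r * sqrt r" using mult_mono[of 1 r 1 "sqrt r"] by simp
      then have "1 / (r * sqrt r) \<le> 1" by simp
      then show ?thesis by (simp add: add_increasing)
    qed
  qed (use e in auto)
  finally show ?thesis by (simp add: r_def)
qed

lemma reg_log_diff:
  assumes e: "e > 0" and u: "u \<noteq> 0"
  shows "\<bar>reg_log e u - ln (cmod u)\<bar> \<le> e / cmod u"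
proof -
  define r where "r = cmod u"
  have r: "r > 0" using u by (simp add: r_def)
  have "ln r = ln (r\<^sup>2) / 2" using r by (simp add: ln_realpow)
  also have "\<dots> \<le> reg_log e u" unfolding reg_log_def r_def[symmetric]
    using r by (intro divide_right_mono ln_mono) auto
  finally have 1: "ln r \<le> reg_log e u" .
  have "ln (r\<^sup>2 + e\<^sup>2) \<le> ln ((r + e)\<^sup>2)"
    using r e by (intro ln_mono) (auto simp: power2_sum add_pos_pos)
  also have "\<dots> = 2 * ln (r * (1 + e / r))" using r e by (simp add: ln_realpow distrib_left)
  also have "ln (r * (1 + e / r)) = ln r + ln (1 + e / r)"
    using r e by (intro ln_mult_pos) (auto simp: add_pos_pos)
  also have "2 * (ln r + ln (1 + e / r)) \<le> 2 * (ln r + e / r)"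
    using r e ln_add_one_self_le_self[of "e / r"] by simp
  finally have le: "ln (r\<^sup>2 + e\<^sup>2) \<le> 2 * (ln r + e / r)" .
  have half: "L / 2 \<le> x" if "L \<le> 2 * x" for L x :: real using that by simp
  have "reg_log e u \<le> ln r + e / r"
    using half[OF le] by (simp only: reg_log_def r_def[symmetric])
  with 1 show ?thesis by (simp add: r_def)
qed

lemma half_ratio_bound:
  assumes e: "e > 0"
  shows "\<bar>(u \<bullet> v) * (1 / ((cmod u)\<^sup>2 + e\<^sup>2))\<bar> \<le> 1 / e * norm v"
proof -
  have p: "(cmod u)\<^sup>2 + e\<^sup>2 > 0" using e by (simp add: add_nonneg_pos)
  have "cmod u * e \<le> (cmod u)\<^sup>2 + e\<^sup>2"
  proof -
    have "0 \<le> cmod u * e" using e by simp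
    then show ?thesis using sum_squares_bound[of "cmod u" e] unfolding mult.assoc by linarith
  qed
  then have "cmod u / ((cmod u)\<^sup>2 + e\<^sup>2) \<le> 1 / e" using p e by (simp add: divide_le_eq pos_divide_le_eq field_simps)
  then have "norm v * (cmod u / ((cmod u)\<^sup>2 + e\<^sup>2)) \<le> norm v * (1 / e)" by (intro mult_left_mono) auto
  moreover have "\<bar>u \<bullet> v\<bar> / ((cmod u)\<^sup>2 + e\<^sup>2) \<le> cmod u * cmod v / ((cmod u)\<^sup>2 + e\<^sup>2)"
    using p by (intro divide_right_mono Cauchy_Schwarz_ineq2) auto
  ultimately show ?thesis using p by (simp add: abs_mult mult.commute)
qed

context liouville
begin

lemma grad_ker_integrable: "integrable lborel (\<lambda>w. grad_ker v (z - w) * g w)"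
proof (rule Bochner_Integration.integrable_bound)
  show "integrable lborel (\<lambda>w. norm v * (g w / cmod (z - w)))"
    using all_good[of z] unfolding good_def by (rule integrable_mult_right)
  show "AE w in lborel. norm (grad_ker v (z - w) * g w) \<le> norm (norm v * (g w / cmod (z - w)))"
  proof (intro AE_I2)
    fix w show "norm (grad_ker v (z - w) * g w) \<le> norm (norm v * (g w / cmod (z - w)))"
      using mult_right_mono[OF grad_ker_bound[of v "z - w"] g_nonneg[of w]] g_nonneg[of w] by (simp add: abs_mult)
  qed
qed measurable

lemma grad_ker_integral_bound:
  "\<bar>\<integral>w. grad_ker v (z - w) * g w \<partial>lborel\<bar> \<le> norm v * (\<integral>w. g w / cmod (z - w) \<partial>lborel)"
proof -
  have "\<bar>\<integral>w. grad_ker v (z - w) * g w \<partial>lborel\<bar> \<le> (\<integral>w. \<bar>grad_ker v (z - w) * g w\<bar> \<partial>lborel)"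
    by (rule integral_abs_bound)
  also have "\<dots> \<le> (\<integral>w. norm v * (g w / cmod (z - w)) \<partial>lborel)"
  proof (rule integral_mono)
    show "integrable lborel (\<lambda>w. norm v * (g w / cmod (z - w)))"
      using all_good[of z] unfolding good_def by (rule integrable_mult_right)
    fix w show "\<bar>grad_ker v (z - w) * g w\<bar> \<le> norm v * (g w / cmod (z - w))"
      using mult_right_mono[OF grad_ker_bound[of v "z - w"] g_nonneg[of w]] g_nonneg[of w] by (simp add: abs_mult)
  qed (use grad_ker_integrable in auto)
  finally show ?thesis by (simp only: integral_mult_right_zero)
qed

text \<open>The potential is the limit of potentials with the smooth kernels \<open>reg_log\<close>,
  whose gradients exist by differentiation under the integral. These gradients converge uniformly on
  the plane at rate sqrt (e n), as \<open>g\<close> is bounded and r^(-3/2) is locally integrable;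
  uniform convergence passes the derivative to the limit.\<close>

lemma logpot_has_derivative:
  "(logpot has_derivative (\<lambda>v. - (\<integral>w. grad_ker v (z - w) * g w \<partial>lborel) / kap)) (at z)"
proof -
  define e where "e n = inverse (real (Suc n))" for n
  have e: "e n > 0" "e \<longlonglongrightarrow> 0" for n
    using LIMSEQ_inverse_real_of_nat by (auto simp: e_def[abs_def] simp del: of_nat_Suc)
  define F where "F n z w = (ln (1 + cmod w) - reg_log (e n) (z - w)) * g w" for n z w
  define G where "G n z v = (\<integral>w. - ((z - w) \<bullet> v) * (1 / ((cmod (z - w))\<^sup>2 + (e n)\<^sup>2)) * g w \<partial>lborel)" for n z v
  have [measurable]: "reg_log (e n) \<in> borel_measurable borel" for n
    using C_k_imp_continuous[OF C_k_reg_log[OF e(1)]] continuous_measurable by blast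
  have Fm: "F n z \<in> borel_measurable borel" for n z unfolding F_def[abs_def] by measurable
  have Fd: "\<bar>F n z w - lker z w * g w\<bar> \<le> e n * (g w / cmod (z - w))" if "w \<noteq> z" for n z w
  proof -
    have "\<bar>reg_log (e n) (z - w) - ln (cmod (z - w))\<bar> * g w \<le> e n / cmod (z - w) * g w"
      using that g_nonneg by (intro mult_right_mono reg_log_diff e) auto
    moreover have "F n z w - lker z w * g w = - ((reg_log (e n) (z - w) - ln (cmod (z - w))) * g w)"
      by (simp add: F_def lker_def algebra_simps)
    ultimately show ?thesis using g_nonneg[of w] by (simp only: abs_minus_cancel abs_mult) simp
  qed
  have iR: "integrable lborel (\<lambda>w. e n * (g w / cmod (z - w)))" for n z
    using all_good[of z] unfolding good_def by (rule integrable_mult_right)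
  have iD: "integrable lborel (\<lambda>w. F n z w - lker z w * g w)" for n z
  proof (rule Bochner_Integration.integrable_bound[OF iR[of n z]])
    show "AE w in lborel. norm (F n z w - lker z w * g w) \<le> norm (e n * (g w / cmod (z - w)))"
      using AE_lborel_singleton[of z]
    proof eventually_elim
      fix w assume "w \<noteq> z"
      from Fd[OF this, of n] show "norm (F n z w - lker z w * g w) \<le> norm (e n * (g w / cmod (z - w)))"
        unfolding real_norm_def by linarith
    qed
  qed (use Fm in measurable)
  have iF: "integrable lborel (F n z)" for n z
    using Bochner_Integration.integrable_add[OF iD[of n z] good_lker_integrable[OF all_good[of z]]] by simp
  have dF: "((\<lambda>z. (\<integral>w. F n z w \<partial>lborel) / kap) has_derivative (\<lambda>v. G n z v / kap)) (at z)" for n z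
  proof -
    have "((\<lambda>z. \<integral>w. F n z w \<partial>lborel) has_derivative (\<lambda>v. G n z v)) (at z)"
      unfolding G_def
    proof (rule has_derivative_integral[where G="\<lambda>w. 1 / e n * g w" and D="\<lambda>z w v. - ((z - w) \<bullet> v) * (1 / ((cmod (z - w))\<^sup>2 + (e n)\<^sup>2)) * g w"])
      fix z w :: complex
      have "((\<lambda>z. z - w) has_derivative (\<lambda>v. v)) (at z)" by (auto intro!: derivative_eq_intros)
      from has_derivative_compose[OF this reg_log_has_derivative[OF e(1)[of n], of "z - w"]]
      have "((\<lambda>z. reg_log (e n) (z - w)) has_derivative (\<lambda>v. ((z - w) \<bullet> v) * (1 / ((cmod (z - w))\<^sup>2 + (e n)\<^sup>2)))) (at z)" .
      then have "((\<lambda>z. (ln (1 + cmod w) - reg_log (e n) (z - w)) * g w) has_derivative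
        (\<lambda>v. (0 - ((z - w) \<bullet> v) * (1 / ((cmod (z - w))\<^sup>2 + (e n)\<^sup>2))) * g w)) (at z)"
        by (intro has_derivative_mult_left has_derivative_diff has_derivative_const)
      then show "((\<lambda>z. F n z w) has_derivative (\<lambda>v. - ((z - w) \<bullet> v) * (1 / ((cmod (z - w))\<^sup>2 + (e n)\<^sup>2)) * g w)) (at z)"
        by (simp add: F_def)
    next
      fix z w v :: complex
      show "\<bar>- ((z - w) \<bullet> v) * (1 / ((cmod (z - w))\<^sup>2 + (e n)\<^sup>2)) * g w\<bar> \<le> 1 / e n * g w * norm v"
        using mult_right_mono[OF half_ratio_bound[OF e(1)[of n], of "z - w" v] g_nonneg[of w]] g_nonneg[of w]
        by (simp add: abs_mult mult_ac)
    qed (use Fm iF g_int in \<open>auto intro!: borel_measurable_times\<close>)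
    then have "((\<lambda>z. (1 / kap) * (\<integral>w. F n z w \<partial>lborel)) has_derivative (\<lambda>v. (1 / kap) * G n z v)) (at z)"
      by (rule has_derivative_mult_right)
    then show ?thesis by simp
  qed
  have lim: "(\<lambda>n. (\<integral>w. F n z w \<partial>lborel) / kap) \<longlonglongrightarrow> logpot z" for z
  proof -
    have "(\<lambda>n. (\<integral>w. F n z w \<partial>lborel) - (\<integral>w. lker z w * g w \<partial>lborel)) \<longlonglongrightarrow> 0"
    proof (rule Lim_null_comparison)
      show "\<forall>\<^sub>F n in sequentially. norm ((\<integral>w. F n z w \<partial>lborel) - (\<integral>w. lker z w * g w \<partial>lborel)) \<le> e n * (\<integral>w. g w / cmod (z - w) \<partial>lborel)"
      proof (intro always_eventually allI)
        fix n
        have eqF: "(\<integral>w. F n z w \<partial>lborel) - (\<integral>w. lker z w * g w \<partial>lborel) = (\<integral>w. F n z w - lker z w * g w \<partial>lborel)"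
          using iF[of n z] good_lker_integrable[OF all_good[of z]] by simp
        have "\<bar>(\<integral>w. F n z w \<partial>lborel) - (\<integral>w. lker z w * g w \<partial>lborel)\<bar> \<le> (\<integral>w. \<bar>F n z w - lker z w * g w\<bar> \<partial>lborel)"
          unfolding eqF by (rule integral_abs_bound)
        also have "\<dots> \<le> (\<integral>w. e n * (g w / cmod (z - w)) \<partial>lborel)"
        proof (rule integral_mono_AE)
          show "integrable lborel (\<lambda>w. \<bar>F n z w - lker z w * g w\<bar>)" by (rule integrable_abs[OF iD])
          show "integrable lborel (\<lambda>w. e n * (g w / cmod (z - w)))" by (rule iR)
          show "AE w in lborel. \<bar>F n z w - lker z w * g w\<bar> \<le> e n * (g w / cmod (z - w))"
            using AE_lborel_singleton[of z] by eventually_elim (rule Fd)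
        qed
        finally show "norm ((\<integral>w. F n z w \<partial>lborel) - (\<integral>w. lker z w * g w \<partial>lborel)) \<le> e n * (\<integral>w. g w / cmod (z - w) \<partial>lborel)"
          by (simp only: integral_mult_right_zero real_norm_def)
      qed
      show "(\<lambda>n. e n * (\<integral>w. g w / cmod (z - w) \<partial>lborel)) \<longlonglongrightarrow> 0"
        using tendsto_mult_left_zero[OF e(2)] .
    qed
    then have "(\<lambda>n. \<integral>w. F n z w \<partial>lborel) \<longlonglongrightarrow> (\<integral>w. lker z w * g w \<partial>lborel)"
      by (simp add: Lim_null[symmetric])
    then show ?thesis unfolding logpot_def using kap_pos by (intro tendsto_divide tendsto_const) auto
  qed
  obtain C where C: "C > 0" "\<And>z. g z \<le> C * exp (- (9 / 5) * lg z)" using g_decay by blast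
  have gC: "g z \<le> C" for z
  proof -
    have "exp (- (9 / 5) * lg z) \<le> 1" using lg_nonneg[of z] by simp
    then have "C * exp (- (9 / 5) * lg z) \<le> C * 1" using C by (intro mult_left_mono) auto
    then show ?thesis using C(2)[of z] by linarith
  qed
  define W where "W u = indicat_real (cball 0 1) u * cmod u powr (- 2 * (3 / 4))" for u :: complex
  have Wi: "integrable lborel W" unfolding W_def using integrable_norm_powr[of "3/4"] by simp
  have Wm [measurable]: "W \<in> borel_measurable borel" using Wi by simp
  have W0: "W u \<ge> 0" for u by (simp add: W_def)
  define S where "S = (C * (\<integral>u. W u \<partial>lborel) + mass) / kap"
  have S: "S \<ge> 0" unfolding S_def using C W0 mass_nonneg kap_pos
    by (intro divide_nonneg_nonneg add_nonneg_nonneg mult_nonneg_nonneg Bochner_Integration.integral_nonneg) auto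
  have unif: "norm (G n z v / kap - (- (\<integral>w. grad_ker v (z - w) * g w \<partial>lborel) / kap)) \<le> sqrt (e n) * S * norm v" for n z v
  proof -
    have Wz: "integrable lborel (\<lambda>w. W (z - w))" "(\<integral>w. W (z - w) \<partial>lborel) = (\<integral>w. W w \<partial>lborel)"
      using integral_reflect[OF Wm, of z] Wi by auto
    have iG: "integrable lborel (\<lambda>w. - ((z - w) \<bullet> v) * (1 / ((cmod (z - w))\<^sup>2 + (e n)\<^sup>2)) * g w)"
    proof (rule Bochner_Integration.integrable_bound)
      show "integrable lborel (\<lambda>w. 1 / e n * norm v * g w)" using g_int by (rule integrable_mult_right)
      show "AE w in lborel. norm (- ((z - w) \<bullet> v) * (1 / ((cmod (z - w))\<^sup>2 + (e n)\<^sup>2)) * g w) \<le> norm (1 / e n * norm v * g w)"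
      proof (intro AE_I2)
        fix w
        show "norm (- ((z - w) \<bullet> v) * (1 / ((cmod (z - w))\<^sup>2 + (e n)\<^sup>2)) * g w) \<le> norm (1 / e n * norm v * g w)"
          using mult_right_mono[OF half_ratio_bound[OF e(1)[of n], of "z - w" v] g_nonneg[of w]] g_nonneg[of w] e(1)[of n]
          by (simp add: abs_mult mult_ac)
      qed
    qed measurable
    have alg: "- X * Q * D + K * D = - ((X * Q - K) * D)" for X Q D K :: real by (simp add: algebra_simps)
    have eqG: "G n z v + (\<integral>w. grad_ker v (z - w) * g w \<partial>lborel)
      = (\<integral>w. - ((z - w) \<bullet> v) * (1 / ((cmod (z - w))\<^sup>2 + (e n)\<^sup>2)) * g w + grad_ker v (z - w) * g w \<partial>lborel)"
      unfolding G_def using iG grad_ker_integrable by simp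
    have "\<bar>G n z v + (\<integral>w. grad_ker v (z - w) * g w \<partial>lborel)\<bar> \<le> (\<integral>w. \<bar>- ((z - w) \<bullet> v) * (1 / ((cmod (z - w))\<^sup>2 + (e n)\<^sup>2)) * g w + grad_ker v (z - w) * g w\<bar> \<partial>lborel)"
      unfolding eqG by (rule integral_abs_bound)
    also have "\<dots> \<le> (\<integral>w. norm v * sqrt (e n) * (C * W (z - w) + g w) \<partial>lborel)"
    proof (rule integral_mono_AE)
      show "integrable lborel (\<lambda>w. \<bar>- ((z - w) \<bullet> v) * (1 / ((cmod (z - w))\<^sup>2 + (e n)\<^sup>2)) * g w + grad_ker v (z - w) * g w\<bar>)"
        using iG grad_ker_integrable by (intro integrable_abs Bochner_Integration.integrable_add)
      show "integrable lborel (\<lambda>w. norm v * sqrt (e n) * (C * W (z - w) + g w))"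
        using Wz g_int by simp
      show "AE w in lborel. \<bar>- ((z - w) \<bullet> v) * (1 / ((cmod (z - w))\<^sup>2 + (e n)\<^sup>2)) * g w + grad_ker v (z - w) * g w\<bar>
         \<le> norm v * sqrt (e n) * (C * W (z - w) + g w)"
        using AE_lborel_singleton[of z]
      proof eventually_elim
        fix w assume "w \<noteq> z"
        then have u: "z - w \<noteq> 0" by simp
        have "\<bar>((z - w) \<bullet> v) * (1 / ((cmod (z - w))\<^sup>2 + (e n)\<^sup>2)) - grad_ker v (z - w)\<bar> * g w \<le> norm v * sqrt (e n) * (W (z - w) + 1) * g w"
          unfolding W_def using g_nonneg by (intro mult_right_mono grad_ker_approx e u)
        also have "\<dots> = norm v * sqrt (e n) * (W (z - w) * g w + g w)" by (simp add: algebra_simps)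
        also have "\<dots> \<le> norm v * sqrt (e n) * (C * W (z - w) + g w)"
          using mult_right_mono[OF gC[of w] W0[of "z - w"]] e(1)[of n] by (intro mult_left_mono) (auto simp: mult.commute)
        finally have "\<bar>((z - w) \<bullet> v) * (1 / ((cmod (z - w))\<^sup>2 + (e n)\<^sup>2)) - grad_ker v (z - w)\<bar> * g w \<le> norm v * sqrt (e n) * (C * W (z - w) + g w)" .
        moreover have "- ((z - w) \<bullet> v) * (1 / ((cmod (z - w))\<^sup>2 + (e n)\<^sup>2)) * g w + grad_ker v (z - w) * g w
           = - ((((z - w) \<bullet> v) * (1 / ((cmod (z - w))\<^sup>2 + (e n)\<^sup>2)) - grad_ker v (z - w)) * g w)" by (rule alg)
        ultimately show "\<bar>- ((z - w) \<bullet> v) * (1 / ((cmod (z - w))\<^sup>2 + (e n)\<^sup>2)) * g w + grad_ker v (z - w) * g w\<bar>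
         \<le> norm v * sqrt (e n) * (C * W (z - w) + g w)"
          using g_nonneg[of w] by (simp only: abs_minus_cancel abs_mult abs_of_nonneg)
      qed
    qed
    also have "\<dots> = norm v * sqrt (e n) * (C * (\<integral>u. W u \<partial>lborel) + mass)"
      using Wz g_int by (simp add: mass_def)
    finally have "\<bar>G n z v + (\<integral>w. grad_ker v (z - w) * g w \<partial>lborel)\<bar> / kap \<le> norm v * sqrt (e n) * (C * (\<integral>u. W u \<partial>lborel) + mass) / kap"
      using kap_pos by (intro divide_right_mono) auto
    then show ?thesis
      using kap_pos by (simp add: S_def add_divide_distrib[symmetric] mult_ac)
  qed
  have "\<exists>h. \<forall>x\<in>UNIV. (\<lambda>n. (\<integral>w. F n x w \<partial>lborel) / kap) \<longlonglongrightarrow> h x \<and>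
     (h has_derivative (\<lambda>v. - (\<integral>w. grad_ker v (x - w) * g w \<partial>lborel) / kap)) (at x within UNIV)"
  proof (rule has_derivative_sequence[where f'="\<lambda>n x v. G n x v / kap"])
    fix r :: real assume r: "r > 0"
    have "(\<lambda>n. sqrt (e n) * S) \<longlonglongrightarrow> sqrt 0 * S" by (intro tendsto_intros e)
    then have "\<forall>\<^sub>F n in sequentially. sqrt (e n) * S < r" using r by (intro order_tendstoD(2)) auto
    then show "\<forall>\<^sub>F n in sequentially. \<forall>x\<in>UNIV. \<forall>h. norm (G n x h / kap - (- (\<integral>w. grad_ker h (x - w) * g w \<partial>lborel) / kap)) \<le> r * norm h"
    proof eventually_elim
      fix n assume n: "sqrt (e n) * S < r"
      show "\<forall>x\<in>UNIV. \<forall>h. norm (G n x h / kap - (- (\<integral>w. grad_ker h (x - w) * g w \<partial>lborel) / kap)) \<le> r * norm h"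
      proof (intro ballI allI)
        fix x h :: complex
        have "sqrt (e n) * S * norm h \<le> r * norm h" using n by (intro mult_right_mono) auto
        then show "norm (G n x h / kap - (- (\<integral>w. grad_ker h (x - w) * g w \<partial>lborel) / kap)) \<le> r * norm h"
          using unif[of n x h] by linarith
      qed
    qed
  qed (use dF lim[of 0] in auto)
  then obtain h where h: "\<And>x. (\<lambda>n. (\<integral>w. F n x w \<partial>lborel) / kap) \<longlonglongrightarrow> h x"
    "\<And>x. (h has_derivative (\<lambda>v. - (\<integral>w. grad_ker v (x - w) * g w \<partial>lborel) / kap)) (at x)" by auto
  have "h = logpot" using LIMSEQ_unique[OF h(1) lim] by auto
  then show ?thesis using h(2) by simp
qed

end

section \<open>Splitting the gradient kernel into a local singular and a smooth bounded part\<close>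

definition plateau :: "complex \<Rightarrow> real" where
  "plateau u = flat_exp 1 (1 - (cmod u)\<^sup>2)"

lemma plateau_nonneg: "plateau u \<ge> 0" and plateau_0: "cmod u \<ge> 1 \<Longrightarrow> plateau u = 0"
  by (auto simp: plateau_def flat_exp_1_nonneg intro!: flat_exp_1_0 one_le_power)

lemma test_function_plateau: "test_function plateau"
proof (rule test_functionI)
  fix k
  have "C_k k (\<lambda>u::complex. 1 - ((cmod u)\<^sup>2 + 0))" by (intro C_k_diff C_k_const C_k_norm_square)
  then have "C_k k (\<lambda>u::complex. flat_exp 1 (1 - ((cmod u)\<^sup>2 + 0)))" by (rule C_k_flat_exp)
  then show "C_k k plateau" by (simp add: plateau_def[abs_def])
  have "{x. plateau x \<noteq> 0} \<subseteq> cball 0 1" using plateau_0 by auto (meson linear)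
  then show "bounded {x. plateau x \<noteq> 0}" by (rule bounded_subset[OF bounded_cball])
qed

text \<open>A desingularised version of \<open>|u|\<^sup>2\<close>, unchanged outside the unit disc.\<close>

definition reg_sq :: "complex \<Rightarrow> real" where
  "reg_sq u = (cmod u)\<^sup>2 + plateau u"

lemma reg_sq_pos: "reg_sq u > 0"
proof (cases "u = 0")
  case True
  then show ?thesis by (simp add: reg_sq_def plateau_def flat_exp_1_pos)
next
  case False
  then show ?thesis using plateau_nonneg[of u] by (simp add: reg_sq_def add_pos_nonneg)
qed

lemma C_k_reg_sq: "C_k k reg_sq"
proof -
  have "C_k k (\<lambda>u. ((cmod u)\<^sup>2 + 0) + plateau u)"
    by (intro C_k_add C_k_norm_square test_functionD(1)[OF test_function_plateau])
  then show ?thesis by (simp add: reg_sq_def[abs_def])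
qed

lemma reg_sq_lower:
  obtains m where "m > 0" "\<And>u. reg_sq u \<ge> m" "\<And>u. reg_sq u \<ge> m * cmod u"
proof -
  have "continuous_on (cball 0 1) reg_sq"
    using C_k_imp_continuous[OF C_k_reg_sq] by (rule continuous_on_subset) auto
  then have "\<exists>u0\<in>cball 0 1. \<forall>u\<in>cball 0 1. reg_sq u0 \<le> reg_sq u"
    by (intro continuous_attains_inf) auto
  then obtain u0 where u0: "\<And>u. u \<in> cball 0 1 \<Longrightarrow> reg_sq u0 \<le> reg_sq u" by blast
  define m where "m = min 1 (reg_sq u0)"
  have m: "m > 0" "m \<le> 1" "m \<le> reg_sq u0" using reg_sq_pos by (auto simp: m_def)
  show thesis
  proof (rule that[OF m(1)])
    fix u
    have "reg_sq u \<ge> m \<and> reg_sq u \<ge> m * cmod u"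
    proof (cases "cmod u \<le> 1")
      case True
      then have "reg_sq u \<ge> m" using u0[of u] m by auto
      moreover have "m * cmod u \<le> m" using True m by (simp add: mult_left_le)
      ultimately show ?thesis by linarith
    next
      case False
      then have r: "reg_sq u = cmod u * cmod u" by (simp add: reg_sq_def plateau_0 power2_eq_square)
      have "1 * cmod u \<le> cmod u * cmod u" using False by (intro mult_right_mono) auto
      moreover have "m * cmod u \<le> 1 * cmod u" using m by (intro mult_right_mono) auto
      ultimately show ?thesis using False m r by linarith
    qed
    then show "reg_sq u \<ge> m" "reg_sq u \<ge> m * cmod u" by auto
  qed
qed

lemma reg_sq_has_derivative:
  "(reg_sq has_derivative (\<lambda>v. 2 * (u \<bullet> v) + fd plateau v u)) (at u)"
proof -
  have "((\<lambda>u. ((cmod u)\<^sup>2 + 0) + plateau u) has_derivative (\<lambda>v. 2 * (u \<bullet> v) + fd plateau v u)) (at u)"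
    by (intro has_derivative_add norm_square_has_derivative C_k_SucD(1)[OF test_functionD(1)[OF test_function_plateau]])
  then show ?thesis by (simp add: reg_sq_def[abs_def])
qed

text \<open>An algebra of bounded smooth functions that is closed under differentiation and contains the
  desingularised kernel.\<close>

inductive bounded_smooth :: "(complex \<Rightarrow> real) \<Rightarrow> bool" where
  recip: "bounded_smooth (\<lambda>u. 1 / reg_sq u)"
| kernel: "bounded_smooth (\<lambda>u. (u \<bullet> v) * (1 / reg_sq u))"
| test: "test_function \<phi> \<Longrightarrow> bounded_smooth \<phi>"
| const: "bounded_smooth (\<lambda>u. c)"
| add: "bounded_smooth f \<Longrightarrow> bounded_smooth h \<Longrightarrow> bounded_smooth (\<lambda>u. f u + h u)"
| mult: "bounded_smooth f \<Longrightarrow> bounded_smooth h \<Longrightarrow> bounded_smooth (\<lambda>u. f u * h u)"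

lemma bounded_smooth_C_k: "bounded_smooth f \<Longrightarrow> C_k k f"
proof (induction rule: bounded_smooth.induct)
  case recip
  show ?case using reg_sq_pos by (intro C_k_inverse C_k_reg_sq) (metis less_irrefl)
next
  case (kernel v)
  show ?case using reg_sq_pos
    by (intro C_k_mult C_k_inverse C_k_reg_sq C_k_linear[OF bounded_linear_inner_left]) (metis less_irrefl)
qed (auto intro: test_functionD)

lemma bounded_smooth_bounded: "bounded_smooth f \<Longrightarrow> \<exists>B. \<forall>u. \<bar>f u\<bar> \<le> B"
proof (induction rule: bounded_smooth.induct)
  case recip
  obtain m where m: "m > 0" "\<And>u. reg_sq u \<ge> m" by (rule reg_sq_lower) (rule that)
  have "\<bar>1 / reg_sq u\<bar> \<le> 1 / m" for u
  proof -
    have "1 / reg_sq u \<le> 1 / m" using m(1) m(2)[of u] by (intro frac_le) auto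
    then show ?thesis using reg_sq_pos[of u] by simp
  qed
  then show ?case by blast
next
  case (kernel v)
  obtain m where m: "m > 0" "\<And>u. reg_sq u \<ge> m * cmod u" by (rule reg_sq_lower) (rule that)
  have "\<bar>(u \<bullet> v) * (1 / reg_sq u)\<bar> \<le> norm v / m" for u
  proof -
    have "\<bar>u \<bullet> v\<bar> * m \<le> (cmod u * cmod v) * m" using m(1) by (intro mult_right_mono Cauchy_Schwarz_ineq2) auto
    also have "\<dots> = cmod v * (m * cmod u)" by simp
    also have "\<dots> \<le> cmod v * reg_sq u" using m(2) by (intro mult_left_mono) auto
    finally have "\<bar>u \<bullet> v\<bar> * m \<le> cmod v * reg_sq u" .
    then have "\<bar>u \<bullet> v\<bar> / reg_sq u \<le> cmod v / m"
      using m(1) reg_sq_pos[of u] by (simp add: pos_divide_le_eq pos_le_divide_eq)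
    then show ?thesis using reg_sq_pos[of u] by (simp add: abs_mult)
  qed
  then show ?case by blast
next
  case (test \<phi>)
  obtain B r where "B > 0" "\<And>x. \<bar>\<phi> x\<bar> \<le> B * indicat_real (cball 0 r) x"
    using continuous_bounded_support[OF C_k_imp_continuous[OF test_functionD(1)[OF test]] test_functionD(2)[OF test]] by blast
  note B = this
  have "\<bar>\<phi> x\<bar> \<le> B" for x using B(2)[of x] B(1) by (cases "x \<in> cball 0 r") simp_all
  then show ?case by blast
next
  case (const c)
  show ?case by blast
next
  case (add f h)
  then obtain B C where "\<And>u. \<bar>f u\<bar> \<le> B" "\<And>u. \<bar>h u\<bar> \<le> C" by blast
  note BC = this
  have "\<bar>f u + h u\<bar> \<le> B + C" for u using BC(1)[of u] BC(2)[of u] by linarith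
  then show ?case by blast
next
  case (mult f h)
  then obtain B C where "\<And>u. \<bar>f u\<bar> \<le> B" "\<And>u. \<bar>h u\<bar> \<le> C" by blast
  then have "\<bar>f u * h u\<bar> \<le> B * C" for u
    unfolding abs_mult using order_trans[OF abs_ge_zero] by (intro mult_mono) blast+
  then show ?case by blast
qed

text \<open>The derivative of \<open>reg_sq\<close> contains the unbounded linear term 2 (u . v). It
  occurs only divided by \<open>reg_sq\<close>, that is, as a \<open>kernel\<close>, which is why
  the kernels are generators of their own.\<close>

lemma bounded_smooth_fd: "bounded_smooth f \<Longrightarrow> bounded_smooth (fd f v)"
proof (induction rule: bounded_smooth.induct)
  case recip
  have "fd (\<lambda>u. 1 / reg_sq u) v = (\<lambda>u. (- 2) * (((u \<bullet> v) * (1 / reg_sq u)) * (1 / reg_sq u))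
      + (- 1) * (fd plateau v u * ((1 / reg_sq u) * (1 / reg_sq u))))"
  proof
    fix u
    have nz: "reg_sq u \<noteq> 0" using reg_sq_pos[of u] by simp
    show "fd (\<lambda>u. 1 / reg_sq u) v u = (- 2) * (((u \<bullet> v) * (1 / reg_sq u)) * (1 / reg_sq u))
      + (- 1) * (fd plateau v u * ((1 / reg_sq u) * (1 / reg_sq u)))"
      by (subst fd_eq[OF has_derivative_recip[OF reg_sq_has_derivative nz]]) (simp only: algebra_simps)
  qed
  moreover have "bounded_smooth \<dots>"
    by (intro bounded_smooth.intros test_function_fd test_function_plateau)
  ultimately show ?case by simp
next
  case (kernel w)
  have "fd (\<lambda>u. (u \<bullet> w) * (1 / reg_sq u)) v = (\<lambda>u. (v \<bullet> w) * (1 / reg_sq u)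
     + ((- 2) * (((u \<bullet> w) * (1 / reg_sq u)) * ((u \<bullet> v) * (1 / reg_sq u)))
      + (- 1) * (fd plateau v u * (((u \<bullet> w) * (1 / reg_sq u)) * (1 / reg_sq u)))))"
  proof
    fix u
    have nz: "reg_sq u \<noteq> 0" using reg_sq_pos[of u] by simp
    have "((\<lambda>u. (u \<bullet> w) * (1 / reg_sq u)) has_derivative
       (\<lambda>v. (u \<bullet> w) * - ((2 * (u \<bullet> v) + fd plateau v u) * ((1 / reg_sq u) * (1 / reg_sq u))) + (v \<bullet> w) * (1 / reg_sq u))) (at u)"
      by (intro has_derivative_mult has_derivative_recip reg_sq_has_derivative nz has_derivative_inner_left has_derivative_ident)
    note der = fd_eq[OF this, of v]
    have alg: "x * - ((2 * y + p) * (q * q)) + t * q = t * q + ((- 2) * ((x * q) * (y * q)) + (- 1) * (p * ((x * q) * q)))"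
      for x y p q t :: real by (simp add: algebra_simps)
    show "fd (\<lambda>u. (u \<bullet> w) * (1 / reg_sq u)) v u = (v \<bullet> w) * (1 / reg_sq u)
     + ((- 2) * (((u \<bullet> w) * (1 / reg_sq u)) * ((u \<bullet> v) * (1 / reg_sq u)))
      + (- 1) * (fd plateau v u * (((u \<bullet> w) * (1 / reg_sq u)) * (1 / reg_sq u))))"
      unfolding der by (rule alg)
  qed
  moreover have "bounded_smooth \<dots>"
    by (intro bounded_smooth.intros test_function_fd test_function_plateau)
  ultimately show ?case by simp
next
  case (test \<phi>)
  then show ?case by (intro bounded_smooth.test test_function_fd)
next
  case (const c)
  have "fd (\<lambda>u. c) v = (\<lambda>u. 0)" by (simp add: frechet_derivative_const fun_eq_iff)
  then show ?case by (simp add: bounded_smooth.const)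
next
  case (add f h)
  have "fd (\<lambda>u. f u + h u) v = (\<lambda>u. fd f v u + fd h v u)"
    using fd_eq[OF has_derivative_add[OF C_k_SucD(1)[OF bounded_smooth_C_k[OF add.hyps(1)]] C_k_SucD(1)[OF bounded_smooth_C_k[OF add.hyps(2)]]]] by auto
  then show ?case using bounded_smooth.add[OF add.IH] by simp
next
  case (mult f h)
  have "fd (\<lambda>u. f u * h u) v = (\<lambda>u. f u * fd h v u + fd f v u * h u)"
    using fd_mult[OF bounded_smooth_C_k[OF mult.hyps(1)] bounded_smooth_C_k[OF mult.hyps(2)]] by auto
  then show ?case
    using bounded_smooth.add[OF bounded_smooth.mult[OF mult.hyps(1) mult.IH(2)] bounded_smooth.mult[OF mult.IH(1) mult.hyps(2)]] by simp
qed

text \<open>Neither factor has bounded support here. Instead \<open>h\<close> is integrable and all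
  derivatives of \<open>f\<close> are bounded, so a multiple of |h| dominates, and the induction
  stays inside \<open>bounded_smooth\<close>.\<close>

lemma C_k_convolution_bounded_smooth:
  assumes h: "integrable lborel h"
  shows "bounded_smooth f \<Longrightarrow> C_k k (\<lambda>z. \<integral>w. f (z - w) * h w \<partial>lborel)"
proof (induction k arbitrary: f)
  case 0
  have fc: "continuous_on UNIV f" using C_k_imp_continuous[OF bounded_smooth_C_k[OF 0]] .
  have [measurable]: "f \<in> borel_measurable borel" "h \<in> borel_measurable borel"
    using fc continuous_measurable h by auto
  obtain B where B: "\<And>u. \<bar>f u\<bar> \<le> B" using bounded_smooth_bounded[OF 0] by blast
  have "isCont (\<lambda>z. \<integral>w. f (z - w) * h w \<partial>lborel) z0" for z0
  proof (rule continuous_integral[where G="\<lambda>w. B * \<bar>h w\<bar>"])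
    show "isCont (\<lambda>z. f (z - w) * h w) z0" for w
      using fc by (intro continuous_intros continuous_at_compose[unfolded o_def, of _ "\<lambda>z. z - w" f]) (auto simp: continuous_on_eq_continuous_at)
    show "\<bar>f (z - w) * h w\<bar> \<le> B * \<bar>h w\<bar>" for z w
      unfolding abs_mult by (intro mult_right_mono B) auto
  qed (use h in auto)
  then show ?case by (simp add: continuous_at_imp_continuous_on)
next
  case (Suc k)
  have f1: "C_k (Suc 0) f" using bounded_smooth_C_k[OF Suc.prems] .
  have fc: "continuous_on UNIV f" "continuous_on UNIV (fd f v)" for v
    using C_k_imp_continuous[OF bounded_smooth_C_k] Suc.prems bounded_smooth_fd by blast+
  have [measurable]: "f \<in> borel_measurable borel" "fd f v \<in> borel_measurable borel" "h \<in> borel_measurable borel" for v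
    using fc continuous_measurable h by auto
  obtain B where B: "\<And>u. \<bar>f u\<bar> \<le> B" using bounded_smooth_bounded[OF Suc.prems] by blast
  have "\<forall>b. \<exists>C. \<forall>u. \<bar>fd f b u\<bar> \<le> C" using bounded_smooth_bounded[OF bounded_smooth_fd[OF Suc.prems]] by blast
  then obtain C where C: "\<And>b u. \<bar>fd f b u\<bar> \<le> C b" by metis
  show ?case
  proof (rule C_k_SucI)
    fix z0
    show "((\<lambda>z. \<integral>w. f (z - w) * h w \<partial>lborel) has_derivative (\<lambda>v. \<integral>w. fd f v (z0 - w) * h w \<partial>lborel)) (at z0)"
    proof (rule has_derivative_integral[where G="\<lambda>w. (\<Sum>b\<in>Basis. C b) * \<bar>h w\<bar>" and D="\<lambda>z w v. fd f v (z - w) * h w"])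
      fix z w :: complex
      have "((\<lambda>z. z - w) has_derivative (\<lambda>v. v)) (at z)" by (auto intro!: derivative_eq_intros)
      from has_derivative_compose[OF this C_k_SucD(1)[OF f1, of "z - w"]]
      show "((\<lambda>z. f (z - w) * h w) has_derivative (\<lambda>v. fd f v (z - w) * h w)) (at z)"
        by (rule has_derivative_mult_left)
      fix v
      have "\<bar>fd f v (z - w)\<bar> \<le> (\<Sum>b\<in>Basis. \<bar>fd f b (z - w)\<bar>) * norm v" by (rule fd_bound[OF f1])
      also have "\<dots> \<le> (\<Sum>b\<in>Basis. C b) * norm v" by (intro mult_right_mono sum_mono C) auto
      finally have "\<bar>fd f v (z - w)\<bar> * \<bar>h w\<bar> \<le> ((\<Sum>b\<in>Basis. C b) * norm v) * \<bar>h w\<bar>" by (intro mult_right_mono) auto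
      then show "\<bar>fd f v (z - w) * h w\<bar> \<le> (\<Sum>b\<in>Basis. C b) * \<bar>h w\<bar> * norm v"
        by (simp only: abs_mult mult_ac)
    next
      show "integrable lborel (\<lambda>w. f (z0 - w) * h w)"
        using integrable_bound_mult[OF h, of "\<lambda>w. f (z0 - w)" B] B by (simp add: mult.commute)
    qed (use h in auto)
    show "C_k k (\<lambda>z. \<integral>w. fd f v (z - w) * h w \<partial>lborel)" for v
      by (intro Suc.IH bounded_smooth_fd Suc.prems)
  qed
qed

context liouville
begin

text \<open>The kernel is A1 + A2 with A1 singular but supported in the unit disc and A2 smooth with
  bounded derivatives. In the convolution with A1 the derivatives fall on \<open>g\<close>, in the
  other they fall on A2.\<close>

lemma C_k_grad_ker_integral:
  assumes g: "C_k k g"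
  shows "C_k k (\<lambda>z. \<integral>w. grad_ker v (z - w) * g w \<partial>lborel)"
proof -
  define A2 where "A2 u = (u \<bullet> v) * (1 / reg_sq u)" for u
  define A1 where "A1 u = grad_ker v u - A2 u" for u
  have A2: "bounded_smooth A2" unfolding A2_def by (rule bounded_smooth.kernel)
  have A2c: "continuous_on UNIV A2" using C_k_imp_continuous[OF bounded_smooth_C_k[OF A2]] .
  have [measurable]: "A2 \<in> borel_measurable borel" using A2c continuous_measurable by auto
  have A1m [measurable]: "A1 \<in> borel_measurable borel" unfolding A1_def by measurable
  obtain B where B: "\<And>u. \<bar>A2 u\<bar> \<le> B" using bounded_smooth_bounded[OF A2] by blast
  have A10: "A1 u = 0" if "cmod u \<ge> 1" for u
    using that by (simp add: A1_def A2_def grad_ker_def reg_sq_def plateau_0)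
  have A1loc: "loc_int A1"
    unfolding loc_int_def
  proof (intro conjI allI A1m)
    fix r
    show "integrable lborel (\<lambda>x. indicat_real (cball 0 r) x * A1 x)"
    proof (rule Bochner_Integration.integrable_bound)
      have "integrable lborel (indicat_real (cball (0::complex) r))"
        using emeasure_lborel_cball_finite[of "0::complex" r] by (intro integrable_real_indicator) auto
      then show "integrable lborel (\<lambda>x. norm v * (indicat_real (cball 0 r) x / cmod x) + B * indicat_real (cball 0 r) x)"
        using integrable_inverse_norm[of r] by (intro Bochner_Integration.integrable_add integrable_mult_right)
      show "AE x in lborel. norm (indicat_real (cball 0 r) x * A1 x) \<le> norm (norm v * (indicat_real (cball 0 r) x / cmod x) + B * indicat_real (cball 0 r) x)"
      proof (intro AE_I2)
        fix x
        have "\<bar>A1 x\<bar> \<le> norm v / cmod x + B" using grad_ker_bound[of v x] B[of x] unfolding A1_def by linarith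
        then show "norm (indicat_real (cball 0 r) x * A1 x) \<le> norm (norm v * (indicat_real (cball 0 r) x / cmod x) + B * indicat_real (cball 0 r) x)"
          by (cases "x \<in> cball 0 r") simp_all
      qed
    qed measurable
  qed
  have bs: "bounded {x. A1 x \<noteq> 0}"
  proof (rule bounded_subset[OF bounded_cball[of 0 1]])
    show "{x. A1 x \<noteq> 0} \<subseteq> cball 0 1" using A10 by auto (meson linear)
  qed
  have 1: "C_k k (\<lambda>z. \<integral>w. A1 w * g (z - w) \<partial>lborel)"
    using C_k_convolution[OF A1loc _ g] bs by blast
  have i2: "integrable lborel (\<lambda>w. A2 (z - w) * g w)" for z
    using integrable_bound_mult[OF g_int, of "\<lambda>w. A2 (z - w)" B] B by (simp add: mult.commute)
  have "(\<integral>w. grad_ker v (z - w) * g w \<partial>lborel) = (\<integral>w. A1 w * g (z - w) \<partial>lborel) + (\<integral>w. A2 (z - w) * g w \<partial>lborel)" for z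
  proof -
    have "(\<integral>w. grad_ker v (z - w) * g w \<partial>lborel) = (\<integral>w. (grad_ker v (z - w) * g w - A2 (z - w) * g w) + A2 (z - w) * g w \<partial>lborel)"
      by simp
    also have "\<dots> = (\<integral>w. grad_ker v (z - w) * g w - A2 (z - w) * g w \<partial>lborel) + (\<integral>w. A2 (z - w) * g w \<partial>lborel)"
      using grad_ker_integrable i2 by (intro Bochner_Integration.integral_add Bochner_Integration.integrable_diff)
    also have "(\<integral>w. grad_ker v (z - w) * g w - A2 (z - w) * g w \<partial>lborel) = (\<integral>w. A1 (z - w) * g (z - (z - w)) \<partial>lborel)"
      by (intro Bochner_Integration.integral_cong) (auto simp: A1_def left_diff_distrib)
    also have "\<dots> = (\<integral>w. A1 w * g (z - w) \<partial>lborel)"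
      by (rule integral_reflect(1)[of "\<lambda>w. A1 w * g (z - w)" z]) measurable
    finally show ?thesis .
  qed
  then show ?thesis using C_k_add[OF 1 C_k_convolution_bounded_smooth[OF g_int A2]] by simp
qed

lemma C_k_coeff: "C_k k (\<lambda>z. (cmod (a * z\<^sup>2 + b * z + c))\<^sup>2)"
proof -
  have l: "C_k k (\<lambda>z. Re (d * z))" "C_k k (\<lambda>z. Im (d * z))" for d :: complex
    by (intro C_k_linear bounded_linear_compose[OF bounded_linear_Re bounded_linear_mult_right]
          bounded_linear_compose[OF bounded_linear_Im bounded_linear_mult_right])+
  have eq: "(cmod (a * z\<^sup>2 + b * z + c))\<^sup>2 =
     (Re (a * z) * Re (1 * z) - Im (a * z) * Im (1 * z) + Re (b * z) + Re c)\<^sup>2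
   + (Re (a * z) * Im (1 * z) + Im (a * z) * Re (1 * z) + Im (b * z) + Im c)\<^sup>2" for z
  proof -
    have "Re (a * z\<^sup>2 + b * z + c) = Re (a * z) * Re (1 * z) - Im (a * z) * Im (1 * z) + Re (b * z) + Re c"
      "Im (a * z\<^sup>2 + b * z + c) = Re (a * z) * Im (1 * z) + Im (a * z) * Re (1 * z) + Im (b * z) + Im c"
      by (simp_all add: power2_eq_square algebra_simps)
    then show ?thesis by (simp only: cmod_power2)
  qed
  show ?thesis unfolding eq by (intro C_k_add C_k_power C_k_diff C_k_mult C_k_const l)
qed

text \<open>If the potential is k times differentiable, so is \<open>g\<close> by its equation; then
  the gradient of the potential has k derivatives and the potential has one more.\<close>

lemma C_k_logpot: "C_k k logpot"
proof (induction k)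
  case 0
  have "isCont logpot z" for z using has_derivative_continuous[OF logpot_has_derivative] .
  then show ?case by (simp add: continuous_at_imp_continuous_on)
next
  case (Suc k)
  have "C_k k (\<lambda>z. (cmod (a * z\<^sup>2 + b * z + c))\<^sup>2 * exp (c0 + logpot z))"
    by (intro C_k_mult C_k_coeff C_k_exp C_k_add C_k_const Suc.IH)
  moreover have "(\<lambda>z. (cmod (a * z\<^sup>2 + b * z + c))\<^sup>2 * exp (c0 + logpot z)) = g" using g_eq by auto
  ultimately have g: "C_k k g" by simp
  show ?case
  proof (rule C_k_SucI[OF logpot_has_derivative])
    fix v
    have "C_k k (\<lambda>z. (- 1 / kap) * (\<integral>w. grad_ker v (z - w) * g w \<partial>lborel))"
      by (intro C_k_cmult C_k_grad_ker_integral g)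
    then show "C_k k (\<lambda>z. - (\<integral>w. grad_ker v (z - w) * g w \<partial>lborel) / kap)" by simp
  qed
qed

lemma C_k_g: "C_k k g"
proof -
  have "C_k k (\<lambda>z. (cmod (a * z\<^sup>2 + b * z + c))\<^sup>2 * exp (c0 + logpot z))"
    by (intro C_k_mult C_k_coeff C_k_exp C_k_add C_k_const C_k_logpot)
  moreover have "(\<lambda>z. (cmod (a * z\<^sup>2 + b * z + c))\<^sup>2 * exp (c0 + logpot z)) = g" using g_eq by auto
  ultimately show ?thesis by simp
qed

text \<open>Green's identity and the weak equation give equality almost everywhere by the
  fundamental lemma. Both sides are continuous, so the set of equality is closed and of full
  measure, hence the whole plane.\<close>

lemma laplacian_logpot: "laplacian logpot z = - g z"
proof -
  have lc: "continuous_on UNIV (\<lambda>z. laplacian logpot z + g z)"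
    using laplacian_continuous[OF C_k_logpot] C_k_imp_continuous[OF C_k_g[of 0]] by (intro continuous_on_add)
  have "AE z in lborel. laplacian logpot z + g z = 0"
  proof (rule integral_test_eq_0_imp_AE_0)
    show "loc_int (\<lambda>z. laplacian logpot z + g z)" by (rule loc_int_continuous[OF lc])
    fix \<phi> :: "complex \<Rightarrow> real" assume \<phi>: "test_function \<phi>"
    have c: "continuous_on UNIV \<phi>" using C_k_imp_continuous[OF test_functionD(1)[OF \<phi>]] .
    have i: "integrable lborel (\<lambda>z. laplacian logpot z * \<phi> z)" "integrable lborel (\<lambda>z. g z * \<phi> z)"
      using laplacian_continuous[OF C_k_logpot] C_k_imp_continuous[OF C_k_g[of 0]]
      by (auto intro!: loc_int_mult_continuous[OF _ c test_functionD(2)[OF \<phi>]] loc_int_continuous)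
    have "(\<integral>z. laplacian logpot z * \<phi> z \<partial>lborel) = - (\<integral>z. g z * \<phi> z \<partial>lborel)"
      using green_identity[OF C_k_logpot test_functionD[OF \<phi>]] logpot_weak[OF test_functionD[OF \<phi>]] by simp
    then show "(\<integral>z. (laplacian logpot z + g z) * \<phi> z \<partial>lborel) = 0"
      using i by (simp add: distrib_right)
  qed
  then have "AE z in lebesgue. z \<in> {z. laplacian logpot z + g z = 0}"
    by (intro AE_completion) simp
  moreover have "closed {z. laplacian logpot z + g z = 0}"
    using lc by (intro closed_Collect_eq) auto
  ultimately have "z \<in> {z. laplacian logpot z + g z = 0}"
    using mem_closed_if_AE_lebesgue by blast
  then show ?thesis by simp
qed

lemma fd_logpot_decay:
  obtains C where "C > 0" "\<And>z v. \<bar>fd logpot v z\<bar> \<le> norm v * (C * exp (- (4 / 5) * lg z))"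
proof -
  obtain C where C: "C > 0" "\<And>z. (\<integral>w. g w / cmod (z - w) \<partial>lborel) \<le> C * exp (- (4 / 5) * lg z)"
    using riesz_decay by blast
  show thesis
  proof (rule that[of "C / kap"])
    show "C / kap > 0" using C kap_pos by simp
    fix z v
    have "fd logpot v z = - (\<integral>w. grad_ker v (z - w) * g w \<partial>lborel) / kap" by (rule fd_eq[OF logpot_has_derivative])
    then have "\<bar>fd logpot v z\<bar> = \<bar>\<integral>w. grad_ker v (z - w) * g w \<partial>lborel\<bar> / kap" using kap_pos by simp
    also have "\<dots> \<le> (norm v * (\<integral>w. g w / cmod (z - w) \<partial>lborel)) / kap"
      using kap_pos by (intro divide_right_mono grad_ker_integral_bound) auto
    also have "\<dots> \<le> (norm v * (C * exp (- (4 / 5) * lg z))) / kap"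
      using kap_pos C by (intro divide_right_mono mult_left_mono) auto
    finally show "\<bar>fd logpot v z\<bar> \<le> norm v * (C / kap * exp (- (4 / 5) * lg z))" by simp
  qed
qed

end

section \<open>The entire function T\<close>

text \<open>The numbers \<open>p\<close> and \<open>q\<close> are the Wirtinger derivatives F_z and
  F_zbar at z, and q = 0 means complex differentiability. As a relation it lets both derivatives of
  a compound expression be computed at once by composing rules.\<close>

definition wd :: "(complex \<Rightarrow> complex) \<Rightarrow> complex \<Rightarrow> complex \<Rightarrow> complex \<Rightarrow> bool" where
  "wd F p q z \<longleftrightarrow> (F has_derivative (\<lambda>h. p * h + q * cnj h)) (at z)"

lemma wd_const: "wd (\<lambda>z. k) 0 0 z"
  by (simp add: wd_def)

lemma wd_add: "wd F p q z \<Longrightarrow> wd G p' q' z \<Longrightarrow> wd (\<lambda>z. F z + G z) (p + p') (q + q') z"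
  unfolding wd_def by (drule (1) has_derivative_add) (simp add: algebra_simps)

lemma wd_diff: "wd F p q z \<Longrightarrow> wd G p' q' z \<Longrightarrow> wd (\<lambda>z. F z - G z) (p - p') (q - q') z"
  unfolding wd_def by (drule (1) has_derivative_diff) (simp add: algebra_simps)

lemma wd_mult: "wd F p q z \<Longrightarrow> wd G p' q' z \<Longrightarrow> wd (\<lambda>z. F z * G z) (F z * p' + p * G z) (F z * q' + q * G z) z"
  unfolding wd_def by (drule (1) has_derivative_mult) (simp add: algebra_simps)

lemma wd_cmult: "wd F p q z \<Longrightarrow> wd (\<lambda>z. k * F z) (k * p) (k * q) z"
  using wd_mult[OF wd_const, of F p q z k] by simp

lemma wd_holo: "(F has_field_derivative d) (at z) \<Longrightarrow> wd F d 0 z"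
  by (simp add: wd_def has_field_derivative_def)

lemma wd_holoD: "wd F d 0 z \<Longrightarrow> (F has_field_derivative d) (at z)"
  by (simp add: wd_def has_field_derivative_def)

lemma wd_cnj: "wd F p q z \<Longrightarrow> wd (\<lambda>z. cnj (F z)) (cnj q) (cnj p) z"
  unfolding wd_def by (drule has_derivative_cnj) (simp add: algebra_simps)

lemma wd_chain: "wd F p q z \<Longrightarrow> (G has_field_derivative d) (at (F z)) \<Longrightarrow> wd (\<lambda>z. G (F z)) (d * p) (d * q) z"
  unfolding wd_def has_field_derivative_def
  by (drule (1) has_derivative_compose) (simp add: algebra_simps)

lemma wd_cong_open:
  assumes "wd F p q z" "open S" "z \<in> S" "\<And>w. w \<in> S \<Longrightarrow> F w = G w"
  shows "wd G p q z"
  using assms unfolding wd_def by (rule has_derivative_transform_within_open)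

lemma wd_unique:
  assumes "wd F p q z" "wd F p' q' z"
  shows "p = p'" "q = q'"
proof -
  have e: "p * h + q * cnj h = p' * h + q' * cnj h" for h
    using has_derivative_unique[OF assms[unfolded wd_def]] by meson
  from e[of 1] e[of \<i>] have 1: "p + q = p' + q'" and 2: "\<i> * (p - q) = \<i> * (p' - q')"
    by (simp_all add: algebra_simps)
  from 2 have "p - q = p' - q'" by simp
  with 1 have "(p + q) + (p - q) = (p' + q') + (p' - q')" "(p + q) - (p - q) = (p' + q') - (p' - q')" by simp_all
  then show "p = p'" "q = q'" by simp_all
qed

lemma wd_eq: "wd F p q z \<Longrightarrow> p = p' \<Longrightarrow> q = q' \<Longrightarrow> wd F p' q' z"
  by simp

section \<open>Wirtinger derivatives as operators on smooth functions\<close>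

definition smooth :: "(complex \<Rightarrow> complex) \<Rightarrow> bool" where
  "smooth F \<longleftrightarrow> (\<forall>k. C_k k (\<lambda>z. Re (F z)) \<and> C_k k (\<lambda>z. Im (F z)))"

definition dir :: "complex \<Rightarrow> (complex \<Rightarrow> complex) \<Rightarrow> complex \<Rightarrow> complex" where
  "dir v F z = Complex (fd (\<lambda>z. Re (F z)) v z) (fd (\<lambda>z. Im (F z)) v z)"

lemma smooth_dir: "smooth F \<Longrightarrow> smooth (dir v F)"
  unfolding smooth_def dir_def using C_k_SucD(2) by auto

lemma smooth_has_derivative: "smooth F \<Longrightarrow> (F has_derivative (\<lambda>v. dir v F z)) (at z)"
proof -
  assume F: "smooth F"
  then have "((\<lambda>z. complex_of_real (Re (F z)) + \<i> * complex_of_real (Im (F z))) has_derivative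
     (\<lambda>v. complex_of_real (fd (\<lambda>z. Re (F z)) v z) + \<i> * complex_of_real (fd (\<lambda>z. Im (F z)) v z))) (at z)"
    unfolding smooth_def
    by (intro has_derivative_add has_derivative_of_real has_derivative_mult_right C_k_SucD(1)[of 0]) blast+
  then show ?thesis by (simp add: dir_def complex_eq[symmetric] Complex_eq)
qed

lemma dir_unique: "(F has_derivative F') (at z) \<Longrightarrow> smooth F \<Longrightarrow> dir v F z = F' v"
  using has_derivative_unique[OF smooth_has_derivative] by metis

lemma dir_commute: "smooth F \<Longrightarrow> dir v (dir w F) z = dir w (dir v F) z"
proof -
  assume "smooth F"
  then have "C_k 2 (\<lambda>z. Re (F z))" "C_k 2 (\<lambda>z. Im (F z))" by (auto simp: smooth_def)
  then show ?thesis unfolding dir_def using fd_symmetric[where v=w and w=v and x=z] by simp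
qed

lemma smooth_cmult: "smooth F \<Longrightarrow> smooth (\<lambda>z. k * F z)"
  unfolding smooth_def by (auto intro!: C_k_add C_k_diff C_k_cmult)

lemma smooth_add: "smooth F \<Longrightarrow> smooth G \<Longrightarrow> smooth (\<lambda>z. F z + G z)"
  unfolding smooth_def by (auto intro!: C_k_add)

definition Dz :: "(complex \<Rightarrow> complex) \<Rightarrow> complex \<Rightarrow> complex" where
  "Dz F z = 1 / 2 * dir 1 F z + (- \<i> / 2) * dir \<i> F z"

definition Dzb :: "(complex \<Rightarrow> complex) \<Rightarrow> complex \<Rightarrow> complex" where
  "Dzb F z = 1 / 2 * dir 1 F z + (\<i> / 2) * dir \<i> F z"

lemma smooth_Dz: "smooth F \<Longrightarrow> smooth (Dz F)" and smooth_Dzb: "smooth F \<Longrightarrow> smooth (Dzb F)"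
  unfolding Dz_def[abs_def] Dzb_def[abs_def] by (intro smooth_add smooth_cmult smooth_dir; assumption)+

lemma wd_smooth: "smooth F \<Longrightarrow> wd F (Dz F z) (Dzb F z) z"
proof -
  assume F: "smooth F"
  have lin: "linear (\<lambda>v. dir v F z)" using has_derivative_linear[OF smooth_has_derivative[OF F]] .
  have "dir v F z = Dz F z * v + Dzb F z * cnj v" for v
  proof -
    have "dir v F z = dir (Re v *\<^sub>R 1 + Im v *\<^sub>R \<i>) F z"
      by (rule arg_cong[where f="\<lambda>v. dir v F z"]) (simp add: complex_eq_iff)
    also have "\<dots> = Re v *\<^sub>R dir 1 F z + Im v *\<^sub>R dir \<i> F z"
      using linear_add[OF lin] linear_scale[OF lin] by simp
    also have "\<dots> = 1 / 2 * ((dir 1 F z - \<i> * dir \<i> F z) * v + (dir 1 F z + \<i> * dir \<i> F z) * cnj v)"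
    proof -
      have "(dir 1 F z - \<i> * dir \<i> F z) * v + (dir 1 F z + \<i> * dir \<i> F z) * cnj v = 2 * (Re v *\<^sub>R dir 1 F z + Im v *\<^sub>R dir \<i> F z)"
        by (simp add: complex_eq_iff algebra_simps)
      then show ?thesis by (simp only:) (simp add: mult.commute)
    qed
    also have "\<dots> = Dz F z * v + Dzb F z * cnj v"
      by (simp add: Dz_def Dzb_def field_simps)
    finally show ?thesis .
  qed
  then have eq: "(\<lambda>v. dir v F z) = (\<lambda>h. Dz F z * h + Dzb F z * cnj h)" by (rule ext)
  show ?thesis using smooth_has_derivative[OF F, of z] unfolding wd_def eq .
qed

lemma dir_lincomb:
  assumes "smooth F" "smooth G"
  shows "dir v (\<lambda>z. k * F z + l * G z) z = k * dir v F z + l * dir v G z"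
  by (rule dir_unique) (intro has_derivative_add has_derivative_mult_right smooth_has_derivative smooth_add smooth_cmult assms)+

lemma Dz_Dzb_commute:
  assumes F: "smooth F" shows "Dzb (Dz F) z = Dz (Dzb F) z"
proof -
  have 1: "dir v (Dz F) z = 1 / 2 * dir v (dir 1 F) z + (- \<i> / 2) * dir v (dir \<i> F) z" for v
    unfolding Dz_def[abs_def] by (intro dir_lincomb smooth_dir F)
  have 2: "dir v (Dzb F) z = 1 / 2 * dir v (dir 1 F) z + (\<i> / 2) * dir v (dir \<i> F) z" for v
    unfolding Dzb_def[abs_def] by (intro dir_lincomb smooth_dir F)
  show ?thesis
    unfolding Dzb_def[of "Dz F"] Dz_def[of "Dzb F"] 1 2 dir_commute[OF F, of \<i> 1]
    by (simp add: algebra_simps)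
qed

text \<open>The mixed Wirtinger derivative is a quarter of the Laplacian, the cross terms cancelling
  by symmetry of second derivatives. For a real function the derivative in zbar is the conjugate of
  the one in z.\<close>

lemma Dzb_Dz_real:
  assumes f: "\<And>k. C_k k f"
  shows "smooth (\<lambda>z. complex_of_real (f z))"
    "Dzb (Dz (\<lambda>z. complex_of_real (f z))) z = complex_of_real (laplacian f z / 4)"
    "Dz (\<lambda>z. complex_of_real (f z)) z = Complex (fd f 1 z) (- fd f \<i> z) / 2"
    "Dzb (\<lambda>z. complex_of_real (f z)) z = cnj (Dz (\<lambda>z. complex_of_real (f z)) z)"
proof -
  let ?F = "\<lambda>z. complex_of_real (f z)"
  show F: "smooth ?F" using f by (auto simp: smooth_def)
  have d1: "dir v ?F = (\<lambda>z. complex_of_real (fd f v z))" for v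
    by (simp add: dir_def fun_eq_iff complex_eq_iff frechet_derivative_const)
  have d2: "dir w (dir v ?F) z = complex_of_real (fd (fd f v) w z)" for v w
    unfolding d1 by (simp add: dir_def complex_eq_iff frechet_derivative_const)
  show "Dz ?F z = Complex (fd f 1 z) (- fd f \<i> z) / 2"
    by (simp add: Dz_def d1 complex_eq_iff)
  show "Dzb ?F z = cnj (Dz ?F z)"
    by (simp add: Dz_def Dzb_def d1 complex_eq_iff)
  have 1: "dir v (Dz ?F) z = 1 / 2 * dir v (dir 1 ?F) z + (- \<i> / 2) * dir v (dir \<i> ?F) z" for v
    unfolding Dz_def[abs_def] by (intro dir_lincomb smooth_dir F)
  show "Dzb (Dz ?F) z = complex_of_real (laplacian f z / 4)"
    unfolding Dzb_def[of "Dz ?F"] 1 dir_commute[OF F, of \<i> 1] d2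
    using fd_symmetric[OF f, where v=1 and w=\<i> and x=z]
    by (simp add: laplacian_def Basis_complex_def complex_eq_iff)
qed

text \<open>Liouville's theorem for polynomial growth leaves an affine function, and growth of order
  |z|^(1/2) excludes a nonzero slope.\<close>

lemma quadratic_growth_const:
  fixes T :: "complex \<Rightarrow> complex"
  assumes hol: "T holomorphic_on UNIV" and C: "C \<ge> 0"
    and b: "\<And>z. cmod z \<ge> \<rho> \<Longrightarrow> cmod (T z) \<le> C * sqrt (3 + cmod z)"
  shows "T z = T 0"
proof -
  define r where "r = max \<rho> 3"
  have b1: "cmod (T z) \<le> (2 * C) * cmod z ^ 1" if z: "r \<le> cmod z" for z
  proof -
    have z3: "cmod z \<ge> 3" "cmod z \<ge> \<rho>" using z by (auto simp: r_def)
    have "3 + cmod z \<le> (2 * cmod z) * 1" using z3 by simp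
    also have "\<dots> \<le> (2 * cmod z) * (2 * cmod z)" using z3 by (intro mult_left_mono) auto
    finally have "sqrt (3 + cmod z) \<le> 2 * cmod z" by (intro real_le_lsqrt) (auto simp: power2_eq_square)
    then have "C * sqrt (3 + cmod z) \<le> C * (2 * cmod z)" using C by (intro mult_left_mono)
    then show ?thesis using b[OF z3(2)] by simp
  qed
  define T1 where "T1 = deriv T 0"
  have T: "T z = T 0 + T1 * z" for z
    using Liouville_polynomial[OF hol b1, where \<xi>=z] by (simp add: T1_def)
  have "T1 = 0"
  proof (rule ccontr)
    assume n: "T1 \<noteq> 0"
    define A where "A = cmod (T 0) + C"
    \<comment> \<open>With t = s^2 - 3 the square root is exactly \<open>s\<close>, and s >= 3 gives
      t >= s (s - 1). The growth bound at t then yields |T1| (s - 1) <= A, which the third lower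
      bound on \<open>s\<close> contradicts.\<close>
    define s where "s = max (max 3 (\<rho> + 3)) (A / cmod T1 + 2)"
    have s: "s \<ge> 3" "s \<ge> \<rho> + 3" "s \<ge> A / cmod T1 + 2" by (auto simp: s_def)
    define t where "t = s * s - 3"
    have ss: "s * 3 \<le> s * s" using s by (intro mult_left_mono) auto
    have t: "t \<ge> \<rho>" "t \<ge> 0" using s ss unfolding t_def by linarith+
    have t3: "s * (s - 1) \<le> t" using s ss unfolding t_def right_diff_distrib by linarith
    have st: "sqrt (3 + t) = s" using s by (simp add: t_def)
    have "cmod (T1 * complex_of_real t) \<le> cmod (T (complex_of_real t)) + cmod (T 0)"
      using norm_triangle_ineq4[of "T (complex_of_real t)" "T 0"] T[of "complex_of_real t"] by simp
    also have "\<dots> \<le> C * s + cmod (T 0)" using b[of "complex_of_real t"] t st by simp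
    also have "\<dots> \<le> C * s + cmod (T 0) * s" using s mult_left_mono[of 1 s "cmod (T 0)"] by simp
    finally have "cmod T1 * t \<le> A * s" using t by (simp add: norm_mult A_def algebra_simps)
    moreover have "cmod T1 * (s * (s - 1)) \<le> cmod T1 * t" using t3 by (intro mult_left_mono) auto
    ultimately have "(cmod T1 * (s - 1)) * s \<le> A * s" by (simp add: mult_ac)
    then have "cmod T1 * (s - 1) \<le> A" using s by (simp add: mult_le_cancel_right)
    moreover have "cmod T1 * (A / cmod T1 + 1) \<le> cmod T1 * (s - 1)" using s by (intro mult_left_mono) auto
    moreover have "cmod T1 * (A / cmod T1 + 1) = A + cmod T1" using n by (simp add: distrib_left)
    ultimately show False using n by (metis add_le_same_cancel1 order_trans norm_le_zero_iff)
  qed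
  then show ?thesis using T[of z] by simp
qed

context liouville
begin

definition "R z = a * z\<^sup>2 + b * z + c"
definition "R' z = 2 * a * z + b"
definition "psi z = complex_of_real (c0 + logpot z)"
definition "phi = Dz psi"
definition "phi' = Dz phi"
text \<open>Away from the zeros of R the function u = psi + ln |R|^2 solves the classical Liouville
  equation, for which u_zz - u_z^2 / 2 is holomorphic. In terms of psi this expression is T / R +
  R'' / R - (3/2) (R' / R)^2. Dropping the terms that depend on R alone and multiplying by R leaves
  T, which has no poles.\<close>

definition "T z = R z * phi' z - R z * (phi z)\<^sup>2 / 2 - R' z * phi z"

lemma R_deriv: "(R has_field_derivative R' z) (at z)"
  unfolding R_def[abs_def] R'_def by (auto intro!: derivative_eq_intros)

lemma R'_deriv: "(R' has_field_derivative 2 * a) (at z)"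
  unfolding R'_def[abs_def] by (auto intro!: derivative_eq_intros)

lemma C_k_c0_logpot: "C_k k (\<lambda>z. c0 + logpot z)"
  by (intro C_k_add C_k_const C_k_logpot)

lemma smooth_psi: "smooth psi" and smooth_phi: "smooth phi" and smooth_phi': "smooth phi'"
proof -
  show "smooth psi" unfolding psi_def[abs_def] by (rule Dzb_Dz_real(1)[OF C_k_c0_logpot])
  then show "smooth phi" unfolding phi_def by (rule smooth_Dz)
  then show "smooth phi'" unfolding phi'_def by (rule smooth_Dz)
qed

lemma wd_psi: "wd psi (phi z) (cnj (phi z)) z"
proof -
  have "Dzb psi z = cnj (phi z)"
    unfolding phi_def psi_def[abs_def] by (rule Dzb_Dz_real(4)[OF C_k_c0_logpot])
  then show ?thesis using wd_smooth[OF smooth_psi, of z] by (simp add: phi_def)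
qed

lemma g_complex: "complex_of_real (g z) = R z * cnj (R z) * exp (psi z)"
  unfolding g_eq[of z] R_def psi_def
  by (simp only: of_real_mult complex_norm_square exp_of_real)

lemma laplacian_c0_logpot: "laplacian (\<lambda>z. c0 + logpot z) z = - g z"
proof -
  have "fd (\<lambda>z. c0 + logpot z) v x = fd logpot v x" for v x
    by (rule fd_eq) (use has_derivative_add[OF has_derivative_const C_k_SucD(1)[OF C_k_logpot[of 1, unfolded One_nat_def]], of c0 x] in simp)
  then show ?thesis using laplacian_logpot[of z] by (simp add: laplacian_def)
qed

text \<open>The equation in complex form: the mixed derivative of psi is a quarter of its Laplacian,
  that is -g / 4.\<close>

lemma wd_phi: "wd phi (phi' z) (- complex_of_real (g z) / 4) z"
proof -
  have "Dzb phi z = complex_of_real (laplacian (\<lambda>z. c0 + logpot z) z / 4)"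
    unfolding phi_def psi_def[abs_def] by (rule Dzb_Dz_real(2)[OF C_k_c0_logpot])
  then show ?thesis using wd_smooth[OF smooth_phi, of z] by (simp add: phi'_def laplacian_c0_logpot)
qed

lemma wd_g:
  "wd (\<lambda>z. complex_of_real (g z)) (R' z * cnj (R z) * exp (psi z) + complex_of_real (g z) * phi z)
     (R z * cnj (R' z) * exp (psi z) + complex_of_real (g z) * cnj (phi z)) z"
proof -
  have "wd (\<lambda>z. R z * cnj (R z) * exp (psi z))
     ((R z * cnj (R z)) * (exp (psi z) * phi z) + (R z * 0 + R' z * cnj (R z)) * exp (psi z))
     ((R z * cnj (R z)) * (exp (psi z) * cnj (phi z)) + (R z * cnj (R' z) + 0 * cnj (R z)) * exp (psi z)) z"
    using wd_mult[OF wd_mult[OF wd_holo[OF R_deriv] wd_cnj[OF wd_holo[OF R_deriv]]] wd_chain[OF wd_psi DERIV_exp], of z] by simp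
  then show ?thesis unfolding g_complex by (rule wd_eq) (simp_all add: algebra_simps)
qed

lemma wd_phi': "wd phi' (Dz phi' z) (- (R' z * cnj (R z) * exp (psi z) + complex_of_real (g z) * phi z) / 4) z"
proof -
  have "Dzb phi = (\<lambda>z. (- 1 / 4) * complex_of_real (g z))"
    using wd_unique(2)[OF wd_smooth[OF smooth_phi] wd_phi] by auto
  moreover have quarter: "(- 1 / 4) * y = - y / 4" for y :: complex by simp
  ultimately have "Dz (Dzb phi) z = (- 1 / 4) * (R' z * cnj (R z) * exp (psi z) + complex_of_real (g z) * phi z)"
    using wd_unique(1)[OF wd_smooth[OF smooth_Dzb[OF smooth_phi], of z]] wd_cmult[OF wd_g, of "- 1 / 4" z] by metis
  then have "Dzb phi' z = - (R' z * cnj (R z) * exp (psi z) + complex_of_real (g z) * phi z) / 4"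
    unfolding phi'_def Dz_Dzb_commute[OF smooth_phi] by (simp only: quarter)
  then show ?thesis using wd_smooth[OF smooth_phi', of z] by (simp only:)
qed

text \<open>In the zbar derivative, R phi'_zbar gives -(R' g + R g phi) / 4, while the other two
  terms give R phi g / 4 and R' g / 4, so all cancels. The z-derivative of \<open>g\<close> is kept
  as R' conj(R) e^psi + g phi, without division by R, so that the zeros of R need no separate
  treatment.\<close>

lemma T_holomorphic: "T holomorphic_on UNIV"
proof -
  have "\<exists>d. (T has_field_derivative d) (at z)" for z
  proof -
    define G where "G = complex_of_real (g z)"
    have gR: "R z * (cnj (R z) * exp (psi z)) = G" using g_complex[of z] by (simp add: G_def mult.assoc)
    define q where "q = R z * (- (R' z * cnj (R z) * exp (psi z) + G * phi z) / 4) + 0 * phi' z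
       - 1 / 2 * (R z * (phi z * (- G / 4) + (- G / 4) * phi z) + 0 * (phi z * phi z))
       - (R' z * (- G / 4) + 0 * phi z)"
    have "\<exists>p. wd (\<lambda>z. R z * phi' z - 1 / 2 * (R z * (phi z * phi z)) - R' z * phi z) p q z"
      unfolding q_def G_def
      by (rule exI, rule wd_diff[OF wd_diff[OF wd_mult[OF wd_holo[OF R_deriv] wd_phi']
           wd_cmult[OF wd_mult[OF wd_holo[OF R_deriv] wd_mult[OF wd_phi wd_phi]]]] wd_mult[OF wd_holo[OF R'_deriv] wd_phi]])
    moreover have "q = 0"
    proof -
      define e4 where "e4 = - (cnj (R z) * exp (psi z)) / 4"
      have X2: "- G / 4 = R z * e4" unfolding gR[symmetric] e4_def by simp
      have "- (R' z * cnj (R z) * exp (psi z) + G * phi z) / 4 = R' z * e4 + (- G / 4) * phi z"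
        unfolding e4_def by (simp add: add_divide_distrib diff_divide_distrib)
      then have X1: "- (R' z * cnj (R z) * exp (psi z) + G * phi z) / 4 = R' z * e4 + R z * e4 * phi z"
        unfolding X2 .
      have half: "1 / 2 * (R z * (x * y + y * x)) = R z * (x * y)" for x y by simp
      show ?thesis unfolding q_def X1 unfolding X2 mult_zero_left add_0_right half by (simp add: algebra_simps)
    qed
    moreover have "(\<lambda>z. R z * phi' z - 1 / 2 * (R z * (phi z * phi z)) - R' z * phi z) = T"
      by (simp add: T_def[abs_def] power2_eq_square)
    ultimately show ?thesis using wd_holoD by metis
  qed
  then show ?thesis
    by (meson field_differentiable_at_within field_differentiable_def holomorphic_on_def)
qed

lemma phi_decay:
  obtains C where "C > 0" "\<And>z. cmod (phi z) \<le> C * exp (- (4 / 5) * lg z)"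
proof -
  obtain C where C: "C > 0" "\<And>z v. \<bar>fd logpot v z\<bar> \<le> norm v * (C * exp (- (4 / 5) * lg z))"
    using fd_logpot_decay by blast
  show thesis
  proof (rule that[OF C(1)])
    fix z
    have "fd (\<lambda>z. c0 + logpot z) v z = fd logpot v z" for v
      by (rule fd_eq) (use has_derivative_add[OF has_derivative_const C_k_SucD(1)[OF C_k_logpot[of 1, unfolded One_nat_def]], of c0 z] in simp)
    then have "phi z = Complex (fd logpot 1 z) (- fd logpot \<i> z) / 2"
      unfolding phi_def psi_def[abs_def] using Dzb_Dz_real(3)[OF C_k_c0_logpot, of z] by simp
    then have "cmod (phi z) = cmod (Complex (fd logpot 1 z) (- fd logpot \<i> z)) / 2" by (simp only: norm_divide norm_numeral)
    also have "\<dots> \<le> (\<bar>fd logpot 1 z\<bar> + \<bar>fd logpot \<i> z\<bar>) / 2"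
      using cmod_le[of "Complex (fd logpot 1 z) (- fd logpot \<i> z)"] by simp
    also have "\<dots> \<le> C * exp (- (4 / 5) * lg z)"
      using C(2)[where v=1 and z=z] C(2)[where v=\<i> and z=z] by simp
    finally show "cmod (phi z) \<le> C * exp (- (4 / 5) * lg z)" .
  qed
qed

end

context liouville
begin

lemma R'_upper: "cmod (R' z) \<le> (2 * cmod a + cmod b) * exp (lg z)"
proof -
  have "cmod (R' z) \<le> 2 * cmod a * cmod z + cmod b * 1"
    unfolding R'_def using norm_triangle_ineq[of "2 * a * z" b] by (simp add: norm_mult)
  also have "\<dots> \<le> 2 * cmod a * (3 + cmod z) + cmod b * (3 + cmod z)"
    by (intro add_mono mult_left_mono) auto
  finally show ?thesis by (simp add: exp_lg distrib_right)
qed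

text \<open>On a disc of radius comparable to \<open>|z0|\<close> the function \<open>T / R\<close> has a primitive that differs from
  \<open>phi\<close> by little, hence is small; the Cauchy estimate then bounds \<open>T\<close>.\<close>

lemma T_growth:
  obtains C \<rho> where "C \<ge> 0" "\<And>z. cmod z \<ge> \<rho> \<Longrightarrow> cmod (T z) \<le> C * sqrt (3 + cmod z)"
proof -
  obtain Cp where Cp: "Cp > 0" "\<And>z. cmod (phi z) \<le> Cp * exp (- (4 / 5) * lg z)" using phi_decay by blast
  obtain Cg where Cg: "Cg > 0" "\<And>z. g z \<le> Cg * exp (- (9 / 5) * lg z)" using g_decay by blast
  obtain CR where CR: "CR > 0" "\<And>z. cmod (R z) \<le> CR * exp (2 * lg z)"
    unfolding R_def using quadratic_upper by blast
  obtain \<rho> where \<rho>: "\<rho> \<ge> 1" "\<And>z. cmod z \<ge> \<rho> \<Longrightarrow> cmod (R z) \<ge> cmod a / 2 * (cmod z)\<^sup>2"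
    unfolding R_def using quadratic_lower[OF a_nz] by blast
  \<comment> \<open>For |z| >= 1 one has 3 + |z| <= 4 |z|, so the lower bound |a| |z|^2 / 2 on |R|
    becomes |a| (3 + |z|)^2 / 32.\<close>
  define K where "K = (2 * cmod a + cmod b) * 32 / cmod a"
  have K: "K \<ge> 0" by (simp add: K_def)
  \<comment> \<open>The summands belong to phi^2 / 2, (R' / R) phi and g / 4, each of order
    |z0|^(-8/5) or smaller on the disc.\<close>
  define C3 where "C3 = 2 * Cp * Cp + 4 * K * Cp + Cg"
  have C3: "C3 \<ge> 0" using Cp Cg K by (simp add: C3_def)
  define C4 where "C4 = 3 * Cp + C3"
  have C4: "C4 \<ge> 0" using C3 Cp by (simp add: C4_def)
  have main: "cmod (T z0) \<le> (CR * 16 * C4) * sqrt (3 + cmod z0)" if z0: "cmod z0 \<ge> 2 * \<rho>" for z0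
  proof -
    define L where "L = lg z0"
    have L0: "L \<ge> 0" unfolding L_def by (rule lg_nonneg)
    define r where "r = cmod z0 / 2"
    have r: "r > 0" using z0 \<rho>(1) unfolding r_def by linarith
    have rL: "r \<le> exp L" "exp L / 16 \<le> r / 2"
      using z0 \<rho> by (simp_all add: r_def L_def exp_lg)
    have inb: "cmod z \<ge> \<rho>" "R z \<noteq> 0" "lg z \<ge> L - ln 2" "cmod (R' z / R z) \<le> 2 * K * exp (- L)"
      if z: "z \<in> ball z0 r" for z
    proof -
      have z1: "cmod z \<ge> cmod z0 / 2"
        using z norm_triangle_ineq2[of z0 z] by (simp add: dist_norm r_def)
      then show z\<rho>: "cmod z \<ge> \<rho>" using z0 by simp
      then have zp: "cmod z \<ge> 1" using \<rho> by simp
      have "0 < cmod a / 2 * (cmod z)\<^sup>2" using a_nz zp by (intro mult_pos_pos zero_less_power) auto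
      then show Rz: "R z \<noteq> 0" using \<rho>(2)[OF z\<rho>] by auto
      have "ln (3 + cmod z0) \<le> ln ((3 + cmod z) * 2)" using z1 by (intro ln_mono) (auto simp: add_pos_nonneg)
      also have "\<dots> = lg z + ln 2" unfolding lg_def by (intro ln_mult_pos) (auto simp: add_pos_nonneg)
      finally show l: "lg z \<ge> L - ln 2" by (simp add: L_def lg_def)
      have "exp (lg z) \<le> 4 * cmod z" using zp by (simp add: exp_lg)
      then have "exp (lg z) * exp (lg z) \<le> (4 * cmod z) * (4 * cmod z)" by (intro mult_mono) auto
      then have "cmod a / 32 * (exp (lg z) * exp (lg z)) \<le> cmod a / 32 * ((4 * cmod z) * (4 * cmod z))"
        by (intro mult_left_mono) auto
      also have "\<dots> = cmod a / 2 * (cmod z)\<^sup>2" by (simp add: power2_eq_square)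
      also have "\<dots> \<le> cmod (R z)" by (rule \<rho>(2)[OF z\<rho>])
      finally have low: "cmod a / 32 * (exp (lg z) * exp (lg z)) \<le> cmod (R z)" .
      have "cmod (R' z) / cmod (R z) \<le> ((2 * cmod a + cmod b) * exp (lg z)) / (cmod a / 32 * (exp (lg z) * exp (lg z)))"
        using R'_upper[of z] low a_nz by (intro frac_le) auto
      also have "\<dots> = K * exp (- lg z)" using a_nz by (simp add: K_def exp_minus field_simps)
      also have "\<dots> \<le> K * (2 * exp (- L))"
      proof (intro mult_left_mono K)
        have "exp (- lg z) \<le> exp (ln 2 + - L)" using l by simp
        also have "\<dots> = 2 * exp (- L)" by (simp only: exp_add) simp
        finally show "exp (- lg z) \<le> 2 * exp (- L)" .
      qed
      finally show "cmod (R' z / R z) \<le> 2 * K * exp (- L)" by (simp add: norm_divide)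
    qed
    have phib: "cmod (phi z) \<le> 2 * Cp * exp (- (4 / 5) * L)" if z: "z \<in> ball z0 r" for z
    proof -
      have "exp (- (4 / 5) * lg z) \<le> exp (ln 2 + - (4 / 5) * L)"
      proof -
        have "(0::real) \<le> ln 2" by simp
        then show ?thesis using inb(3)[OF z] unfolding exp_le_cancel_iff by linarith
      qed
      also have "\<dots> = 2 * exp (- (4 / 5) * L)" by (simp only: exp_add) simp
      finally have "Cp * exp (- (4 / 5) * lg z) \<le> Cp * (2 * exp (- (4 / 5) * L))" using Cp by (intro mult_left_mono) auto
      then show ?thesis using Cp(2)[of z] by (simp add: mult_ac)
    qed
    have gb: "g z \<le> 4 * Cg * exp (- (8 / 5) * L)" if z: "z \<in> ball z0 r" for z
    proof -
      have "exp (- (9 / 5) * lg z) \<le> exp (ln 2 + ln 2 + - (8 / 5) * L)"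
      proof -
        have "(0::real) \<le> ln 2" by simp
        then show ?thesis using inb(3)[OF z] L0 unfolding exp_le_cancel_iff by linarith
      qed
      also have "\<dots> = 4 * exp (- (8 / 5) * L)" by (simp only: exp_add) simp
      finally have "Cg * exp (- (9 / 5) * lg z) \<le> Cg * (4 * exp (- (8 / 5) * L))" using Cg by (intro mult_left_mono) auto
      then show ?thesis using Cg(2)[of z] by (simp add: mult_ac)
    qed
    have "(\<lambda>z. T z / R z) holomorphic_on ball z0 r"
    proof (rule holomorphic_on_divide)
      show "T holomorphic_on ball z0 r" using T_holomorphic by (rule holomorphic_on_subset) auto
      show "R holomorphic_on ball z0 r"
        using R_deriv by (meson field_differentiable_at_within field_differentiable_def holomorphic_on_def)
    qed (use inb(2) in auto)
    then obtain F where F: "\<And>z. z \<in> ball z0 r \<Longrightarrow> (F has_field_derivative T z / R z) (at z within ball z0 r)"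
      using holomorphic_convex_primitive'[OF convex_ball open_ball] by blast
    have F': "(F has_field_derivative T z / R z) (at z)" if "z \<in> ball z0 r" for z
      using F[OF that] at_within_open[OF that open_ball] by simp
    define G where "G z = F z - F z0" for z
    have G: "(G has_field_derivative T z / R z) (at z)" if "z \<in> ball z0 r" for z
      unfolding G_def using F'[OF that] by (auto intro!: derivative_eq_intros)
    \<comment> \<open>Since T / R = phi' - S, subtracting the primitive \<open>G\<close> of T / R
      from \<open>phi\<close> cancels the uncontrolled derivative phi'. The difference has Wirtinger
      derivatives S and -g / 4, both already known to be small.\<close>
    define S where "S z = (phi z)\<^sup>2 / 2 + R' z / R z * phi z" for z
    have wdD: "wd (\<lambda>z. phi z - G z) (S z) (- complex_of_real (g z) / 4) z" if z: "z \<in> ball z0 r" for z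
    proof -
      have "T z / R z = phi' z - S z" using inb(2)[OF z]
        by (simp add: T_def S_def field_simps power2_eq_square)
      then show ?thesis using wd_diff[OF wd_phi wd_holo[OF G[OF z]]] by simp
    qed
    have Sb: "cmod (S z) + g z / 4 \<le> C3 * exp (- (8 / 5) * L)" if z: "z \<in> ball z0 r" for z
    proof -
      have p0: "0 \<le> 2 * Cp * exp (- (4 / 5) * L)" using Cp by simp
      have "cmod (S z) \<le> cmod (phi z) * cmod (phi z) / 2 + cmod (R' z / R z) * cmod (phi z)"
        unfolding S_def using norm_triangle_ineq[of "(phi z)\<^sup>2 / 2" "R' z / R z * phi z"]
        by (simp add: norm_mult norm_divide power2_eq_square)
      also have "\<dots> \<le> (2 * Cp * exp (- (4 / 5) * L)) * (2 * Cp * exp (- (4 / 5) * L)) / 2 + (2 * K * exp (- L)) * (2 * Cp * exp (- (4 / 5) * L))"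
        using p0 K by (intro add_mono divide_right_mono mult_mono phib[OF z] inb(4)[OF z]) auto
      also have "\<dots> = 2 * Cp * Cp * (exp (- (4 / 5) * L) * exp (- (4 / 5) * L)) + 4 * K * Cp * (exp (- L) * exp (- (4 / 5) * L))"
        by (simp add: algebra_simps)
      also have "exp (- (4 / 5) * L) * exp (- (4 / 5) * L) = exp (- (8 / 5) * L)" by (simp add: exp_add[symmetric])
      also have "4 * K * Cp * (exp (- L) * exp (- (4 / 5) * L)) \<le> 4 * K * Cp * exp (- (8 / 5) * L)"
        using K Cp L0 by (intro mult_left_mono) (auto simp: exp_add[symmetric])
      finally have "cmod (S z) \<le> 2 * Cp * Cp * exp (- (8 / 5) * L) + 4 * K * Cp * exp (- (8 / 5) * L)" by simp
      then show ?thesis using gb[OF z] by (simp add: C3_def algebra_simps)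
    qed
    have z0b: "z0 \<in> ball z0 r" using r by simp
    have Gb: "cmod (G z) \<le> C4 * exp (- (3 / 5) * L)" if z: "z \<in> ball z0 (r)" for z
    proof -
      have "cmod ((phi z - G z) - (phi z0 - G z0)) \<le> C3 * exp (- (8 / 5) * L) * cmod (z - z0)"
      proof (rule differentiable_bound[OF convex_ball _ _ z z0b])
        fix w assume w: "w \<in> ball z0 r"
        show "((\<lambda>z. phi z - G z) has_derivative (\<lambda>h. S w * h + (- complex_of_real (g w) / 4) * cnj h)) (at w within ball z0 r)"
          using wdD[OF w] unfolding wd_def by (rule has_derivative_at_withinI)
        show "onorm (\<lambda>h. S w * h + (- complex_of_real (g w) / 4) * cnj h) \<le> C3 * exp (- (8 / 5) * L)"
        proof (rule onorm_le)
          fix h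
          have "cmod (S w * h + (- complex_of_real (g w) / 4) * cnj h) \<le> cmod (S w * h) + cmod ((- complex_of_real (g w) / 4) * cnj h)"
            by (rule norm_triangle_ineq)
          also have "\<dots> = (cmod (S w) + g w / 4) * cmod h"
            using g_nonneg[of w] by (simp add: norm_mult norm_divide distrib_right)
          also have "\<dots> \<le> C3 * exp (- (8 / 5) * L) * cmod h" by (intro mult_right_mono Sb w) auto
          finally show "cmod (S w * h + (- complex_of_real (g w) / 4) * cnj h) \<le> C3 * exp (- (8 / 5) * L) * cmod h" .
        qed
      qed
      also have "\<dots> \<le> C3 * exp (- (8 / 5) * L) * exp L"
        using z rL(1) C3 by (intro mult_left_mono) (auto simp: dist_norm norm_minus_commute)
      also have "\<dots> = C3 * exp (- (3 / 5) * L)" by (simp add: exp_add[symmetric])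
      finally have 1: "cmod ((phi z - G z) - (phi z0 - G z0)) \<le> C3 * exp (- (3 / 5) * L)" .
      have "cmod (G z) \<le> cmod ((phi z - G z) - (phi z0 - G z0)) + cmod (phi z) + cmod (phi z0)"
        using norm_triangle_ineq4[of "phi z - phi z0" "(phi z - G z) - (phi z0 - G z0)"] norm_triangle_ineq4[of "phi z" "phi z0"]
        by (simp add: G_def)
      moreover have "cmod (phi z0) \<le> Cp * exp (- (4 / 5) * L)" using Cp(2)[of z0] by (simp add: L_def)
      moreover have "exp (- (4 / 5) * L) \<le> exp (- (3 / 5) * L)" using L0 by simp
      then have "3 * Cp * exp (- (4 / 5) * L) \<le> 3 * Cp * exp (- (3 / 5) * L)" using Cp by (intro mult_left_mono) auto
      moreover have "C4 * exp (- (3 / 5) * L) = 3 * Cp * exp (- (3 / 5) * L) + C3 * exp (- (3 / 5) * L)"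
        by (simp add: C4_def distrib_right)
      ultimately show ?thesis using 1 phib[OF z] by linarith
    qed
    have Ghol: "G holomorphic_on ball z0 r"
      using G by (meson field_differentiable_at_within field_differentiable_def holomorphic_on_def)
    have "norm ((deriv ^^ 1) G z0) \<le> fact 1 * (C4 * exp (- (3 / 5) * L)) / (r / 2) ^ 1"
    proof (rule Cauchy_inequality)
      show "G holomorphic_on ball z0 (r / 2)" using Ghol r by (rule_tac holomorphic_on_subset) auto
      show "continuous_on (cball z0 (r / 2)) G"
        using holomorphic_on_imp_continuous_on[OF Ghol] r by (rule_tac continuous_on_subset) auto
      show "cmod (G x) \<le> C4 * exp (- (3 / 5) * L)" if "cmod (z0 - x) = r / 2" for x
        using that r by (intro Gb) (simp add: dist_norm)
    qed (use r in auto)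
    moreover have "deriv G z0 = T z0 / R z0" by (rule DERIV_imp_deriv[OF G[OF z0b]])
    ultimately have "cmod (T z0 / R z0) \<le> C4 * exp (- (3 / 5) * L) / (r / 2)" by simp
    also have "\<dots> \<le> C4 * exp (- (3 / 5) * L) / (exp L / 16)"
      using rL(2) C4 r by (intro divide_left_mono) auto
    also have "\<dots> = 16 * C4 * exp (- (8 / 5) * L)"
    proof -
      have "exp (- (3 / 5) * L) / exp L = exp (- (8 / 5) * L)" by (simp add: exp_diff[symmetric])
      then show ?thesis by (simp add: field_simps)
    qed
    finally have q: "cmod (T z0 / R z0) \<le> 16 * C4 * exp (- (8 / 5) * L)" .
    have "cmod (T z0) = cmod (R z0) * cmod (T z0 / R z0)" using inb(2)[OF z0b] by (simp add: norm_divide)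
    also have "\<dots> \<le> (CR * exp (2 * L)) * (16 * C4 * exp (- (8 / 5) * L))"
      using CR q by (intro mult_mono) (auto simp: L_def)
    also have "\<dots> = (CR * 16 * C4) * (exp (2 * L) * exp (- (8 / 5) * L))" by (simp only: mult_ac)
    also have "exp (2 * L) * exp (- (8 / 5) * L) = exp (2 / 5 * L)" by (simp add: exp_add[symmetric])
    also have "(CR * 16 * C4) * exp (2 / 5 * L) \<le> (CR * 16 * C4) * exp (L / 2)"
      using CR C4 L0 by (intro mult_left_mono) auto
    also have "exp (L / 2) = sqrt (3 + cmod z0)"
    proof -
      have "exp (L / 2) ^ 2 = 3 + cmod z0" using exp_lg[of z0] by (simp add: L_def exp_double[symmetric])
      then show ?thesis by (metis exp_ge_zero real_sqrt_unique)
    qed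
    finally show ?thesis .
  qed
  show thesis
  proof (rule that[of "CR * 16 * C4" "2 * \<rho>"])
    show "0 \<le> CR * 16 * C4" using CR C4 by simp
  qed (rule main)
qed

lemma T_const: "T z = T 0"
proof -
  obtain C \<rho> where "C \<ge> 0" "\<And>z. cmod z \<ge> \<rho> \<Longrightarrow> cmod (T z) \<le> C * sqrt (3 + cmod z)" using T_growth by blast
  then show ?thesis by (rule quadratic_growth_const[OF T_holomorphic])
qed

end

section \<open>The linear equation for the exponential\<close>

context liouville
begin

text \<open>\<open>y1\<close> and \<open>y2\<close> are y_z and y_zz, written out by the product
  rule in the form the Wirtinger rules produce.\<close>

definition "y z = exp (- 1 / 2 * psi z)"
definition "y1 z = - 1 / 2 * (phi z * y z)"
definition "y2 z = - 1 / 2 * (phi z * y1 z + phi' z * y z)"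

lemma wd_y: "wd y (y1 z) (cnj (y1 z)) z"
proof -
  have "wd (\<lambda>z. exp (- 1 / 2 * psi z)) (exp (- 1 / 2 * psi z) * (- 1 / 2 * phi z)) (exp (- 1 / 2 * psi z) * (- 1 / 2 * cnj (phi z))) z"
    by (rule wd_chain[OF wd_cmult[OF wd_psi] DERIV_exp])
  moreover have "cnj (exp (- 1 / 2 * psi z)) = exp (- 1 / 2 * psi z)"
    by (simp add: psi_def exp_cnj)
  ultimately show ?thesis unfolding y_def[abs_def] y1_def by (rule_tac wd_eq) (simp_all add: mult_ac)
qed

lemma y_real: "y z = complex_of_real (exp (- (c0 + logpot z) / 2))"
proof -
  have "- 1 / 2 * complex_of_real s = complex_of_real (- s / 2)" for s by simp
  then show ?thesis unfolding y_def psi_def by (simp only: exp_of_real)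
qed

lemma cnj_y: "cnj (y z) = y z" and y_nz: "y z \<noteq> 0"
  by (simp_all add: y_real)

lemma wd_y1: "wd y1 (y2 z) (- 1 / 2 * (phi z * cnj (y1 z) + (- complex_of_real (g z) / 4) * y z)) z"
  unfolding y1_def[abs_def] y2_def
  by (rule wd_cmult[OF wd_mult[OF wd_phi wd_y, unfolded y1_def]])

text \<open>As y_z = -phi y / 2 and y_zz = (phi^2 / 4 - phi' / 2) y, the left side is (T 0 - T z) y
  / 2, and T is constant.\<close>

lemma ode: "R z * y2 z - R' z * y1 z + T 0 / 2 * y z = 0"
proof -
  have "T 0 = R z * phi' z - R z * (phi z)\<^sup>2 / 2 - R' z * phi z" using T_const[of z] by (simp add: T_def)
  then show ?thesis unfolding y2_def y1_def by (simp only:) (simp add: power2_eq_square field_simps)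
qed

lemma y2_wd: "\<exists>y3 q. wd y2 y3 q z"
  unfolding y2_def[abs_def]
  by (intro exI, rule wd_cmult[OF wd_add[OF wd_mult[OF wd_phi wd_y1] wd_mult[OF wd_phi' wd_y]]])

text \<open>Because the coefficient of y_z is -R', the two terms R' y_zz cancel on differentiation.
  At a zero of R what remains is a condition on y_z alone.\<close>

lemma ode_derivative: "\<exists>y3. R z * y3 = (2 * a - T 0 / 2) * y1 z"
proof -
  obtain y3 q where y3: "wd y2 y3 q z" using y2_wd by blast
  have "wd (\<lambda>z. R z * y2 z - R' z * y1 z + T 0 / 2 * y z)
    ((R z * y3 + R' z * y2 z) - (R' z * y2 z + 2 * a * y1 z) + T 0 / 2 * y1 z)
    ((R z * q + 0 * y2 z) - (R' z * (- 1 / 2 * (phi z * cnj (y1 z) + (- complex_of_real (g z) / 4) * y z)) + 0 * y1 z) + T 0 / 2 * cnj (y1 z)) z"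
    by (rule wd_add[OF wd_diff[OF wd_mult[OF wd_holo[OF R_deriv] y3] wd_mult[OF wd_holo[OF R'_deriv] wd_y1]] wd_cmult[OF wd_y]])
  moreover have "wd (\<lambda>z. R z * y2 z - R' z * y1 z + T 0 / 2 * y z) 0 0 z"
    unfolding ode by (rule wd_const)
  ultimately have "(R z * y3 + R' z * y2 z) - (R' z * y2 z + 2 * a * y1 z) + T 0 / 2 * y1 z = 0"
    by (rule wd_unique(1))
  then have "R z * y3 = (2 * a - T 0 / 2) * y1 z" by (simp add: algebra_simps)
  then show ?thesis by blast
qed

text \<open>Evaluating the equation and its derivative at a zero of \<open>R\<close> quantises the constant \<open>T\<close>.\<close>

lemma T_cases: "T 0 = 0 \<or> (T 0 = 4 * a \<and> c \<noteq> b\<^sup>2 / (4 * a))"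
proof -
  have key: "T 0 = 0 \<or> (T 0 = 4 * a \<and> R' z \<noteq> 0)" if z: "R z = 0" for z
  proof -
    have 1: "R' z * y1 z = T 0 / 2 * y z" using ode[of z] z by simp
    have 2: "(2 * a - T 0 / 2) * y1 z = 0" using ode_derivative[of z] z by auto
    show ?thesis
    proof (cases "y1 z = 0 \<or> R' z = 0")
      case True
      then have "T 0 / 2 * y z = 0" using 1 by auto
      then show ?thesis using y_nz[of z] by simp
    next
      case False
      then have "2 * a - T 0 / 2 = 0" using 2 by simp
      then have "T 0 = 4 * a" by (simp add: field_simps)
      then show ?thesis using False by simp
    qed
  qed
  define z0 where "z0 = (- b + csqrt (b\<^sup>2 - 4 * a * c)) / (2 * a)"
  have s: "(2 * a * z0 + b)\<^sup>2 = b\<^sup>2 - 4 * a * c" using a_nz by (simp add: z0_def)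
  have "4 * a * R z0 = (2 * a * z0 + b)\<^sup>2 - (b\<^sup>2 - 4 * a * c)"
    by (simp add: R_def power2_eq_square algebra_simps)
  then have R0: "R z0 = 0" using s a_nz by simp
  \<comment> \<open>The square of R'(z0) is the discriminant, so a zero with nonvanishing derivative
    excludes a double root.\<close>
  have "c \<noteq> b\<^sup>2 / (4 * a)" if "R' z0 \<noteq> 0"
  proof
    assume "c = b\<^sup>2 / (4 * a)"
    then have "b\<^sup>2 - 4 * a * c = 0" using a_nz by simp
    then have "(R' z0)\<^sup>2 = 0" using s by (simp add: R'_def)
    then show False using that by simp
  qed
  then show ?thesis using key[OF R0] by blast
qed

section \<open>The linear equation away from the zeros of R\<close>

lemma finite_zeros: "finite {z. R z = 0}"
proof -
  have "{z. R z = 0} = {z. poly [:c, b, a:] z = 0}"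
    by (auto simp: R_def power2_eq_square algebra_simps)
  then show ?thesis using poly_roots_finite[of "[:c, b, a:]"] a_nz by simp
qed

definition "regular = - {z. R z = 0}"

lemma regular: "open regular" "connected regular" "closure regular = UNIV" "z \<in> regular \<longleftrightarrow> R z \<noteq> 0"
proof -
  show "open regular" unfolding regular_def using finite_imp_closed[OF finite_zeros] by (rule open_Compl)
  show "connected regular"
    unfolding regular_def Compl_eq_Diff_UNIV
    by (intro connected_open_delete_finite finite_zeros) auto
  show "closure regular = UNIV"
    unfolding regular_def closure_complement using empty_interior_finite[OF finite_zeros] by simp
  show "z \<in> regular \<longleftrightarrow> R z \<noteq> 0" by (simp add: regular_def)
qed

text \<open>Abel's identity: the Wronskian of two solutions is a constant multiple of R, its
  quotient by R having derivative 0 on a connected set.\<close>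

lemma holomorphic_solution:
  assumes Q: "\<And>z. (Q has_field_derivative q1 z) (at z)" "\<And>z. (q1 has_field_derivative q2 z) (at z)"
    and A: "\<And>z. z \<in> regular \<Longrightarrow> (A has_field_derivative A1 z) (at z)" "\<And>z. z \<in> regular \<Longrightarrow> (A1 has_field_derivative A2 z) (at z)"
    and odeQ: "\<And>z. R z * q2 z - R' z * q1 z + t * Q z = 0"
    and odeA: "\<And>z. z \<in> regular \<Longrightarrow> R z * A2 z - R' z * A1 z + t * A z = 0"
  shows "\<exists>k. \<forall>z\<in>regular. A1 z * Q z - A z * q1 z = k * R z"
proof -
  have "((\<lambda>z. (A1 z * Q z - A z * q1 z) / R z) has_field_derivative 0) (at z)" if z: "z \<in> regular" for z
  proof -
    have Rz: "R z \<noteq> 0" using z regular(4) by simp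
    have "((\<lambda>z. (A1 z * Q z - A z * q1 z) / R z) has_field_derivative
      ((((A2 z * Q z + q1 z * A1 z) - (A1 z * q1 z + q2 z * A z)) * R z - (A1 z * Q z - A z * q1 z) * R' z) / (R z * R z))) (at z)"
      by (intro DERIV_divide DERIV_diff DERIV_mult Q A z R_deriv Rz)
    moreover have "((A2 z * Q z + q1 z * A1 z) - (A1 z * q1 z + q2 z * A z)) * R z - (A1 z * Q z - A z * q1 z) * R' z
       = Q z * (R z * A2 z - R' z * A1 z + t * A z) - A z * (R z * q2 z - R' z * q1 z + t * Q z)"
      by (simp add: algebra_simps)
    ultimately show ?thesis using odeQ[of z] odeA[OF z] by simp
  qed
  then have "(\<lambda>z. (A1 z * Q z - A z * q1 z) / R z) constant_on regular"
    by (rule has_field_derivative_0_imp_constant_on[OF _ regular(2,1)])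
  then obtain k where k: "\<forall>z\<in>regular. (A1 z * Q z - A z * q1 z) / R z = k"
    unfolding constant_on_def by (rule exE)
  have "\<forall>z\<in>regular. A1 z * Q z - A z * q1 z = k * R z"
  proof
    fix z assume z: "z \<in> regular"
    then show "A1 z * Q z - A z * q1 z = k * R z" using k[rule_format, OF z] regular(4)[of z] by (simp add: divide_eq_eq)
  qed
  then show ?thesis by blast
qed

text \<open>In the variable z, \<open>y\<close> is a combination of P and Q whose coefficients
  depend on zbar only. As \<open>y\<close> is real, conjugation gives y = conj(P) A + conj(Q) B with
  A and B holomorphic. The equation in z now passes to A and B, which are therefore combinations of
  P and Q with constant coefficients. The form extends over the zeros of R by continuity, and the
  nonlinear equation for psi fixes its determinant.\<close>

lemma hermitian_form:
  assumes P: "\<And>z. (P has_field_derivative p1 z) (at z)" "\<And>z. (p1 has_field_derivative p2 z) (at z)"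
    and Q: "\<And>z. (Q has_field_derivative q1 z) (at z)" "\<And>z. (q1 has_field_derivative q2 z) (at z)"
    and odeP: "\<And>z. R z * p2 z - R' z * p1 z + T 0 / 2 * P z = 0"
    and odeQ: "\<And>z. R z * q2 z - R' z * q1 z + T 0 / 2 * Q z = 0"
    and W: "\<And>z. p1 z * Q z - P z * q1 z = R z"
  obtains \<kappa> \<rho> :: real and \<nu> :: complex where "\<kappa> * \<rho> - (cmod \<nu>)\<^sup>2 = 1 / 8"
    "\<And>z. exp (- (c0 + logpot z) / 2) = \<kappa> * (cmod (P z))\<^sup>2 + \<rho> * (cmod (Q z))\<^sup>2 + 2 * Re (\<nu> * P z * cnj (Q z))"
proof -
  \<comment> \<open>Cramer's rule for y = P X + Q Y and y_z = P' X + Q' Y, with Wronskian R.\<close>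
  define X where "X z = (y1 z * Q z - y z * q1 z) / R z" for z
  define Y where "Y z = (p1 z * y z - P z * y1 z) / R z" for z
  have Rinv: "((\<lambda>z. 1 / R z) has_field_derivative - R' z / (R z * R z)) (at z)" if "z \<in> regular" for z
    using that regular(4) by (auto intro!: derivative_eq_intros R_deriv simp: power2_eq_square)
  define yq where "yq z = - 1 / 2 * (phi z * cnj (y1 z) + (- complex_of_real (g z) / 4) * y z)" for z
  have wy1: "wd y1 (y2 z) (yq z) z" for z unfolding yq_def by (rule wd_y1)
  have wX: "\<exists>q. wd X 0 q z" if z: "z \<in> regular" for z
  proof -
    have Rz: "R z \<noteq> 0" using z regular(4) by simp
    have "\<exists>q. wd (\<lambda>z. (y1 z * Q z - y z * q1 z) * (1 / R z))
      ((y1 z * Q z - y z * q1 z) * (- R' z / (R z * R z)) + ((y1 z * q1 z + y2 z * Q z) - (y z * q2 z + y1 z * q1 z)) * (1 / R z)) q z"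
      by (rule exI, rule wd_mult[OF wd_diff[OF wd_mult[OF wy1 wd_holo[OF Q(1)]] wd_mult[OF wd_y wd_holo[OF Q(2)]]] wd_holo[OF Rinv[OF z]]])
    moreover have "(y1 z * Q z - y z * q1 z) * (- R' z / (R z * R z)) + ((y1 z * q1 z + y2 z * Q z) - (y z * q2 z + y1 z * q1 z)) * (1 / R z)
      = (Q z * (R z * y2 z - R' z * y1 z + T 0 / 2 * y z) - y z * (R z * q2 z - R' z * q1 z + T 0 / 2 * Q z)) / (R z * R z)"
      using Rz by (simp add: field_simps)
    ultimately show ?thesis unfolding X_def using ode[of z] odeQ[of z] by simp
  qed
  have wY: "\<exists>q. wd Y 0 q z" if z: "z \<in> regular" for z
  proof -
    have Rz: "R z \<noteq> 0" using z regular(4) by simp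
    have "\<exists>q. wd (\<lambda>z. (p1 z * y z - P z * y1 z) * (1 / R z))
      ((p1 z * y z - P z * y1 z) * (- R' z / (R z * R z)) + ((p1 z * y1 z + p2 z * y z) - (P z * y2 z + p1 z * y1 z)) * (1 / R z)) q z"
      by (rule exI, rule wd_mult[OF wd_diff[OF wd_mult[OF wd_holo[OF P(2)] wd_y] wd_mult[OF wd_holo[OF P(1)] wy1]] wd_holo[OF Rinv[OF z]]])
    moreover have "(p1 z * y z - P z * y1 z) * (- R' z / (R z * R z)) + ((p1 z * y1 z + p2 z * y z) - (P z * y2 z + p1 z * y1 z)) * (1 / R z)
      = (y z * (R z * p2 z - R' z * p1 z + T 0 / 2 * P z) - P z * (R z * y2 z - R' z * y1 z + T 0 / 2 * y z)) / (R z * R z)"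
      using Rz by (simp add: field_simps)
    ultimately show ?thesis unfolding Y_def using ode[of z] odeP[of z] by simp
  qed
  have yXY: "y z = P z * X z + Q z * Y z" if z: "z \<in> regular" for z
  proof -
    have "P z * (y1 z * Q z - y z * q1 z) + Q z * (p1 z * y z - P z * y1 z) = y z * (p1 z * Q z - P z * q1 z)"
      by (simp add: algebra_simps)
    then have "(P z * (y1 z * Q z - y z * q1 z) + Q z * (p1 z * y z - P z * y1 z)) / R z = y z"
      using z regular(4) unfolding W by simp
    then show ?thesis unfolding X_def Y_def by (simp add: add_divide_distrib)
  qed
  define A where "A z = cnj (X z)" for z
  define B where "B z = cnj (Y z)" for z
  have "\<exists>d. (A has_field_derivative d) (at z)" "\<exists>d. (B has_field_derivative d) (at z)" if z: "z \<in> regular" for z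
    unfolding A_def[abs_def] B_def[abs_def] using wX[OF z] wY[OF z] wd_cnj wd_holoD by (metis complex_cnj_zero)+
  then have AB: "A holomorphic_on regular" "B holomorphic_on regular"
    unfolding holomorphic_on_def by (meson field_differentiable_at_within field_differentiable_def)+
  have dA: "(A has_field_derivative deriv A z) (at z)" "(deriv A has_field_derivative deriv (deriv A) z) (at z)"
    and dB: "(B has_field_derivative deriv B z) (at z)" "(deriv B has_field_derivative deriv (deriv B) z) (at z)"
    if z: "z \<in> regular" for z
    using AB holomorphic_deriv[OF AB(1) regular(1)] holomorphic_deriv[OF AB(2) regular(1)] regular(1) z
    by (auto intro: holomorphic_derivI)
  have yAB: "y z = cnj (P z) * A z + cnj (Q z) * B z" if z: "z \<in> regular" for z
  proof -
    have "cnj (y z) = cnj (P z * X z + Q z * Y z)" using yXY[OF z] by simp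
    then show ?thesis by (simp add: cnj_y A_def B_def)
  qed
  have y1AB: "y1 z = cnj (P z) * deriv A z + cnj (Q z) * deriv B z" if z: "z \<in> regular" for z
  proof -
    have "wd (\<lambda>z. cnj (P z) * A z + cnj (Q z) * B z)
      ((cnj (P z) * deriv A z + cnj 0 * A z) + (cnj (Q z) * deriv B z + cnj 0 * B z))
      ((cnj (P z) * 0 + cnj (p1 z) * A z) + (cnj (Q z) * 0 + cnj (q1 z) * B z)) z"
      by (rule wd_add[OF wd_mult[OF wd_cnj[OF wd_holo[OF P(1)]] wd_holo[OF dA(1)[OF z]]] wd_mult[OF wd_cnj[OF wd_holo[OF Q(1)]] wd_holo[OF dB(1)[OF z]]]])
    from wd_unique(1)[OF wd_y wd_cong_open[OF this regular(1) z yAB[symmetric]]] show ?thesis by simp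
  qed
  have y2AB: "y2 z = cnj (P z) * deriv (deriv A) z + cnj (Q z) * deriv (deriv B) z" if z: "z \<in> regular" for z
  proof -
    have "wd (\<lambda>z. cnj (P z) * deriv A z + cnj (Q z) * deriv B z)
      ((cnj (P z) * deriv (deriv A) z + cnj 0 * deriv A z) + (cnj (Q z) * deriv (deriv B) z + cnj 0 * deriv B z))
      ((cnj (P z) * 0 + cnj (p1 z) * deriv A z) + (cnj (Q z) * 0 + cnj (q1 z) * deriv B z)) z"
      by (rule wd_add[OF wd_mult[OF wd_cnj[OF wd_holo[OF P(1)]] wd_holo[OF dA(2)[OF z]]] wd_mult[OF wd_cnj[OF wd_holo[OF Q(1)]] wd_holo[OF dB(2)[OF z]]]])
    from wd_unique(1)[OF wd_y1 wd_cong_open[OF this regular(1) z y1AB[symmetric]]] show ?thesis by simp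
  qed
  \<comment> \<open>For the z-derivative conj(P) and conj(Q) are constants, so the equation for
    \<open>y\<close> becomes conj(P) LA + conj(Q) LB = 0. Its zbar derivative is a second linear
    relation, and the determinant of the two is conj(R), which does not vanish here.\<close>
  define LA where "LA z = R z * deriv (deriv A) z - R' z * deriv A z + T 0 / 2 * A z" for z
  define LB where "LB z = R z * deriv (deriv B) z - R' z * deriv B z + T 0 / 2 * B z" for z
  have L1: "cnj (P z) * LA z + cnj (Q z) * LB z = 0" if z: "z \<in> regular" for z
    using ode[of z] unfolding yAB[OF z] y1AB[OF z] y2AB[OF z] LA_def LB_def by (simp add: algebra_simps)
  have "LA holomorphic_on regular" "LB holomorphic_on regular"
    unfolding LA_def[abs_def] LB_def[abs_def] R_def R'_def
    by (intro holomorphic_intros AB holomorphic_deriv regular(1))+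
  then have dL: "(LA has_field_derivative deriv LA z) (at z)" "(LB has_field_derivative deriv LB z) (at z)" if "z \<in> regular" for z
    using that regular(1) by (auto intro: holomorphic_derivI)
  have L2: "cnj (p1 z) * LA z + cnj (q1 z) * LB z = 0" if z: "z \<in> regular" for z
  proof -
    have "wd (\<lambda>z. cnj (P z) * LA z + cnj (Q z) * LB z)
      ((cnj (P z) * deriv LA z + cnj 0 * LA z) + (cnj (Q z) * deriv LB z + cnj 0 * LB z))
      ((cnj (P z) * 0 + cnj (p1 z) * LA z) + (cnj (Q z) * 0 + cnj (q1 z) * LB z)) z"
      by (rule wd_add[OF wd_mult[OF wd_cnj[OF wd_holo[OF P(1)]] wd_holo[OF dL(1)[OF z]]] wd_mult[OF wd_cnj[OF wd_holo[OF Q(1)]] wd_holo[OF dL(2)[OF z]]]])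
    from wd_unique(2)[OF wd_cong_open[OF this regular(1) z L1] wd_const] show ?thesis by simp
  qed
  have L0: "LA z = 0" "LB z = 0" if z: "z \<in> regular" for z
  proof -
    have cW: "cnj (p1 z) * cnj (Q z) - cnj (P z) * cnj (q1 z) = cnj (R z)"
      using arg_cong[OF W[of z], of cnj] by simp
    have nz: "cnj (R z) \<noteq> 0" using z regular(4) by simp
    have "(cnj (p1 z) * cnj (Q z) - cnj (P z) * cnj (q1 z)) * LA z
      = cnj (Q z) * (cnj (p1 z) * LA z + cnj (q1 z) * LB z) - cnj (q1 z) * (cnj (P z) * LA z + cnj (Q z) * LB z)"
      by (simp add: algebra_simps)
    then show "LA z = 0" unfolding cW L1[OF z] L2[OF z] using nz by simp
    have "(cnj (p1 z) * cnj (Q z) - cnj (P z) * cnj (q1 z)) * LB z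
      = cnj (p1 z) * (cnj (P z) * LA z + cnj (Q z) * LB z) - cnj (P z) * (cnj (p1 z) * LA z + cnj (q1 z) * LB z)"
      by (simp add: algebra_simps)
    then show "LB z = 0" unfolding cW L1[OF z] L2[OF z] using nz by simp
  qed
  have span: "\<exists>k l. \<forall>z\<in>regular. F z = k * P z + l * Q z"
    if F: "\<And>z. z \<in> regular \<Longrightarrow> (F has_field_derivative F1 z) (at z)" "\<And>z. z \<in> regular \<Longrightarrow> (F1 has_field_derivative F2 z) (at z)"
      "\<And>z. z \<in> regular \<Longrightarrow> R z * F2 z - R' z * F1 z + T 0 / 2 * F z = 0" for F F1 F2
  proof -
    obtain k where k: "\<And>z. z \<in> regular \<Longrightarrow> F1 z * Q z - F z * q1 z = k * R z"
      using holomorphic_solution[OF Q F(1,2) odeQ F(3)] by blast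
    obtain l where l: "\<And>z. z \<in> regular \<Longrightarrow> F1 z * P z - F z * p1 z = l * R z"
      using holomorphic_solution[OF P F(1,2) odeP F(3)] by blast
    have "F z = k * P z + (- l) * Q z" if z: "z \<in> regular" for z
    proof -
      have "F z * (p1 z * Q z - P z * q1 z) = P z * (F1 z * Q z - F z * q1 z) - Q z * (F1 z * P z - F z * p1 z)"
        by (simp add: algebra_simps)
      then have "F z * R z = (k * P z + (- l) * Q z) * R z" unfolding W k[OF z] l[OF z] by (simp add: algebra_simps)
      then show ?thesis using z regular(4) by simp
    qed
    then show ?thesis by blast
  qed
  obtain \<alpha> \<beta> where ab: "\<And>z. z \<in> regular \<Longrightarrow> A z = \<alpha> * P z + \<beta> * Q z"
    using span[OF dA] L0(1) unfolding LA_def by blast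
  obtain \<gamma> \<delta> where gd: "\<And>z. z \<in> regular \<Longrightarrow> B z = \<gamma> * P z + \<delta> * Q z"
    using span[OF dB] L0(2) unfolding LB_def by blast
  \<comment> \<open>The coefficient matrix is replaced by its hermitian part. This changes nothing
    in the real part of the form, and \<open>y\<close> is real.\<close>
  define \<kappa> \<rho> \<nu> where "\<kappa> = Re \<alpha>" and "\<rho> = Re \<delta>" and "\<nu> = (cnj \<beta> + \<gamma>) / 2"
  define H where "H z = \<kappa> * (cmod (P z))\<^sup>2 + \<rho> * (cmod (Q z))\<^sup>2 + 2 * Re (\<nu> * P z * cnj (Q z))" for z
  have form_reg: "exp (- (c0 + logpot z) / 2) = H z" if z: "z \<in> regular" for z
  proof -
    have "exp (- (c0 + logpot z) / 2) = Re (y z)" by (simp add: y_real)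
    also have "\<dots> = Re (cnj (P z) * (\<alpha> * P z + \<beta> * Q z) + cnj (Q z) * (\<gamma> * P z + \<delta> * Q z))"
      using yAB[OF z] ab[OF z] gd[OF z] by simp
    also have "\<dots> = H z"
      unfolding H_def \<kappa>_def \<rho>_def \<nu>_def cmod_power2 by (simp add: power2_eq_square field_simps)
    finally show ?thesis .
  qed
  have Pc: "continuous_on UNIV P" "continuous_on UNIV Q"
    using P(1) Q(1) by (meson DERIV_isCont continuous_at_imp_continuous_on)+
  have form: "exp (- (c0 + logpot z) / 2) = H z" for z
  proof -
    have cont: "continuous_on (closure regular) (\<lambda>z. exp (- (c0 + logpot z) / 2) - H z)"
      unfolding regular(3) H_def using Pc C_k_imp_continuous[OF C_k_logpot[of 0]] by (intro continuous_intros) auto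
    have "exp (- (c0 + logpot z) / 2) - H z = 0"
      by (rule continuous_constant_on_closure[OF cont]) (use form_reg regular(3) in auto)
    then show ?thesis by simp
  qed
  have yH: "y z = complex_of_real \<kappa> * (P z * cnj (P z)) + complex_of_real \<rho> * (Q z * cnj (Q z)) + (\<nu> * (P z * cnj (Q z)) + cnj \<nu> * (Q z * cnj (P z)))" for z
    unfolding y_real form H_def cmod_power2
    by (simp add: complex_eq_iff power2_eq_square algebra_simps)
  obtain z0 where z0: "z0 \<in> regular" using regular(3) by fastforce
  define Y1 where "Y1 z = complex_of_real \<kappa> * (p1 z * cnj (P z)) + complex_of_real \<rho> * (q1 z * cnj (Q z)) + (\<nu> * (p1 z * cnj (Q z)) + cnj \<nu> * (q1 z * cnj (P z)))" for z
  have y1H: "y1 z = Y1 z" for z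
  proof -
    have "\<exists>q. wd (\<lambda>z. complex_of_real \<kappa> * (P z * cnj (P z)) + complex_of_real \<rho> * (Q z * cnj (Q z)) + (\<nu> * (P z * cnj (Q z)) + cnj \<nu> * (Q z * cnj (P z))))
       (complex_of_real \<kappa> * (P z * cnj 0 + p1 z * cnj (P z)) + complex_of_real \<rho> * (Q z * cnj 0 + q1 z * cnj (Q z))
         + (\<nu> * (P z * cnj 0 + p1 z * cnj (Q z)) + cnj \<nu> * (Q z * cnj 0 + q1 z * cnj (P z)))) q z"
      by (rule exI, rule wd_add[OF wd_add[OF wd_cmult[OF wd_mult[OF wd_holo[OF P(1)] wd_cnj[OF wd_holo[OF P(1)]]]]
            wd_cmult[OF wd_mult[OF wd_holo[OF Q(1)] wd_cnj[OF wd_holo[OF Q(1)]]]]]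
          wd_add[OF wd_cmult[OF wd_mult[OF wd_holo[OF P(1)] wd_cnj[OF wd_holo[OF Q(1)]]]]
            wd_cmult[OF wd_mult[OF wd_holo[OF Q(1)] wd_cnj[OF wd_holo[OF P(1)]]]]]])
    then show ?thesis unfolding yH[symmetric] Y1_def using wd_unique(1)[OF wd_y] by force
  qed
  define Yq where "Yq z = complex_of_real \<kappa> * (p1 z * cnj (p1 z)) + complex_of_real \<rho> * (q1 z * cnj (q1 z)) + (\<nu> * (p1 z * cnj (q1 z)) + cnj \<nu> * (q1 z * cnj (p1 z)))" for z
  have yqH: "yq z = Yq z" for z
  proof -
    have "\<exists>p. wd Y1 p
       (complex_of_real \<kappa> * (p1 z * cnj (p1 z) + 0 * cnj (P z)) + complex_of_real \<rho> * (q1 z * cnj (q1 z) + 0 * cnj (Q z))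
         + (\<nu> * (p1 z * cnj (q1 z) + 0 * cnj (Q z)) + cnj \<nu> * (q1 z * cnj (p1 z) + 0 * cnj (P z)))) z"
      unfolding Y1_def[abs_def]
      by (rule exI, rule wd_add[OF wd_add[OF wd_cmult[OF wd_mult[OF wd_holo[OF P(2)] wd_cnj[OF wd_holo[OF P(1)]]]]
            wd_cmult[OF wd_mult[OF wd_holo[OF Q(2)] wd_cnj[OF wd_holo[OF Q(1)]]]]]
          wd_add[OF wd_cmult[OF wd_mult[OF wd_holo[OF P(2)] wd_cnj[OF wd_holo[OF Q(1)]]]]
            wd_cmult[OF wd_mult[OF wd_holo[OF Q(2)] wd_cnj[OF wd_holo[OF P(1)]]]]]])
    moreover have "Y1 = y1" using y1H by auto
    ultimately show ?thesis unfolding Yq_def using wd_unique(2)[OF wy1] by force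
  qed
  \<comment> \<open>Here \<open>yq\<close> is the mixed derivative of \<open>y\<close>. For y =
    e^(-psi/2) the equation reads y y_zzbar - |y_z|^2 = g y^2 / 8, and y^2 e^psi = 1.\<close>
  have lio: "y z * yq z - y1 z * cnj (y1 z) = R z * cnj (R z) / 8" for z
  proof -
    have e: "y z * y z * exp (psi z) = 1" by (simp add: y_def exp_add[symmetric])
    have "y z * yq z - y1 z * cnj (y1 z) = complex_of_real (g z) * (y z * y z) / 8"
      by (simp add: yq_def y1_def field_simps)
    also have "\<dots> = R z * cnj (R z) * (y z * y z * exp (psi z)) / 8" unfolding g_complex by (simp add: mult_ac)
    finally show ?thesis unfolding e by simp
  qed
  \<comment> \<open>For a hermitian form in P and Q the same expression is its determinant times the
    squared modulus of the Wronskian. Comparison at one point off the zeros of R gives the value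
    1/8.\<close>
  have "y z0 * yq z0 - y1 z0 * cnj (y1 z0) = (complex_of_real \<kappa> * complex_of_real \<rho> - \<nu> * cnj \<nu>) * ((p1 z0 * Q z0 - P z0 * q1 z0) * cnj (p1 z0 * Q z0 - P z0 * q1 z0))"
    unfolding yqH y1H Y1_def Yq_def yH by (simp add: algebra_simps)
  then have "R z0 * cnj (R z0) / 8 = (complex_of_real \<kappa> * complex_of_real \<rho> - \<nu> * cnj \<nu>) * (R z0 * cnj (R z0))"
    unfolding lio W .
  moreover have "R z0 * cnj (R z0) \<noteq> 0" using z0 regular(4) by simp
  ultimately have "complex_of_real \<kappa> * complex_of_real \<rho> - \<nu> * cnj \<nu> = 1 / 8"
    by (metis mult_cancel_right times_divide_eq_left mult_1)
  moreover have "complex_of_real \<kappa> * complex_of_real \<rho> - \<nu> * cnj \<nu> = complex_of_real (\<kappa> * \<rho> - (cmod \<nu>)\<^sup>2)"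
    unfolding of_real_diff complex_norm_square by simp
  ultimately have "complex_of_real (\<kappa> * \<rho> - (cmod \<nu>)\<^sup>2) = complex_of_real (1 / 8)" by simp
  then have "\<kappa> * \<rho> - (cmod \<nu>)\<^sup>2 = 1 / 8" by (simp only: of_real_eq_iff)
  then show thesis using that[of \<kappa> \<rho> \<nu>] form unfolding H_def by blast
qed

end

section \<open>Completing the square and the two polynomial bases\<close>

context liouville
begin

text \<open>Completing the square in P splits off a multiple of |Q|^2 governed by the determinant.
  Since that is 1/8, the form scaled by sqrt 8 has determinant 1, and the second square is |Q / l|^2
  with the same \<open>l\<close> that multiplies P.\<close>

lemma sum_of_squares_form:
  assumes P: "\<And>z. (P has_field_derivative p1 z) (at z)" "\<And>z. (p1 has_field_derivative p2 z) (at z)"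
    and Q: "\<And>z. (Q has_field_derivative q1 z) (at z)" "\<And>z. (q1 has_field_derivative q2 z) (at z)"
    and odeP: "\<And>z. R z * p2 z - R' z * p1 z + T 0 / 2 * P z = 0"
    and odeQ: "\<And>z. R z * q2 z - R' z * q1 z + T 0 / 2 * Q z = 0"
    and W: "\<And>z. p1 z * Q z - P z * q1 z = R z"
  shows "\<exists>l m. l \<noteq> 0 \<and> (\<forall>z. c0 + logpot z =
     ln 8 - 2 * ln ((cmod (l * P z + m * Q z))\<^sup>2 + (cmod (1 / l * Q z))\<^sup>2))"
proof -
  obtain k r :: real and n :: complex where det: "k * r - (cmod n)\<^sup>2 = 1 / 8"
    and form: "\<And>z. exp (- (c0 + logpot z) / 2) = k * (cmod (P z))\<^sup>2 + r * (cmod (Q z))\<^sup>2 + 2 * Re (n * P z * cnj (Q z))"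
    by (rule hermitian_form[OF assms]) (rule that)
  have expand: "(cmod (x * p + cnj u * q))\<^sup>2 = (cmod x)\<^sup>2 * (cmod p)\<^sup>2 + (cmod u)\<^sup>2 * (cmod q)\<^sup>2 + 2 * Re (x * u * p * cnj q)"
    for x u p q :: complex
  proof -
    have "complex_of_real ((cmod (x * p + cnj u * q))\<^sup>2) =
       (x * cnj x) * (p * cnj p) + (u * cnj u) * (q * cnj q) + (x * u * p * cnj q + cnj (x * u * p * cnj q))"
      by (simp only: complex_norm_square) (simp add: algebra_simps)
    also have "\<dots> = complex_of_real ((cmod x)\<^sup>2 * (cmod p)\<^sup>2 + (cmod u)\<^sup>2 * (cmod q)\<^sup>2 + 2 * Re (x * u * p * cnj q))"
      by (simp only: of_real_add of_real_mult complex_norm_square complex_add_cnj of_real_numeral)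
    finally show ?thesis by (simp only: of_real_eq_iff)
  qed
  have kr: "k * r > 0" using det zero_le_power2[of "cmod n"] by linarith
  \<comment> \<open>\<open>k\<close> times the positive value of the form is a square plus the
    determinant times |Q|^2, hence nonnegative; k r > 0 excludes k = 0.\<close>
  have "k > 0"
  proof -
    have "k * exp (- (c0 + logpot 0) / 2) = (cmod (complex_of_real k * P 0 + cnj n * Q 0))\<^sup>2 + (k * r - (cmod n)\<^sup>2) * (cmod (Q 0))\<^sup>2"
      unfolding form expand by (simp add: power2_eq_square algebra_simps)
    also have "\<dots> \<ge> 0" unfolding det by simp
    finally have "k \<ge> 0" by (simp add: zero_le_mult_iff)
    then show ?thesis using kr by (cases "k = 0") auto
  qed
  \<comment> \<open>This scaling turns the determinant 1/8 into 1 and accounts for the ln 8 = 2 ln s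
    in the formula.\<close>
  define s where "s = sqrt (8::real)"
  have s: "s > 0" "s * s = 8" by (simp_all add: s_def)
  define x where "x = sqrt (s * k)"
  have x: "x > 0" "x\<^sup>2 = s * k" using s \<open>k > 0\<close> by (simp_all add: x_def)
  define l where "l = complex_of_real x"
  have l: "l \<noteq> 0" "cmod l = x" using x by (simp_all add: l_def)
  define u where "u = complex_of_real s * n / l"
  have lu: "l * u = complex_of_real s * n" using l by (simp add: u_def)
  have cu: "(cmod u)\<^sup>2 * (s * k) = 8 * (cmod n)\<^sup>2"
  proof -
    have "(cmod (l * u))\<^sup>2 = (s * cmod n)\<^sup>2" unfolding lu using s by (simp add: norm_mult)
    moreover have "(cmod (l * u))\<^sup>2 = (cmod u)\<^sup>2 * (s * k)"
      by (simp only: norm_mult power_mult_distrib l(2) x(2) mult.commute)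
    moreover have "(s * cmod n)\<^sup>2 = 8 * (cmod n)\<^sup>2"
      by (simp only: power_mult_distrib power2_eq_square[of s] s(2))
    ultimately show ?thesis by simp
  qed
  have coeff: "(cmod u)\<^sup>2 + 1 / x\<^sup>2 = s * r"
  proof -
    have sk: "s * k > 0" using s \<open>k > 0\<close> by simp
    have "((cmod u)\<^sup>2 + 1 / x\<^sup>2) * (s * k) = 8 * (cmod n)\<^sup>2 + 1"
      unfolding x(2) distrib_right cu using s(1) \<open>k > 0\<close> by simp
    also have "\<dots> = 8 * (k * r)" using det by simp
    also have "\<dots> = (s * r) * (s * k)" unfolding s(2)[symmetric] by (simp add: mult_ac)
    finally show ?thesis using s(1) \<open>k > 0\<close> by simp
  qed
  have sum: "(cmod (l * P z + cnj u * Q z))\<^sup>2 + (cmod (1 / l * Q z))\<^sup>2 = s * exp (- (c0 + logpot z) / 2)" for z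
  proof -
    have "(cmod (1 / l * Q z))\<^sup>2 = 1 / x\<^sup>2 * (cmod (Q z))\<^sup>2"
      using l by (simp add: norm_mult norm_divide power_mult_distrib power_divide)
    then have "(cmod (l * P z + cnj u * Q z))\<^sup>2 + (cmod (1 / l * Q z))\<^sup>2
      = x\<^sup>2 * (cmod (P z))\<^sup>2 + ((cmod u)\<^sup>2 + 1 / x\<^sup>2) * (cmod (Q z))\<^sup>2 + 2 * Re (l * u * P z * cnj (Q z))"
      unfolding expand l(2) by (simp add: distrib_right)
    also have "\<dots> = s * (k * (cmod (P z))\<^sup>2 + r * (cmod (Q z))\<^sup>2 + 2 * Re (n * P z * cnj (Q z)))"
      unfolding coeff unfolding x(2) lu by (simp add: algebra_simps)
    finally show ?thesis unfolding form .
  qed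
  have "c0 + logpot z = ln 8 - 2 * ln ((cmod (l * P z + cnj u * Q z))\<^sup>2 + (cmod (1 / l * Q z))\<^sup>2)" for z
  proof -
    have "ln 8 = 2 * ln s" using s(1) by (simp add: s(2)[symmetric] ln_mult_pos)
    then show ?thesis unfolding sum using s(1) by (simp add: ln_mult_pos field_simps)
  qed
  then show ?thesis using l(1) by blast
qed

text \<open>For T = 0 the equation is solved by 1 and the primitive of R, for T = 4 a by R' / 2 and
  z^2 - c / a. The bases are normalised to have Wronskian exactly R, as the determinant computation
  requires.\<close>

lemma classification:
  "\<exists>(P0 :: complex poly) (Q0 :: complex poly) (P :: complex poly) (Q :: complex poly)
            (lam :: complex) (mu :: complex).
           lam \<noteq> 0
         \<and> ((P0 = [:0, c, b / 2, a / 3:] \<and> Q0 = 1)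
            \<or> (c \<noteq> b^2 / (4 * a) \<and> P0 = [:- c / a, 0, 1:] \<and> Q0 = [:b / 2, a:]))
         \<and> P = smult lam P0 + smult mu Q0
         \<and> Q = smult (1 / lam) Q0
         \<and> (\<forall>z. c0 + logpot z = ln 8 - 2 * ln ((cmod (poly P z))^2 + (cmod (poly Q z))^2))"
  (is "\<exists>P0 Q0 P Q lam mu. ?G P0 Q0 P Q lam mu")
proof -
  have conclude: "\<exists>P0 Q0 P Q lam mu. ?G P0 Q0 P Q lam mu"
    if PQ: "(P0 = [:0, c, b / 2, a / 3:] \<and> Q0 = 1) \<or> (c \<noteq> b^2 / (4 * a) \<and> P0 = [:- c / a, 0, 1:] \<and> Q0 = [:b / 2, a:])"
      and odeP: "\<And>z. R z * poly (pderiv (pderiv P0)) z - R' z * poly (pderiv P0) z + T 0 / 2 * poly P0 z = 0"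
      and odeQ: "\<And>z. R z * poly (pderiv (pderiv Q0)) z - R' z * poly (pderiv Q0) z + T 0 / 2 * poly Q0 z = 0"
      and W: "\<And>z. poly (pderiv P0) z * poly Q0 z - poly P0 z * poly (pderiv Q0) z = R z"
    for P0 Q0
  proof -
    obtain l m where lm: "l \<noteq> 0" "\<And>z. c0 + logpot z =
       ln 8 - 2 * ln ((cmod (l * poly P0 z + m * poly Q0 z))\<^sup>2 + (cmod (1 / l * poly Q0 z))\<^sup>2)"
      using sum_of_squares_form[OF poly_DERIV poly_DERIV poly_DERIV poly_DERIV odeP odeQ W] by blast
    have "?G P0 Q0 (smult l P0 + smult m Q0) (smult (1 / l) Q0) l m"
      using PQ lm by (simp only: poly_add poly_smult simp_thms)
    then show ?thesis by blast
  qed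
  from T_cases show ?thesis
  proof
    assume T: "T 0 = 0"
    show ?thesis
    proof (rule conclude[of "[:0, c, b / 2, a / 3:]" 1])
      show "R z * poly (pderiv (pderiv [:0, c, b / 2, a / 3:])) z - R' z * poly (pderiv [:0, c, b / 2, a / 3:]) z
        + T 0 / 2 * poly [:0, c, b / 2, a / 3:] z = 0" for z
        by (simp add: T R_def R'_def pderiv_pCons power2_eq_square algebra_simps)
      show "poly (pderiv [:0, c, b / 2, a / 3:]) z * poly 1 z - poly [:0, c, b / 2, a / 3:] z * poly (pderiv 1) z = R z" for z
        by (simp add: R_def pderiv_pCons power2_eq_square algebra_simps)
    qed (simp_all add: T)
  next
    assume T: "T 0 = 4 * a \<and> c \<noteq> b\<^sup>2 / (4 * a)"
    show ?thesis
    proof (rule conclude[of "[:- c / a, 0, 1:]" "[:b / 2, a:]"])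
      show "R z * poly (pderiv (pderiv [:- c / a, 0, 1:])) z - R' z * poly (pderiv [:- c / a, 0, 1:]) z
        + T 0 / 2 * poly [:- c / a, 0, 1:] z = 0" for z
        using T a_nz by (simp add: R_def R'_def pderiv_pCons power2_eq_square field_simps)
      show "R z * poly (pderiv (pderiv [:b / 2, a:])) z - R' z * poly (pderiv [:b / 2, a:]) z
        + T 0 / 2 * poly [:b / 2, a:] z = 0" for z
        using T a_nz by (simp add: R_def R'_def pderiv_pCons power2_eq_square field_simps)
      show "poly (pderiv [:- c / a, 0, 1:]) z * poly [:b / 2, a:] z - poly [:- c / a, 0, 1:] z * poly (pderiv [:b / 2, a:]) z = R z" for z
        using a_nz by (simp add: R_def pderiv_pCons power2_eq_square field_simps)
    qed (use T in simp)
  qed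
qed

end

section \<open>From the weak formulation to a pointwise equation\<close>

lemma L1_loc_measurable:
  assumes "L1_loc u" shows "u \<in> borel_measurable lebesgue"
proof (rule borel_measurable_LIMSEQ_real)
  fix n :: nat
  have "u absolutely_integrable_on cball 0 (real n)" using assms by (simp add: L1_loc_def)
  then show "(\<lambda>x. indicat_real (cball 0 (real n)) x *\<^sub>R u x) \<in> borel_measurable lebesgue"
    unfolding set_integrable_def by (rule borel_measurable_integrable)
next
  fix x :: 'a
  obtain N where N: "norm x \<le> real N" using real_arch_simple by blast
  have "\<forall>\<^sub>F n in sequentially. u x = indicat_real (cball 0 (real n)) x *\<^sub>R u x"
    using eventually_ge_at_top[of N] by eventually_elim (use N in auto)
  then show "(\<lambda>n. indicat_real (cball 0 (real n)) x *\<^sub>R u x) \<longlonglongrightarrow> u x"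
    by (rule Lim_transform_eventually[OF tendsto_const])
qed

lemma logpot_cong_AE:
  assumes "finite_mass g"
    and gh: "AE w in lborel. g w = h w" "g \<in> borel_measurable borel" "h \<in> borel_measurable borel"
  shows "finite_mass.logpot g z = (\<integral>w. lker z w * h w \<partial>lborel) / kap"
proof -
  interpret finite_mass g by (rule assms(1))
  have "(\<integral>w. lker z w * g w \<partial>lborel) = (\<integral>w. lker z w * h w \<partial>lborel)"
  proof (rule integral_cong_AE)
    show "AE w in lborel. lker z w * g w = lker z w * h w" using gh(1) by eventually_elim simp
  qed (use gh in auto)
  then show ?thesis by (simp add: logpot_def)
qed

text \<open>The given function is only Lebesgue measurable and matters up to null sets. A Borel
  version u is equal to a constant plus the potential of its density almost everywhere. Replacing
  the density by |R|^2 times the exponential of that expression changes it on a null set, so the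
  potential stays the same and the equation now holds at every point.\<close>

lemma weak_solution_eq_logpot:
  fixes \<psi> :: "complex \<Rightarrow> real"
  assumes a: "a \<noteq> 0"
    and weak: "weak_solution_neg_laplacian \<psi> (\<lambda>z. (cmod (a * z^2 + b * z + c))^2 * exp (\<psi> z))"
    and fin: "(\<integral>\<^sup>+z. ennreal ((cmod (a * z^2 + b * z + c))^2 * exp (\<psi> z)) \<partial>lebesgue) < \<infinity>"
  obtains g c0 where "liouville g a b c c0" "AE z in lebesgue. \<psi> z = c0 + finite_mass.logpot g z"
proof -
  have L1: "L1_loc \<psi>" using weak by (simp add: weak_solution_neg_laplacian_def)
  obtain u where u [measurable]: "u \<in> borel_measurable lborel" and \<psi>u: "AE z in lborel. \<psi> z = u z"
    using completion_ex_borel_measurable_real[OF L1_loc_measurable[OF L1]] by blast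
  define r where "r z = (cmod (a * z^2 + b * z + c))^2" for z
  have r [measurable]: "r \<in> borel_measurable borel" unfolding r_def[abs_def] by measurable
  define g where "g z = r z * exp (u z)" for z
  have g [measurable]: "g \<in> borel_measurable borel" using u unfolding g_def by measurable
  have \<psi>u': "AE z in lebesgue. \<psi> z = u z" using \<psi>u by (rule AE_completion)
  have ulocal: "loc_int u"
    unfolding loc_int_def
  proof (intro conjI allI)
    show "u \<in> borel_measurable borel" using u by simp
    fix s
    have "integrable lebesgue (\<lambda>x. indicat_real (cball 0 s) x *\<^sub>R \<psi> x)"
      using L1 by (simp add: L1_loc_def set_integrable_def)
    then have "integrable lebesgue (\<lambda>x. indicat_real (cball 0 s) x * u x)"
      by (rule integrable_cong_AE_imp) (use \<psi>u' in \<open>auto simp: measurable_completion elim!: eventually_mono\<close>)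
    then show "integrable lborel (\<lambda>x. indicat_real (cball 0 s) x * u x)"
      by (subst (asm) integrable_completion) auto
  qed
  have "(\<integral>\<^sup>+z. ennreal (g z) \<partial>lborel) = (\<integral>\<^sup>+z. ennreal (g z) \<partial>lebesgue)"
    by (rule nn_integral_completion[symmetric])
  also have "\<dots> = (\<integral>\<^sup>+z. ennreal ((cmod (a * z^2 + b * z + c))^2 * exp (\<psi> z)) \<partial>lebesgue)"
    using \<psi>u' by (intro nn_integral_cong_AE) (auto simp: g_def r_def elim!: eventually_mono)
  finally have "(\<integral>\<^sup>+z. ennreal (g z) \<partial>lborel) < \<infinity>" using fin by simp
  then have gint: "integrable lborel g" by (intro integrableI_nonneg) (auto simp: g_def r_def)
  interpret finite_mass g
    by unfold_locales (use gint in \<open>auto simp: g_def r_def\<close>)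
  obtain \<rho> where \<rho>: "\<rho> \<ge> 1" "\<And>z. cmod z \<ge> \<rho> \<Longrightarrow> cmod (a * z\<^sup>2 + b * z + c) \<ge> cmod a / 2 * (cmod z)\<^sup>2"
    using quadratic_lower[OF a] by blast
  \<comment> \<open>Past this radius |R| >= 1: the lower bound |a| |z|^2 / 2 is at least 1 as soon
    as |z| is at least 1 and 2 / |a|. There u <= e^u <= g.\<close>
  define \<rho>' where "\<rho>' = \<rho> + 2 / cmod a"
  have ug: "u w \<le> g w" if w: "cmod w \<ge> \<rho>'" for w
  proof -
    have "2 / cmod a \<ge> 0" by simp
    then have w1: "cmod w \<ge> \<rho>" "cmod w \<ge> 2 / cmod a" "cmod w \<ge> 1" using w \<rho>(1) unfolding \<rho>'_def by linarith+
    have "1 = cmod a / 2 * (2 / cmod a)" using a by simp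
    also have "\<dots> \<le> cmod a / 2 * cmod w" using w1 by (intro mult_left_mono) auto
    also have "\<dots> \<le> cmod a / 2 * (cmod w)\<^sup>2" using w1(3) by (intro mult_left_mono self_le_power) auto
    also have "\<dots> \<le> cmod (a * w\<^sup>2 + b * w + c)" by (rule \<rho>(2)[OF w1(1)])
    finally have "1 \<le> r w" unfolding r_def by (simp add: one_le_power)
    then have "1 * exp (u w) \<le> g w" unfolding g_def by (intro mult_right_mono) auto
    then show ?thesis using exp_ge_add_one_self[of "u w"] by linarith
  qed
  have "\<exists>c0. AE z in lborel. u z = c0 + logpot z"
  proof (rule weak_solution_representation[OF ulocal ug])
    fix \<phi> :: "complex \<Rightarrow> real" assume \<phi>: "test_function \<phi>"
    have [measurable]: "\<phi> \<in> borel_measurable borel" "laplacian \<phi> \<in> borel_measurable borel"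
      using test_function_measurable[OF \<phi>] continuous_measurable[OF laplacian_continuous[OF test_functionD(1)[OF \<phi>]]] by auto
    have "(\<integral>z. u z * laplacian \<phi> z \<partial>lborel) = (\<integral>z. u z * laplacian \<phi> z \<partial>lebesgue)"
      by (rule integral_completion[symmetric]) measurable
    also have "\<dots> = (\<integral>z. \<psi> z * laplacian \<phi> z \<partial>lebesgue)"
    proof (rule integral_cong_AE)
      show "(\<lambda>z. u z * laplacian \<phi> z) \<in> borel_measurable lebesgue"
        by (rule measurable_completion) measurable
      have [measurable]: "\<psi> \<in> borel_measurable lebesgue" by (rule L1_loc_measurable[OF L1])
      have [measurable]: "laplacian \<phi> \<in> borel_measurable lebesgue"
        by (rule measurable_completion) measurable
      show "(\<lambda>z. \<psi> z * laplacian \<phi> z) \<in> borel_measurable lebesgue" by measurable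
    qed (use \<psi>u' in \<open>auto elim!: eventually_mono\<close>)
    finally have 1: "(\<integral>z. u z * laplacian \<phi> z \<partial>lborel) = (\<integral>z. \<psi> z * laplacian \<phi> z \<partial>lebesgue)" .
    have "(\<integral>z. g z * \<phi> z \<partial>lborel) = (\<integral>z. g z * \<phi> z \<partial>lebesgue)"
      by (rule integral_completion[symmetric]) measurable
    also have "\<dots> = (\<integral>z. ((cmod (a * z^2 + b * z + c))^2 * exp (\<psi> z)) * \<phi> z \<partial>lebesgue)"
    proof (rule integral_cong_AE)
      show "(\<lambda>z. g z * \<phi> z) \<in> borel_measurable lebesgue"
        by (rule measurable_completion) measurable
      have [measurable]: "\<psi> \<in> borel_measurable lebesgue" by (rule L1_loc_measurable[OF L1])
      have [measurable]: "r \<in> borel_measurable lebesgue" "\<phi> \<in> borel_measurable lebesgue"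
        by (rule measurable_completion, measurable)+
      have "(\<lambda>z. (r z * exp (\<psi> z)) * \<phi> z) \<in> borel_measurable lebesgue" by measurable
      then show "(\<lambda>z. ((cmod (a * z^2 + b * z + c))^2 * exp (\<psi> z)) * \<phi> z) \<in> borel_measurable lebesgue"
        by (simp only: r_def)
      show "AE z in lebesgue. g z * \<phi> z = ((cmod (a * z^2 + b * z + c))^2 * exp (\<psi> z)) * \<phi> z"
        using \<psi>u' by eventually_elim (simp add: g_def r_def)
    qed
    finally show "- (\<integral>z. u z * laplacian \<phi> z \<partial>lborel) = (\<integral>z. g z * \<phi> z \<partial>lborel)"
      using weak \<phi> 1 by (simp add: weak_solution_neg_laplacian_def)
  qed
  then obtain c0 where c0: "AE z in lborel. u z = c0 + logpot z" by blast
  define h where "h z = r z * exp (c0 + logpot z)" for z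
  have lp [measurable]: "logpot \<in> borel_measurable borel" using loc_int_logpot by (simp add: loc_int_def)
  have h [measurable]: "h \<in> borel_measurable borel" unfolding h_def by measurable
  have gh: "AE w in lborel. g w = h w" using c0 by eventually_elim (simp add: g_def h_def)
  have "integrable lborel h" using gint gh by (subst integrable_cong_AE[of h _ g]) (auto elim!: eventually_mono)
  then have hm: "finite_mass h" by unfold_locales (auto simp: h_def r_def)
  have eq: "finite_mass.logpot h z = logpot z" for z
  proof -
    have "logpot z = (\<integral>w. lker z w * h w \<partial>lborel) / kap"
      by (rule logpot_cong_AE[OF _ gh g h]) unfold_locales
    then show ?thesis by (simp add: finite_mass.logpot_def[OF hm])
  qed
  show thesis
  proof (rule that[of h c0])
    show "liouville h a b c c0"
      unfolding liouville_def liouville_axioms_def using hm a by (auto simp: eq h_def r_def)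
    have "AE z in lebesgue. u z = c0 + logpot z" using c0 by (rule AE_completion)
    with \<psi>u' show "AE z in lebesgue. \<psi> z = c0 + finite_mass.logpot h z"
      by eventually_elim (simp add: eq)
  qed
qed

text \<open>The formula is asserted almost everywhere, because a distributional solution is
  determined only up to null sets.\<close>

theorem corollary2p17:
  fixes a b c :: complex and \<psi> :: "complex \<Rightarrow> real"
  assumes "a \<noteq> 0"
    and "L1_loc \<psi>"
    and "weak_solution_neg_laplacian \<psi>
           (\<lambda>z. (cmod (a * z^2 + b * z + c))^2 * exp (\<psi> z))"
    and "(\<integral>\<^sup>+z. ennreal ((cmod (a * z^2 + b * z + c))^2 * exp (\<psi> z)) \<partial>lebesgue) < \<infinity>"
  shows "\<exists>(P0 :: complex poly) (Q0 :: complex poly) (P :: complex poly) (Q :: complex poly)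
            (lam :: complex) (mu :: complex).
           lam \<noteq> 0
         \<and> ((P0 = [:0, c, b / 2, a / 3:] \<and> Q0 = 1)
            \<or> (c \<noteq> b^2 / (4 * a) \<and> P0 = [:- c / a, 0, 1:] \<and> Q0 = [:b / 2, a:]))
         \<and> P = smult lam P0 + smult mu Q0
         \<and> Q = smult (1 / lam) Q0
         \<and> (AE z in lebesgue.
              \<psi> z = ln 8 - 2 * ln ((cmod (poly P z))^2 + (cmod (poly Q z))^2))"
proof -
  obtain g c0 where g: "liouville g a b c c0" and \<psi>: "AE z in lebesgue. \<psi> z = c0 + finite_mass.logpot g z"
    using weak_solution_eq_logpot[OF assms(1,3,4)] by blast
  interpret liouville g a b c c0 by (rule g)
  obtain P0 Q0 P Q :: "complex poly" and lam mu :: complex where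
    "lam \<noteq> 0" "(P0 = [:0, c, b / 2, a / 3:] \<and> Q0 = 1)
            \<or> (c \<noteq> b^2 / (4 * a) \<and> P0 = [:- c / a, 0, 1:] \<and> Q0 = [:b / 2, a:])"
    "P = smult lam P0 + smult mu Q0" "Q = smult (1 / lam) Q0"
    and form: "\<And>z. c0 + logpot z = ln 8 - 2 * ln ((cmod (poly P z))^2 + (cmod (poly Q z))^2)"
    using classification by blast
  moreover have "AE z in lebesgue. \<psi> z = ln 8 - 2 * ln ((cmod (poly P z))^2 + (cmod (poly Q z))^2)"
    using \<psi> unfolding form .
  ultimately show ?thesis by blast
qed

end
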